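(* Let $K$ be a field of characteristic zero, $n\ge1$, and let $\mathbb{A}_n$ be the Jacobian algebra. With the notation of the context: 1. ${}'\Delta_n\in\mathrm{Den}_l(\mathbb{A}_n,\mathfrak{a}_n)$ and ${}'\Delta_n^{-1}\mathbb{A}_n\simeq{}'Q(\mathbb{A}_n)$. Furthermore, ${}'\Delta_n$ is a left denominator set of $\mathbb{A}_n$ which is the largest left denominator set of $\mathbb{A}_n$ contained in the multiplicative set ${}'\mathcal{C}_{\mathbb{A}_n}\cap\Delta_n$. 2. ${}'\Delta_n+\mathfrak{a}_n,\ {}'S(\mathbb{A}_n)+\mathfrak{a}_n\in\mathrm{Den}_l(\mathbb{A}_n,\mathfrak{a}_n)$ and $({}'\Delta_n+\mathfrak{a}_n)^{-1}\mathbb{A}_n\simeq({}'S(\mathbb{A}_n)+\mathfrak{a}_n)^{-1}\mathbb{A}_n\simeq{}'Q(\mathbb{A}_n)$. 3. ${}'\Delta_n=\overline{{}'\Delta_n},\ \overline{{}'\Delta_n+\mathfrak{a}_n},\ \overline{{}'S(\mathbb{A}_n)+\mathfrak{a}_n}\in\mathrm{Den}_l(\mathcal{A}_n,0)$ and ${}'\Delta_n^{-1}\mathcal{A}_n\simeq\overline{{}'\Delta_n+\mathfrak{a}_n}^{\,-1}\mathcal{A}_n\simeq\overline{{}'S(\mathbb{A}_n)+\mathfrak{a}_n}^{\,-1}\mathcal{A}_n\simeq{}'Q(\mathbb{A}_n)$. 4. $\widetilde{{}'\Delta_n}\in\mathrm{Den}_l(\mathbb{A}_n,\mathfrak{a}_n)$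 and $\widetilde{{}'\Delta_n}^{-1}\mathbb{A}_n\simeq{}'Q(\mathbb{A}_n)$; also $\overline{\widetilde{{}'\Delta_n}}\in\mathrm{Den}_l(\mathcal{A}_n,0)$ and $\overline{\widetilde{{}'\Delta_n}}^{\,-1}\mathcal{A}_n\simeq{}'Q(\mathbb{A}_n)$. 5. $\widetilde{{}'\Delta_n}+\mathfrak{a}_n\in\mathrm{Den}_l(\mathbb{A}_n,\mathfrak{a}_n)$ and $(\widetilde{{}'\Delta_n}+\mathfrak{a}_n)^{-1}\mathbb{A}_n\simeq{}'Q(\mathbb{A}_n)$. 6. ${}'\Delta_n\in\mathrm{Den}_l(\Delta_n,0)$ and ${}'\Delta_n^{-1}\Delta_n\simeq{}'Q(\mathbb{A}_n)$. 7. ${}''\Delta_n:=\big({}'S(\mathbb{A}_n)\cap({}'\mathcal{C}_{\Delta_n+\mathfrak{a}_n}+\mathfrak{a}_n)\big)+\mathfrak{a}_n\in\mathrm{Den}_l(\mathbb{A}_n,\mathfrak{a}_n)$, ${}'\Delta_n\subseteq{}''\Delta_n$ and ${}''\Delta_n^{-1}\mathbb{A}_n\simeq{}'Q(\mathbb{A}_n)$.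
   Context: Localization. All rings are unital. A subset $S$ of a ring $R$ is multiplicative if $1\in S$, $SS\subseteq S$, $0\notin S$. A multiplicative set $S$ is a left Ore set if $Sr\cap Rs\neq\emptyset$ for all $r\in R$, $s\in S$; put $\mathrm{ass}_l(S)=\{r\in R\mid sr=0\text{ for some }s\in S\}$. A left Ore set $S$ is a left denominator set if $rs=0$ with $r\in R$, $s\in S$ implies $tr=0$ for some $t\in S$. $\mathrm{Den}_l(R,\mathfrak{a})$ is the set of left denominator sets $S$ of $R$ with $\mathrm{ass}_l(S)=\mathfrak{a}$, and $S^{-1}R$ is the left localization. ${}'\mathcal{C}_R=\{c\in R\mid rc=0\Rightarrow r=0\}$ is the set of left regular elements of $R$; it contains a largest left denominator set of $R$, denoted ${}'S(R)$, and ${}'Q(R):={}'S(R)^{-1}R$. The symbol $\simeq$ denotes isomorphism of $K$-algebras. The Jacobian algebra. Let $P_n=K[x_1,\ldots,x_n]$. $\mathbb{A}_n$ is the subalgebra of $\mathrm{End}_K(P_n)$ generated by the multiplications by $x_i$, the derivatives $\partial_i=\frac{\partial}{\partial x_i}$ and the inverses $H_i^{-1}$ of the maps $H_i:=\partial_ix_i$, $i=1,\ldots,n$; $\mathbb{A}_n\simeq\mathbb{A}_1^{\otimes n}$. The algebra $\mathbb{A}_1$ has a unique proper nonzero ideal $F=\bigoplus_{i,j\ge0}KE_{ij}$, where $E_{ij}\in\mathrm{End}_K(K[x])$, $E_{ij}(x^k)=\delta_{jk}x^i$. Let $\mathfrak{p}_i=\mathbb{A}_1^{\otimes(i-1)}\otimes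 F\otimes\mathbb{A}_1^{\otimes(n-i)}$ and $\mathfrak{a}_n=\mathfrak{p}_1+\cdots+\mathfrak{p}_n$. The factor algebra $\mathcal{A}_n:=\mathbb{A}_n/\mathfrak{a}_n$ is the skew Laurent polynomial algebra $\mathcal{L}_n[\partial_1^{\pm1},\ldots,\partial_n^{\pm1};\tau_1,\ldots,\tau_n]$, where $\mathcal{L}_n=K[H_i^{\pm1},(H_i\pm1)^{-1},(H_i\pm2)^{-1},\ldots\mid i=1,\ldots,n]$, $\tau_i(H_j)=H_j+\delta_{ij}$, $\partial_ih=\tau_i(h)\partial_i$. $\Delta_n:=\mathcal{L}_n^+[\partial_1,\ldots,\partial_n;\tau_1,\ldots,\tau_n]$ is the subalgebra of $\mathbb{A}_n$ generated by $\mathcal{L}_n^+=K[H_i^{\pm1},(H_i+1)^{-1},(H_i+2)^{-1},\ldots\mid i=1,\ldots,n]$ and $\partial_1,\ldots,\partial_n$ (a skew polynomial ring); it meets $\mathfrak{a}_n$ only in $0$ and is identified with its image in $\mathcal{A}_n$. For a subset $S\subseteq\mathbb{A}_n$, $\overline{S}$ is its image under $\pi_{\mathfrak{a}_n}:\mathbb{A}_n\to\mathcal{A}_n$. Sets: ${}'\Delta_n:=\Delta_n\cap{}'S(\mathbb{A}_n)$ and $\widetilde{{}'\Delta_n}:=\{c\in\Delta_n\mid\partial^\alpha c\in{}'S(\mathbb{A}_n)\text{ for some }\alpha\in\mathbb{N}^n\}$, where $\partial^\alpha=\partial_1^{\alpha_1}\cdots\partial_n^{\alpha_n}$. ${}'\mathcal{C}_{\Delta_n+\mathfrak{a}_n}$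 is the set of left regular elements of the ring $\Delta_n+\mathfrak{a}_n$. For subsets, $S+\mathfrak{a}_n=\{s+a\mid s\in S,a\in\mathfrak{a}_n\}$. *)

theory Defs
  imports "HOL-Algebra.QuotRing" "HOL-Algebra.Module" "HOL-Algebra.Subrings"
    "HOL-Library.Poly_Mapping"
begin

section \<open>Algebras over a field\<close>

text \<open>
  A \<open>K\<close>-algebra is a ring record extended by a scalar multiplication, i.e. a \<^typ>\<open>('k, 'a) module\<close>
  record; the field \<open>K\<close> is the type \<open>'k\<close>. A subalgebra \<open>B\<close> of \<open>A\<close>, viewed as an algebra in its
  own right, is \<open>A\<lparr>carrier := B\<rparr>\<close>.
\<close>

definition subspace_of :: "('k, 'a) module \<Rightarrow> 'a set \<Rightarrow> bool" where
  "subspace_of A V \<longleftrightarrow> additive_subgroup V A \<and> (\<forall>c. \<forall>v\<in>V. c \<odot>\<^bsub>A\<^esub> v \<in> V)"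

definition subalgebra_of :: "('k, 'a) module \<Rightarrow> 'a set \<Rightarrow> bool" where
  "subalgebra_of A B \<longleftrightarrow> subring B A \<and> (\<forall>c. \<forall>v\<in>B. c \<odot>\<^bsub>A\<^esub> v \<in> B)"

definition quot_algebra :: "('k, 'a) module \<Rightarrow> 'a set \<Rightarrow> ('k, 'a set) module" where
  "quot_algebra A I = ring.extend (A Quot I)
     (module.fields (\<lambda>c U. \<Union>x\<in>U. I +>\<^bsub>A\<^esub> (c \<odot>\<^bsub>A\<^esub> x)))"

definition alg_isomorphic :: "('k, 'a) module \<Rightarrow> ('k, 'b) module \<Rightarrow> bool"
    (infix \<open>\<simeq>\<^sub>K\<close> 60) where
  "A \<simeq>\<^sub>K B \<longleftrightarrow>
     (\<exists>h\<in>ring_iso A B. \<forall>c. \<forall>x\<in>carrier A. h (c \<odot>\<^bsub>A\<^esub> x) = c \<odot>\<^bsub>B\<^esub> h x)"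


section \<open>Left denominator sets and left localization\<close>

definition multiplicative :: "('a, 'm) ring_scheme \<Rightarrow> 'a set \<Rightarrow> bool" where
  "multiplicative R S \<longleftrightarrow> S \<subseteq> carrier R \<and> \<one>\<^bsub>R\<^esub> \<in> S \<and>
     (\<forall>s\<in>S. \<forall>t\<in>S. s \<otimes>\<^bsub>R\<^esub> t \<in> S) \<and> \<zero>\<^bsub>R\<^esub> \<notin> S"

text \<open>\<open>S #>\<^bsub>R\<^esub> r\<close> is the set \<open>Sr\<close>.\<close>

definition left_Ore :: "('a, 'm) ring_scheme \<Rightarrow> 'a set \<Rightarrow> bool" where
  "left_Ore R S \<longleftrightarrow> multiplicative R S \<and>
     (\<forall>r\<in>carrier R. \<forall>s\<in>S. (S #>\<^bsub>R\<^esub> r) \<inter> (carrier R #>\<^bsub>R\<^esub> s) \<noteq> {})"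

definition ass_l :: "('a, 'm) ring_scheme \<Rightarrow> 'a set \<Rightarrow> 'a set" where
  "ass_l R S = {r \<in> carrier R. \<exists>s\<in>S. s \<otimes>\<^bsub>R\<^esub> r = \<zero>\<^bsub>R\<^esub>}"

definition left_denominator :: "('a, 'm) ring_scheme \<Rightarrow> 'a set \<Rightarrow> bool" where
  "left_denominator R S \<longleftrightarrow> left_Ore R S \<and>
     (\<forall>r\<in>carrier R. \<forall>s\<in>S. r \<otimes>\<^bsub>R\<^esub> s = \<zero>\<^bsub>R\<^esub> \<longrightarrow> (\<exists>t\<in>S. t \<otimes>\<^bsub>R\<^esub> r = \<zero>\<^bsub>R\<^esub>))"

definition Den_l :: "('a, 'm) ring_scheme \<Rightarrow> 'a set \<Rightarrow> 'a set set" where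
  "Den_l R I = {S. left_denominator R S \<and> ass_l R S = I}"

definition largest_left_den_in :: "('a, 'm) ring_scheme \<Rightarrow> 'a set \<Rightarrow> 'a set \<Rightarrow> bool" where
  "largest_left_den_in R C S \<longleftrightarrow> left_denominator R S \<and> S \<subseteq> C \<and>
     (\<forall>T. left_denominator R T \<and> T \<subseteq> C \<longrightarrow> T \<subseteq> S)"

definition left_regular :: "('a, 'm) ring_scheme \<Rightarrow> 'a set" where
  "left_regular R = {c \<in> carrier R. \<forall>r\<in>carrier R. r \<otimes>\<^bsub>R\<^esub> c = \<zero>\<^bsub>R\<^esub> \<longrightarrow> r = \<zero>\<^bsub>R\<^esub>}"

definition prime_S :: "('a, 'm) ring_scheme \<Rightarrow> 'a set" where
  "prime_S R = (THE S. largest_left_den_in R (left_regular R) S)"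

text \<open>
  The localization \<open>S\<^sup>-\<^sup>1A\<close> consists of the left fractions \<open>s\<^sup>-\<^sup>1r\<close>, which are the classes of the pairs
  \<open>(s, r)\<close> under Ore's relation. As for \<^const>\<open>rcoset_mult\<close>, each operation on classes is the
  union of the results over all choices (of representatives and of the elements provided by the
  Ore condition); for a left denominator set \<open>S\<close> all these results coincide:
  \<open>s\<^sup>-\<^sup>1r + t\<^sup>-\<^sup>1q = (cs)\<^sup>-\<^sup>1(cr + dq)\<close> if \<open>cs = dt \<in> S\<close>, and
  \<open>s\<^sup>-\<^sup>1r \<cdot> t\<^sup>-\<^sup>1q = (us)\<^sup>-\<^sup>1(aq)\<close> if \<open>ur = at\<close> with \<open>u \<in> S\<close>.
\<close>

definition frac_rel :: "('a, 'm) ring_scheme \<Rightarrow> 'a set \<Rightarrow> (('a \<times> 'a) \<times> ('a \<times> 'a)) set" where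
  "frac_rel R S = {((s, r), (t, q)). s \<in> S \<and> r \<in> carrier R \<and> t \<in> S \<and> q \<in> carrier R \<and>
     (\<exists>c\<in>carrier R. \<exists>d\<in>carrier R.
        c \<otimes>\<^bsub>R\<^esub> s = d \<otimes>\<^bsub>R\<^esub> t \<and> c \<otimes>\<^bsub>R\<^esub> s \<in> S \<and> c \<otimes>\<^bsub>R\<^esub> r = d \<otimes>\<^bsub>R\<^esub> q)}"

definition left_frac :: "('a, 'm) ring_scheme \<Rightarrow> 'a set \<Rightarrow> 'a \<Rightarrow> 'a \<Rightarrow> ('a \<times> 'a) set" where
  "left_frac R S s r = frac_rel R S `` {(s, r)}"

definition localization :: "('k, 'a) module \<Rightarrow> 'a set \<Rightarrow> ('k, ('a \<times> 'a) set) module" where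
  "localization A S =
     \<lparr>carrier = (S \<times> carrier A) // frac_rel A S,
      mult = (\<lambda>U V. \<Union>{left_frac A S (u \<otimes>\<^bsub>A\<^esub> s) (a \<otimes>\<^bsub>A\<^esub> q) | s r t q u a.
        (s, r) \<in> U \<and> (t, q) \<in> V \<and> u \<in> S \<and> a \<in> carrier A \<and> u \<otimes>\<^bsub>A\<^esub> r = a \<otimes>\<^bsub>A\<^esub> t}),
      one = left_frac A S \<one>\<^bsub>A\<^esub> \<one>\<^bsub>A\<^esub>,
      zero = left_frac A S \<one>\<^bsub>A\<^esub> \<zero>\<^bsub>A\<^esub>,
      add = (\<lambda>U V. \<Union>{left_frac A S (c \<otimes>\<^bsub>A\<^esub> s) ((c \<otimes>\<^bsub>A\<^esub> r) \<oplus>\<^bsub>A\<^esub> (d \<otimes>\<^bsub>A\<^esub> q)) | s r t q c d.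
        (s, r) \<in> U \<and> (t, q) \<in> V \<and> c \<in> carrier A \<and> d \<in> carrier A \<and>
        c \<otimes>\<^bsub>A\<^esub> s = d \<otimes>\<^bsub>A\<^esub> t \<and> c \<otimes>\<^bsub>A\<^esub> s \<in> S}),
      smult = (\<lambda>k U. \<Union>{left_frac A S s (k \<odot>\<^bsub>A\<^esub> r) | s r. (s, r) \<in> U})\<rparr>"

definition prime_Q :: "('k, 'a) module \<Rightarrow> ('k, ('a \<times> 'a) set) module" where
  "prime_Q A = localization A (prime_S A)"


section \<open>Polynomials and their linear endomorphisms\<close>

text \<open>
  \<open>P\<^sub>n = K[x\<^sub>i | i \<in> 'n]\<close>, where the finite nonempty type \<open>'n\<close> indexes the variables (so
  \<open>n = CARD('n) \<ge> 1\<close>): the finitely supported functions from exponent vectors to coefficients.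
\<close>

type_synonym ('n, 'k) pol = "('n \<Rightarrow>\<^sub>0 nat) \<Rightarrow>\<^sub>0 'k"

type_synonym ('n, 'k) pol_op = "('n, 'k) pol \<Rightarrow> ('n, 'k) pol"

definition pscale :: "'k::comm_ring_1 \<Rightarrow> ('n, 'k) pol \<Rightarrow> ('n, 'k) pol" where
  "pscale c p = Poly_Mapping.single 0 c * p"

definition xpow :: "('n \<Rightarrow>\<^sub>0 nat) \<Rightarrow> ('n, 'k::comm_ring_1) pol" where
  "xpow m = Poly_Mapping.single m 1"

text \<open>The linear map sending each monomial \<open>x\<^sup>m\<close> to \<open>g m\<close>.\<close>

definition lin_ext :: "(('n \<Rightarrow>\<^sub>0 nat) \<Rightarrow> ('m, 'k::comm_ring_1) pol) \<Rightarrow> ('n, 'k) pol \<Rightarrow> ('m, 'k) pol" where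
  "lin_ext g p = (\<Sum>m\<in>Poly_Mapping.keys p. pscale (Poly_Mapping.lookup p m) (g m))"

definition End_alg :: "('k::field_char_0, ('n, 'k) pol_op) module" where
  "End_alg =
     \<lparr>carrier = {f. (\<forall>p q. f (p + q) = f p + f q) \<and> (\<forall>c p. f (pscale c p) = pscale c (f p))},
      mult = (\<circ>), one = id, zero = (\<lambda>p. 0), add = (\<lambda>f g p. f p + g p),
      smult = (\<lambda>c f p. pscale c (f p))\<rparr>"

definition opX :: "'n \<Rightarrow> ('n, 'k::field_char_0) pol_op" where
  "opX i p = xpow (Poly_Mapping.single i 1) * p"

definition opD :: "'n \<Rightarrow> ('n, 'k::field_char_0) pol_op" where
  "opD i = lin_ext (\<lambda>m. pscale (of_nat (Poly_Mapping.lookup m i)) (xpow (m - Poly_Mapping.single i 1)))"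

definition opH :: "'n \<Rightarrow> ('n, 'k::field_char_0) pol_op" where
  "opH i = opD i \<circ> opX i"

text \<open>\<open>opHinv i j\<close> is the inverse map of \<open>H\<^sub>i + j\<close>, which is bijective since \<open>K\<close> has characteristic zero.\<close>

definition opHinv :: "'n \<Rightarrow> nat \<Rightarrow> ('n, 'k::field_char_0) pol_op" where
  "opHinv i j = inv_into UNIV (\<lambda>p. opH i p + pscale (of_nat j) p)"

text \<open>\<open>\<partial>\<^sup>\<alpha>\<close>; the order of composition is irrelevant since the \<open>\<partial>\<^sub>i\<close> commute.\<close>

definition opD_pow :: "('n::finite \<Rightarrow> nat) \<Rightarrow> ('n, 'k::field_char_0) pol_op" where
  "opD_pow \<alpha> = Finite_Set.fold (\<lambda>i f. (opD i ^^ \<alpha> i) \<circ> f) id UNIV"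


section \<open>The Jacobian algebra\<close>

definition Jac :: "('k::field_char_0, ('n::finite, 'k) pol_op) module" where
  "Jac = End_alg\<lparr>carrier :=
     subalgebra_of End_alg hull (range opX \<union> range opD \<union> range (\<lambda>i. opHinv i 0))\<rparr>"

text \<open>
  \<open>A\<^sub>1\<close> is the Jacobian algebra over the index type \<^typ>\<open>unit\<close>, acting on \<open>K[x] = P\<^sub>1\<close>, and
  \<open>xpow (Poly_Mapping.single () k)\<close> is \<open>x\<^sup>k\<close>. \<open>unitE i j\<close> is \<open>E\<^sub>i\<^sub>j\<close>.
\<close>

definition unitE :: "nat \<Rightarrow> nat \<Rightarrow> (unit, 'k::field_char_0) pol_op" where
  "unitE i j = lin_ext (\<lambda>m. if Poly_Mapping.lookup m () = j then xpow (Poly_Mapping.single () i) else 0)"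

definition ideal_F :: "(unit, 'k::field_char_0) pol_op set" where
  "ideal_F = subspace_of End_alg hull {unitE i j | i j. True}"

text \<open>The substitution \<open>x \<mapsto> x\<^sub>i\<close> from \<open>K[x]\<close> to \<open>P\<^sub>n\<close>.\<close>

definition embed_var :: "'n \<Rightarrow> (unit, 'k::field_char_0) pol \<Rightarrow> ('n, 'k) pol" where
  "embed_var i = lin_ext (\<lambda>m. xpow (Poly_Mapping.single i (Poly_Mapping.lookup m ())))"

text \<open>
  The identification of \<open>a\<^sub>1 \<otimes> \<dots> \<otimes> a\<^sub>n\<close> with an endomorphism of \<open>P\<^sub>n = K[x]\<^sup>\<otimes>\<^sup>n\<close>:
  it sends \<open>x\<^sup>m = \<Prod>\<^sub>i x\<^sub>i\<^bsup>m i\<^esup>\<close> to the product of the polynomials \<open>a\<^sub>i(x\<^bsup>m i\<^esup>)\<close> evaluated at \<open>x\<^sub>i\<close>.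
\<close>

definition tensor_op ::
    "('n::finite \<Rightarrow> (unit, 'k::field_char_0) pol_op) \<Rightarrow> ('n, 'k) pol_op" where
  "tensor_op a = lin_ext (\<lambda>m. \<Prod>i\<in>UNIV.
     embed_var i (a i (xpow (Poly_Mapping.single () (Poly_Mapping.lookup m i)))))"

definition ideal_p :: "'n::finite \<Rightarrow> ('n, 'k::field_char_0) pol_op set" where
  "ideal_p i = subspace_of End_alg hull
     {tensor_op a | a. a i \<in> ideal_F \<and> (\<forall>j. j \<noteq> i \<longrightarrow> a j \<in> carrier Jac)}"

definition ideal_a :: "('n::finite, 'k::field_char_0) pol_op set" where
  "ideal_a = {\<lambda>p. \<Sum>i\<in>UNIV. f i p | f. \<forall>i. f i \<in> ideal_p i}"

definition Jac_bar :: "('k::field_char_0, ('n::finite, 'k) pol_op set) module" where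
  "Jac_bar = quot_algebra Jac ideal_a"

definition proj_a :: "('n::finite, 'k::field_char_0) pol_op \<Rightarrow> ('n, 'k) pol_op set" where
  "proj_a f = ideal_a +>\<^bsub>Jac\<^esub> f"

definition L_plus :: "('n::finite, 'k::field_char_0) pol_op set" where
  "L_plus = subalgebra_of Jac hull (range opH \<union> {opHinv i j | i j. True})"

definition Delta :: "('n::finite, 'k::field_char_0) pol_op set" where
  "Delta = subalgebra_of Jac hull (L_plus \<union> range opD)"

definition prime_Delta :: "('n::finite, 'k::field_char_0) pol_op set" where
  "prime_Delta = Delta \<inter> prime_S Jac"

definition tilde_Delta :: "('n::finite, 'k::field_char_0) pol_op set" where
  "tilde_Delta = {c \<in> Delta. \<exists>\<alpha>. opD_pow \<alpha> \<otimes>\<^bsub>Jac\<^esub> c \<in> prime_S Jac}"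

definition dprime_Delta :: "('n::finite, 'k::field_char_0) pol_op set" where
  "dprime_Delta =
     (prime_S Jac \<inter> (left_regular (Jac\<lparr>carrier := Delta <+>\<^bsub>Jac\<^esub> ideal_a\<rparr>) <+>\<^bsub>Jac\<^esub> ideal_a))
       <+>\<^bsub>Jac\<^esub> ideal_a"

end

theory Submission
  imports Defs "HOL-Computational_Algebra.Polynomial"
begin

text \<open>
  Let \<open>T\<close> be the set of all \<open>\<partial>\<^sup>\<alpha>\<close>. Everything follows from five properties of \<open>T\<close> and \<open>\<Delta>\<close>: the
  elements of \<open>T\<close> commute and are left regular in \<open>\<AA>\<close>, \<open>t\<Delta> \<subseteq> \<Delta>t\<close> for \<open>t \<in> T\<close>, every element of \<open>\<AA>\<close> is
  moved into \<open>\<Delta>\<close> by left multiplication with some \<open>t \<in> T\<close>, \<open>\<Delta>\<close> is a domain, and \<open>\<aa>\<close> is the left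
  annihilated set \<open>ass\<^sub>l(T)\<close>. They imply that \<open>T\<close> is a left denominator set contained in \<open>'S(\<AA>)\<close> and
  that \<open>\<aa>\<close> is completely prime, so \<open>ass\<^sub>l('S(\<AA>)) = \<aa>\<close>. The saturation
  \<open>{x. \<exists>t\<in>T. tx \<in> 'S(\<AA>)}\<close> is multiplicatively closed: if \<open>xt \<in> 'S(\<AA>)\<close> with \<open>t\<close> left regular, then \<open>x\<close> is
  left regular and satisfies the Ore condition with respect to \<open>'S(\<AA>)\<close>, whence \<open>x \<in> 'S(\<AA>)\<close> by
  maximality. Every multiplicatively closed set between \<open>'\<Delta>\<close> and the saturation then is a left
  denominator set with the same localization, and all sets of the theorem are of this kind.

  \<open>\<Delta>\<close> is a domain because the coefficients of its elements, as functions on exponent vectors, are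
  rational along coordinate lines, so two nonzero ones have a common point of nonvanishing. And
  \<open>\<aa> = ass\<^sub>l(T)\<close> because \<open>x\<^sub>i H\<^sub>i\<^sup>-\<^sup>1 \<partial>\<^sub>i = 1 - E\<^sub>0\<^sub>0\<close> in the \<open>i\<close>-th variable, so that
  \<open>\<partial>\<^sub>i r \<in> \<aa>\<close> implies \<open>r \<in> \<aa>\<close>.
\<close>

section \<open>Ore localization of algebras\<close>

text \<open>The obstacle is that \<partial>_i is surjective but not injective on polynomials. On the
  right of a product it can be cancelled, while on the left it annihilates the projection onto the
  polynomials free of x_i. Localization therefore has a nonzero kernel, and left cancellation is
  replaced by clearing: a factor from \<open>T\<close> is multiplied from the left until everything
  lies in the domain \<open>D\<close>. Two relations make this possible. Clearing ends in
  \<open>Delta\<close> because \<partial>_i x_i = H_i. Moving \<partial>_i to the right turns H_i +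
  j into H_i + j + 1 and never back, so inverses of H_i + j with j \<ge> 0 suffice for stability. A
  further obstacle is that \<open>Delta\<close> is given only as a generated algebra of operators,
  without a normal form for its elements; that it is a domain is read off from the action on
  monomials. All localizations at subsets of \<open>A\<close> are compared through the smallest
  admissible set \<open>D'\<close>, by one criterion for a homomorphism to induce an
  isomorphism.\<close>

locale k_algebra = ring A for A :: "('k, 'a) module" (structure) +
  assumes smult_closed [simp]: "x \<in> carrier A \<Longrightarrow> c \<odot> x \<in> carrier A"
    and mult_smult: "\<lbrakk>x \<in> carrier A; y \<in> carrier A\<rbrakk> \<Longrightarrow> x \<otimes> (c \<odot> y) = c \<odot> (x \<otimes> y)"
    and smult_add: "\<lbrakk>x \<in> carrier A; y \<in> carrier A\<rbrakk> \<Longrightarrow> c \<odot> (x \<oplus> y) = c \<odot> x \<oplus> c \<odot> y"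

locale left_den = k_algebra +
  fixes S
  assumes den: "left_denominator A S"
begin

lemma S_multiplicative: "multiplicative A S"
  using den by (simp add: left_denominator_def left_Ore_def)

lemma S_carrier [simp]: "s \<in> S \<Longrightarrow> s \<in> carrier A"
  using S_multiplicative by (auto simp: multiplicative_def)

lemma S_one [simp]: "\<one> \<in> S"
  using S_multiplicative by (auto simp: multiplicative_def)

lemma S_mult [simp]: "\<lbrakk>s \<in> S; t \<in> S\<rbrakk> \<Longrightarrow> s \<otimes> t \<in> S"
  using S_multiplicative by (auto simp: multiplicative_def)

lemma ore:
  assumes "r \<in> carrier A" "s \<in> S"
  obtains u a where "u \<in> S" "a \<in> carrier A" "u \<otimes> r = a \<otimes> s"
proof -
  have "(S #> r) \<inter> (carrier A #> s) \<noteq> {}"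
    using den assms by (auto simp: left_denominator_def left_Ore_def)
  with that show ?thesis unfolding r_coset_def by auto
qed

text \<open>The denominator condition for \<open>r - q\<close>: a common right factor from
  \<open>S\<close> is traded for a common left factor from \<open>S\<close>. This replaces
  cancellation, since \<open>S\<close> may contain zero divisors.\<close>

lemma cancel_right:
  assumes "r \<in> carrier A" "q \<in> carrier A" "s \<in> S" "r \<otimes> s = q \<otimes> s"
  obtains v where "v \<in> S" "v \<otimes> r = v \<otimes> q"
proof -
  have "(r \<ominus> q) \<otimes> s = \<zero>"
    using assms by (simp add: minus_eq l_distr l_minus r_neg)
  then obtain v where v: "v \<in> S" "v \<otimes> (r \<ominus> q) = \<zero>"
    using den assms unfolding left_denominator_def by (meson minus_closed)
  have "v \<otimes> r = v \<otimes> q"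
    using v(2) assms(1,2) S_carrier[OF v(1)] by (simp add: minus_eq r_distr r_minus minus_equality
        minus_unique r_right_minus_eq[unfolded minus_eq])
  with that v(1) show ?thesis by blast
qed

text \<open>The multipliers in \<open>frac_rel\<close> satisfy only \<open>b s \<in> S\<close>, so
  the Ore condition does not apply to \<open>b\<close> itself. It is applied to \<open>a s\<close>
  and \<open>b s\<close>, and the factor \<open>s\<close> is then removed by
  \<open>cancel_right\<close>.\<close>

lemma common_left_multiple:
  assumes "a \<in> carrier A" "b \<in> carrier A" "s \<in> S" "b \<otimes> s \<in> S"
  obtains e f where "e \<in> S" "f \<in> carrier A" "e \<otimes> a = f \<otimes> b"
proof -
  obtain u x where u: "u \<in> S" "x \<in> carrier A" "u \<otimes> (a \<otimes> s) = x \<otimes> (b \<otimes> s)"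
    using ore[of "a \<otimes> s" "b \<otimes> s"] assms by auto
  have "(u \<otimes> a) \<otimes> s = (x \<otimes> b) \<otimes> s" using u assms(1-3) by (simp add: m_assoc)
  then obtain v where v: "v \<in> S" "v \<otimes> (u \<otimes> a) = v \<otimes> (x \<otimes> b)"
    using cancel_right[of "u \<otimes> a" "x \<otimes> b" s] u(1,2) assms by auto
  then have "(v \<otimes> u) \<otimes> a = (v \<otimes> x) \<otimes> b"
    using u(1,2) assms by (simp add: m_assoc)
  then show ?thesis
    using that[of "v \<otimes> u" "v \<otimes> x"] v(1) u(1,2) by simp
qed

section \<open>Classes of left fractions and the operations on them\<close>

abbreviation "fr \<equiv> left_frac A S"
abbreviation "Loc \<equiv> localization A S"

lemma frac_rel_iff:
  "((s, r), (t, q)) \<in> frac_rel A S \<longleftrightarrow> s \<in> S \<and> r \<in> carrier A \<and> t \<in> S \<and> q \<in> carrier A \<and>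
     (\<exists>c\<in>carrier A. \<exists>d\<in>carrier A. c \<otimes> s = d \<otimes> t \<and> c \<otimes> s \<in> S \<and> c \<otimes> r = d \<otimes> q)"
  by (simp add: frac_rel_def)

lemma equiv_frac_rel: "equiv (S \<times> carrier A) (frac_rel A S)"
proof (rule equivI)
  show "frac_rel A S \<subseteq> (S \<times> carrier A) \<times> (S \<times> carrier A)"
    by (auto simp: frac_rel_def)
  show "refl_on (S \<times> carrier A) (frac_rel A S)"
    by (rule refl_onI) (auto simp: frac_rel_def intro!: bexI[of _ \<one>])
  show "sym (frac_rel A S)"
    by (rule symI) (force simp: frac_rel_def)
  show "trans (frac_rel A S)"
  proof (rule transI, clarify)
    fix s r t q w p
    assume 1: "((s, r), (t, q)) \<in> frac_rel A S" and 2: "((t, q), (w, p)) \<in> frac_rel A S"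
    from 1 obtain c d where c: "s \<in> S" "r \<in> carrier A" "t \<in> S" "q \<in> carrier A" "c \<in> carrier A"
      "d \<in> carrier A" "c \<otimes> s = d \<otimes> t" "c \<otimes> s \<in> S" "c \<otimes> r = d \<otimes> q"
      unfolding frac_rel_iff by blast
    from 2 obtain c' d' where c': "w \<in> S" "p \<in> carrier A" "c' \<in> carrier A"
      "d' \<in> carrier A" "c' \<otimes> t = d' \<otimes> w" "c' \<otimes> t \<in> S" "c' \<otimes> q = d' \<otimes> p"
      unfolding frac_rel_iff by blast
    \<comment> \<open>The two equivalences meet at \<open>t\<close>: once \<open>d\<close> is
      matched with \<open>c'\<close>, the multipliers \<open>e c\<close> and \<open>f d'\<close>
      expand \<open>(s, r)\<close> and \<open>(w, p)\<close> to the same pair.\<close>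
    obtain e f where e: "e \<in> S" "f \<in> carrier A" "e \<otimes> d = f \<otimes> c'"
      using common_left_multiple[of d c' t] c c' by auto
    have mid: "e \<otimes> (c \<otimes> x) = f \<otimes> (d' \<otimes> z)"
      if "x \<in> carrier A" "y \<in> carrier A" "z \<in> carrier A" "c \<otimes> x = d \<otimes> y" "c' \<otimes> y = d' \<otimes> z" for x y z
      using e(1,2) c c' that m_assoc[of e d y, symmetric] m_assoc[of f c' y] e(3) by simp
    have "e \<otimes> c \<otimes> s = f \<otimes> d' \<otimes> w" "e \<otimes> c \<otimes> r = f \<otimes> d' \<otimes> p"
      using mid[of s t w] mid[of r q p] e(1,2) c c' by (simp_all add: m_assoc)
    moreover have "e \<otimes> c \<otimes> s \<in> S"
      using S_mult[OF e(1) c(8)] e(1) c(1,5) by (simp add: m_assoc)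
    ultimately show "((s, r), (w, p)) \<in> frac_rel A S"
      unfolding frac_rel_iff using c(1,2,5) c'(1,2,4) e(1,2)
      by (intro conjI bexI[of _ "e \<otimes> c"] bexI[of _ "f \<otimes> d'"]) auto
  qed
qed

lemma left_frac_eq_iff:
  assumes "s \<in> S" "r \<in> carrier A" "t \<in> S" "q \<in> carrier A"
  shows "fr s r = fr t q \<longleftrightarrow> ((s, r), (t, q)) \<in> frac_rel A S"
  unfolding left_frac_def
  by (rule eq_equiv_class_iff[OF equiv_frac_rel]) (use assms in auto)

lemma left_frac_expand:
  assumes "s \<in> S" "r \<in> carrier A" "c \<in> carrier A" "c \<otimes> s \<in> S"
  shows "fr (c \<otimes> s) (c \<otimes> r) = fr s r"
proof -
  have "((c \<otimes> s, c \<otimes> r), (s, r)) \<in> frac_rel A S"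
    unfolding frac_rel_iff using assms by (intro conjI bexI[of _ \<one>] bexI[of _ c]) auto
  then show ?thesis
    using assms by (simp add: left_frac_eq_iff)
qed

lemma mem_left_frac:
  assumes "(s', r') \<in> fr s r"
  obtains g h where "g \<in> carrier A" "h \<in> carrier A" "s \<in> S" "r \<in> carrier A" "s' \<in> S" "r' \<in> carrier A"
    "g \<otimes> s \<in> S" "h \<otimes> s' = g \<otimes> s" "h \<otimes> r' = g \<otimes> r"
  using assms unfolding left_frac_def frac_rel_def by auto

lemma self_mem_left_frac: "\<lbrakk>s \<in> S; r \<in> carrier A\<rbrakk> \<Longrightarrow> (s, r) \<in> fr s r"
  unfolding left_frac_def by (rule equiv_class_self[OF equiv_frac_rel]) auto

lemma carrier_localization:
  "carrier (Loc) = {fr s r | s r. s \<in> S \<and> r \<in> carrier A}"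
  by (auto simp: localization_def quotient_def left_frac_def)

text \<open>The multiplier \<open>u\<close> need not lie in \<open>S\<close>; this freedom lets one change representatives
  by changing multipliers only.\<close>

lemma left_frac_mult_indep_multiplier:
  assumes "s \<in> S" "r \<in> carrier A" "t \<in> S" "q \<in> carrier A"
    and "u \<in> carrier A" "u \<otimes> s \<in> S" "a \<in> carrier A" "u \<otimes> r = a \<otimes> t"
    and "u' \<in> carrier A" "u' \<otimes> s \<in> S" "a' \<in> carrier A" "u' \<otimes> r = a' \<otimes> t"
  shows "fr (u \<otimes> s) (a \<otimes> q) = fr (u' \<otimes> s) (a' \<otimes> q)"
proof -
  obtain e f where e: "e \<in> S" "f \<in> carrier A" "e \<otimes> u = f \<otimes> u'"
    using common_left_multiple[of u u' s] assms by auto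
  \<comment> \<open>\<open>e a\<close> and \<open>f a'\<close> agree only after multiplication by
    \<open>t\<close> on the right; a further left factor \<open>w\<close> makes them agree
    outright.\<close>
  have "(e \<otimes> a) \<otimes> t = (e \<otimes> u) \<otimes> r"
    using e(1) assms(1-8) by (simp add: m_assoc)
  also have "\<dots> = (f \<otimes> a') \<otimes> t"
    unfolding e(3) using e(2) assms by (simp add: m_assoc)
  finally obtain w where w: "w \<in> S" "w \<otimes> (e \<otimes> a) = w \<otimes> (f \<otimes> a')"
    using cancel_right[of "e \<otimes> a" "f \<otimes> a'" t] assms e(1,2) by auto
  have cl: "w \<otimes> e \<in> S" "w \<otimes> f \<in> carrier A" using w e by auto
  have s_eq: "(w \<otimes> e) \<otimes> (u \<otimes> s) = (w \<otimes> f) \<otimes> (u' \<otimes> s)"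
    using w(1) e assms(1,5,9) m_assoc[of e u s, symmetric] by (simp add: m_assoc)
  have "fr (u \<otimes> s) (a \<otimes> q)
      = fr ((w \<otimes> e) \<otimes> (u \<otimes> s)) ((w \<otimes> e) \<otimes> (a \<otimes> q))"
    using left_frac_expand[of "u \<otimes> s" "a \<otimes> q" "w \<otimes> e"] assms cl by simp
  also have "(w \<otimes> e) \<otimes> (a \<otimes> q) = (w \<otimes> (e \<otimes> a)) \<otimes> q"
    using w(1) e(1) assms by (simp add: m_assoc)
  also have "\<dots> = (w \<otimes> f) \<otimes> (a' \<otimes> q)"
    unfolding w(2) using w(1) e(2) assms by (simp add: m_assoc)
  also note s_eq
  also have "fr ((w \<otimes> f) \<otimes> (u' \<otimes> s)) ((w \<otimes> f) \<otimes> (a' \<otimes> q))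
      = fr (u' \<otimes> s) (a' \<otimes> q)"
    using left_frac_expand[of "u' \<otimes> s" "a' \<otimes> q" "w \<otimes> f"] assms cl s_eq[symmetric] by simp
  finally show ?thesis .
qed

lemma left_frac_mult_indep:
  assumes "(s', r') \<in> fr s r" "(t', q') \<in> fr t q"
    and "u \<in> carrier A" "u \<otimes> s \<in> S" "a \<in> carrier A" "u \<otimes> r = a \<otimes> t"
    and "u' \<in> carrier A" "u' \<otimes> s' \<in> S" "a' \<in> carrier A" "u' \<otimes> r' = a' \<otimes> t'"
  shows "fr (u' \<otimes> s') (a' \<otimes> q') = fr (u \<otimes> s) (a \<otimes> q)"
proof -
  obtain g g' where g: "g \<in> carrier A" "g' \<in> carrier A" "s \<in> S" "r \<in> carrier A" "s' \<in> S"
    "r' \<in> carrier A" "g \<otimes> s \<in> S" "g' \<otimes> s' = g \<otimes> s" "g' \<otimes> r' = g \<otimes> r"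
    using mem_left_frac[OF assms(1)] by metis
  obtain h h' where h: "h \<in> carrier A" "h' \<in> carrier A" "t \<in> S" "q \<in> carrier A" "t' \<in> S"
    "q' \<in> carrier A" "h \<otimes> t \<in> S" "h' \<otimes> t' = h \<otimes> t" "h' \<otimes> q' = h \<otimes> q"
    using mem_left_frac[OF assms(2)] by metis
  \<comment> \<open>Multipliers are chosen for the common expansions \<open>g s = g' s'\<close> and
    \<open>h t = h' t'\<close>. Composed with \<open>g\<close>, \<open>h\<close> or with
    \<open>g'\<close>, \<open>h'\<close> they serve both pairs of representatives, so both products
    equal the same fraction.\<close>
  obtain w b where w: "w \<in> S" "b \<in> carrier A" "w \<otimes> (g \<otimes> r) = b \<otimes> (h \<otimes> t)"
    using ore[of "g \<otimes> r" "h \<otimes> t"] g h by auto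
  have "fr (u \<otimes> s) (a \<otimes> q) = fr (w \<otimes> g \<otimes> s) (b \<otimes> h \<otimes> q)"
    by (rule left_frac_mult_indep_multiplier) (use assms g h w in \<open>auto simp: m_assoc\<close>)
  also have "w \<otimes> g \<otimes> s = w \<otimes> g' \<otimes> s'"
    using g w by (simp add: m_assoc)
  also have "b \<otimes> h \<otimes> q = b \<otimes> h' \<otimes> q'"
    using h w by (simp add: m_assoc)
  also have "fr (w \<otimes> g' \<otimes> s') (b \<otimes> h' \<otimes> q') = fr (u' \<otimes> s') (a' \<otimes> q')"
    by (rule left_frac_mult_indep_multiplier) (use assms g h w in \<open>auto simp: m_assoc\<close>)
  finally show ?thesis ..
qed

lemma mult_left_frac:
  assumes "s \<in> S" "r \<in> carrier A" "t \<in> S" "q \<in> carrier A" "u \<in> S" "a \<in> carrier A" "u \<otimes> r = a \<otimes> t"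
  shows "fr s r \<otimes>\<^bsub>Loc\<^esub> fr t q = fr (u \<otimes> s) (a \<otimes> q)"
proof -
  \<comment> \<open>All choices give one value, so the union in \<open>localization\<close> runs
    over a singleton family.\<close>
  have "{fr (u' \<otimes> s') (a' \<otimes> q') | s' r' t' q' u' a'.
      (s', r') \<in> fr s r \<and> (t', q') \<in> fr t q \<and>
      u' \<in> S \<and> a' \<in> carrier A \<and> u' \<otimes> r' = a' \<otimes> t'} = {fr (u \<otimes> s) (a \<otimes> q)}"
    (is "?X = ?Y")
  proof (rule antisym)
    show "?X \<subseteq> ?Y"
    proof clarsimp
      fix s' r' t' q' u' a'
      assume *: "(s', r') \<in> fr s r" "(t', q') \<in> fr t q"
        "u' \<in> S" "a' \<in> carrier A" "u' \<otimes> r' = a' \<otimes> t'"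
      have "s' \<in> S" using mem_left_frac[OF *(1)] by blast
      with * show "fr (u' \<otimes> s') (a' \<otimes> q') = fr (u \<otimes> s) (a \<otimes> q)"
        using assms by (intro left_frac_mult_indep) auto
    qed
    show "?Y \<subseteq> ?X"
      using self_mem_left_frac assms by blast
  qed
  then show ?thesis
    by (simp add: localization_def)
qed

lemma left_frac_add_indep_multiplier:
  assumes "s \<in> S" "r \<in> carrier A" "t \<in> S" "q \<in> carrier A"
    and "c \<in> carrier A" "d \<in> carrier A" "c \<otimes> s = d \<otimes> t" "c \<otimes> s \<in> S"
    and "c' \<in> carrier A" "d' \<in> carrier A" "c' \<otimes> s = d' \<otimes> t" "c' \<otimes> s \<in> S"
  shows "fr (c \<otimes> s) (c \<otimes> r \<oplus> d \<otimes> q) = fr (c' \<otimes> s) (c' \<otimes> r \<oplus> d' \<otimes> q)"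
proof -
  obtain e f where e: "e \<in> S" "f \<in> carrier A" "e \<otimes> c = f \<otimes> c'"
    using common_left_multiple[of c c' s] assms by auto
  have "(e \<otimes> d) \<otimes> t = (e \<otimes> c) \<otimes> s"
    using e(1) assms(1-7) by (simp add: m_assoc)
  also have "\<dots> = (f \<otimes> d') \<otimes> t"
    unfolding e(3) using e(2) assms(1-6,9-11) by (simp add: m_assoc)
  finally obtain w where w: "w \<in> S" "w \<otimes> (e \<otimes> d) = w \<otimes> (f \<otimes> d')"
    using cancel_right[of "e \<otimes> d" "f \<otimes> d'" t] assms e(1,2) by auto
  have wS: "w \<otimes> e \<in> S" using w e by auto
  have cl: "w \<otimes> e \<in> carrier A" "w \<otimes> f \<in> carrier A" using w e by auto
  have c_eq: "(w \<otimes> e) \<otimes> c = (w \<otimes> f) \<otimes> c'" and d_eq: "(w \<otimes> e) \<otimes> d = (w \<otimes> f) \<otimes> d'"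
    using w e assms(5,6,9,10) by (simp_all add: m_assoc)
  have s_eq: "(w \<otimes> e) \<otimes> (c \<otimes> s) = (w \<otimes> f) \<otimes> (c' \<otimes> s)"
    using c_eq cl assms(1,5,9) by (simp add: m_assoc[symmetric])
  have "fr (c \<otimes> s) (c \<otimes> r \<oplus> d \<otimes> q)
      = fr ((w \<otimes> e) \<otimes> (c \<otimes> s)) ((w \<otimes> e) \<otimes> (c \<otimes> r \<oplus> d \<otimes> q))"
    using left_frac_expand[of "c \<otimes> s" "c \<otimes> r \<oplus> d \<otimes> q" "w \<otimes> e"] assms wS by simp
  also have "(w \<otimes> e) \<otimes> (c \<otimes> r \<oplus> d \<otimes> q) = ((w \<otimes> e) \<otimes> c) \<otimes> r \<oplus> ((w \<otimes> e) \<otimes> d) \<otimes> q"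
    using cl assms(1-6) by (simp add: r_distr m_assoc)
  also have "\<dots> = (w \<otimes> f) \<otimes> (c' \<otimes> r \<oplus> d' \<otimes> q)"
    unfolding c_eq d_eq using cl assms(1-4,9,10) by (simp add: r_distr m_assoc)
  also note s_eq
  also have "fr ((w \<otimes> f) \<otimes> (c' \<otimes> s)) ((w \<otimes> f) \<otimes> (c' \<otimes> r \<oplus> d' \<otimes> q))
      = fr (c' \<otimes> s) (c' \<otimes> r \<oplus> d' \<otimes> q)"
    by (rule left_frac_expand) (use assms wS cl s_eq[symmetric] in auto)
  finally show ?thesis .
qed

lemma left_frac_add_indep:
  assumes "(s', r') \<in> fr s r" "(t', q') \<in> fr t q"
    and "c \<in> carrier A" "d \<in> carrier A" "c \<otimes> s = d \<otimes> t" "c \<otimes> s \<in> S"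
    and "c' \<in> carrier A" "d' \<in> carrier A" "c' \<otimes> s' = d' \<otimes> t'" "c' \<otimes> s' \<in> S"
  shows "fr (c' \<otimes> s') (c' \<otimes> r' \<oplus> d' \<otimes> q') = fr (c \<otimes> s) (c \<otimes> r \<oplus> d \<otimes> q)"
proof -
  obtain g g' where g: "g \<in> carrier A" "g' \<in> carrier A" "s \<in> S" "r \<in> carrier A" "s' \<in> S"
    "r' \<in> carrier A" "g \<otimes> s \<in> S" "g' \<otimes> s' = g \<otimes> s" "g' \<otimes> r' = g \<otimes> r"
    using mem_left_frac[OF assms(1)] by metis
  obtain h h' where h: "h \<in> carrier A" "h' \<in> carrier A" "t \<in> S" "q \<in> carrier A" "t' \<in> S"
    "q' \<in> carrier A" "h \<otimes> t \<in> S" "h' \<otimes> t' = h \<otimes> t" "h' \<otimes> q' = h \<otimes> q"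
    using mem_left_frac[OF assms(2)] by metis
  obtain w b where w: "w \<in> S" "b \<in> carrier A" "w \<otimes> (g \<otimes> s) = b \<otimes> (h \<otimes> t)"
    using ore[of "g \<otimes> s" "h \<otimes> t"] g h by auto
  have wgs: "w \<otimes> g \<otimes> s \<in> S"
    using S_mult[OF w(1) g(7)] w(1) g(1,3) by (simp add: m_assoc)
  have eq': "w \<otimes> g' \<otimes> s' = w \<otimes> g \<otimes> s" "w \<otimes> g' \<otimes> r' = w \<otimes> g \<otimes> r"
    "b \<otimes> h' \<otimes> q' = b \<otimes> h \<otimes> q" "b \<otimes> h' \<otimes> t' = b \<otimes> h \<otimes> t"
    using g h w(1,2) by (simp_all add: m_assoc)
  have eq: "w \<otimes> g \<otimes> s = b \<otimes> h \<otimes> t"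
    using g h w by (simp add: m_assoc)
  have "fr (c \<otimes> s) (c \<otimes> r \<oplus> d \<otimes> q)
      = fr (w \<otimes> g \<otimes> s) (w \<otimes> g \<otimes> r \<oplus> b \<otimes> h \<otimes> q)"
    by (rule left_frac_add_indep_multiplier) (use assms g h w wgs eq in auto)
  also have "\<dots> = fr (w \<otimes> g' \<otimes> s') (w \<otimes> g' \<otimes> r' \<oplus> b \<otimes> h' \<otimes> q')"
    unfolding eq' ..
  also have "\<dots> = fr (c' \<otimes> s') (c' \<otimes> r' \<oplus> d' \<otimes> q')"
  proof (rule left_frac_add_indep_multiplier)
    show "w \<otimes> g' \<otimes> s' = b \<otimes> h' \<otimes> t'" "w \<otimes> g' \<otimes> s' \<in> S"
      unfolding eq' using eq wgs by auto
  qed (use assms g h w in auto)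
  finally show ?thesis ..
qed

lemma add_left_frac:
  assumes "s \<in> S" "r \<in> carrier A" "t \<in> S" "q \<in> carrier A"
    and "c \<in> carrier A" "d \<in> carrier A" "c \<otimes> s = d \<otimes> t" "c \<otimes> s \<in> S"
  shows "fr s r \<oplus>\<^bsub>Loc\<^esub> fr t q
    = fr (c \<otimes> s) (c \<otimes> r \<oplus> d \<otimes> q)"
proof -
  have "{fr (c' \<otimes> s') (c' \<otimes> r' \<oplus> d' \<otimes> q') | s' r' t' q' c' d'.
      (s', r') \<in> fr s r \<and> (t', q') \<in> fr t q \<and>
      c' \<in> carrier A \<and> d' \<in> carrier A \<and> c' \<otimes> s' = d' \<otimes> t' \<and> c' \<otimes> s' \<in> S}
     = {fr (c \<otimes> s) (c \<otimes> r \<oplus> d \<otimes> q)}" (is "?X = ?Y")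
  proof (rule antisym)
    show "?X \<subseteq> ?Y"
      using assms left_frac_add_indep by blast
    show "?Y \<subseteq> ?X"
      using self_mem_left_frac assms by blast
  qed
  then show ?thesis
    by (simp add: localization_def)
qed

lemma smult_left_frac:
  assumes "s \<in> S" "r \<in> carrier A"
  shows "k \<odot>\<^bsub>Loc\<^esub> fr s r = fr s (k \<odot> r)"
proof -
  have "fr s' (k \<odot> r') = fr s (k \<odot> r)"
    if sr': "(s', r') \<in> fr s r" for s' r'
  proof -
    obtain g g' where g: "g \<in> carrier A" "g' \<in> carrier A" "s' \<in> S"
      "r' \<in> carrier A" "g \<otimes> s \<in> S" "g' \<otimes> s' = g \<otimes> s" "g' \<otimes> r' = g \<otimes> r"
      using mem_left_frac[OF sr'] by metis
    have "fr s' (k \<odot> r') = fr (g' \<otimes> s') (g' \<otimes> (k \<odot> r'))"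
      using g by (subst left_frac_expand) auto
    also have "\<dots> = fr (g \<otimes> s) (g \<otimes> (k \<odot> r))"
      using g assms by (simp add: mult_smult)
    also have "\<dots> = fr s (k \<odot> r)"
      using g assms by (intro left_frac_expand) auto
    finally show ?thesis .
  qed
  then have "{fr s' (k \<odot> r') | s' r'. (s', r') \<in> fr s r}
      = {fr s (k \<odot> r)}"
    using self_mem_left_frac[OF assms] by blast
  then show ?thesis
    by (simp add: localization_def)
qed

lemma one_localization: "\<one>\<^bsub>Loc\<^esub> = fr \<one> \<one>"
  by (simp add: localization_def)

lemma localization_closed:
  assumes "x \<in> carrier (Loc)" "y \<in> carrier (Loc)"
  shows "x \<otimes>\<^bsub>Loc\<^esub> y \<in> carrier (Loc)"
    and "x \<oplus>\<^bsub>Loc\<^esub> y \<in> carrier (Loc)"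
proof -
  obtain s r t q where xy: "s \<in> S" "r \<in> carrier A" "t \<in> S" "q \<in> carrier A"
    "x = fr s r" "y = fr t q"
    using assms unfolding carrier_localization by auto
  obtain u a where "u \<in> S" "a \<in> carrier A" "u \<otimes> r = a \<otimes> t"
    using ore xy by metis
  with xy have "x \<otimes>\<^bsub>Loc\<^esub> y = fr (u \<otimes> s) (a \<otimes> q)"
    "u \<otimes> s \<in> S" "a \<otimes> q \<in> carrier A"
    using mult_left_frac[of s r t q u a] by auto
  then show "x \<otimes>\<^bsub>Loc\<^esub> y \<in> carrier (Loc)"
    unfolding carrier_localization by blast
  obtain u a where "u \<in> S" "a \<in> carrier A" "u \<otimes> s = a \<otimes> t"
    using ore[of s t] xy by auto
  moreover from this xy have "u \<otimes> s \<in> S"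
    using S_mult by blast
  ultimately have "x \<oplus>\<^bsub>Loc\<^esub> y = fr (u \<otimes> s) (u \<otimes> r \<oplus> a \<otimes> q)"
    "u \<otimes> s \<in> S" "u \<otimes> r \<oplus> a \<otimes> q \<in> carrier A"
    using add_left_frac[of s r t q u a] xy by (metis S_carrier, simp_all add: xy)
  then show "x \<oplus>\<^bsub>Loc\<^esub> y \<in> carrier (Loc)"
    unfolding carrier_localization by blast
qed

lemma localization_smult_closed:
  "x \<in> carrier (Loc) \<Longrightarrow> k \<odot>\<^bsub>Loc\<^esub> x \<in> carrier (Loc)"
  by (auto simp: carrier_localization) (metis smult_closed smult_left_frac)

lemma localization_one_closed: "\<one>\<^bsub>Loc\<^esub> \<in> carrier (Loc)"
  unfolding one_localization carrier_localization using S_one one_closed by blast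

lemma left_frac_eqD:
  assumes "s \<in> S" "r \<in> carrier A" "q \<in> carrier A" "fr s r = fr s q"
  shows "r \<ominus> q \<in> ass_l A S"
proof -
  obtain c d where c: "c \<in> carrier A" "d \<in> carrier A" "c \<otimes> s = d \<otimes> s" "c \<otimes> s \<in> S" "c \<otimes> r = d \<otimes> q"
    using assms by (auto simp: left_frac_eq_iff frac_rel_iff)
  obtain v where v: "v \<in> S" "v \<otimes> c = v \<otimes> d"
    using cancel_right c assms by metis
  have "(v \<otimes> c) \<otimes> s \<in> S"
    using S_mult[OF v(1) c(4)] v(1) c(1) assms(1) by (simp add: m_assoc)
  \<comment> \<open>\<open>v c\<close> need not lie in \<open>S\<close>, but \<open>v c s\<close>
    does; taking \<open>\<one>\<close> as the other element yields a left multiple of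
    \<open>v c\<close> that lies in \<open>S\<close>.\<close>
  then obtain e y where e: "e \<in> S" "y \<in> carrier A" "e \<otimes> \<one> = y \<otimes> (v \<otimes> c)"
    using common_left_multiple[of \<one> "v \<otimes> c" s] v(1) c(1) assms(1) by auto
  then have ev: "e = y \<otimes> (v \<otimes> c)" by simp
  have "e \<otimes> r = y \<otimes> (v \<otimes> (d \<otimes> q))"
    unfolding ev c(5)[symmetric] using v(1) e(2) c(1) assms by (simp add: m_assoc)
  also have "\<dots> = e \<otimes> q"
    unfolding ev v(2) using v(1) e(2) c(2) assms by (simp add: m_assoc)
  finally have "e \<otimes> (r \<ominus> q) = \<zero>"
    using e(1) assms by (simp add: minus_eq r_distr r_minus r_neg)
  then show ?thesis
    using e(1) assms by (auto simp: ass_l_def)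
qed

lemma left_frac_eqI:
  assumes "s \<in> S" "r \<in> carrier A" "q \<in> carrier A" "r \<ominus> q \<in> ass_l A S"
  shows "fr s r = fr s q"
proof -
  obtain v where v: "v \<in> S" "v \<otimes> (r \<ominus> q) = \<zero>"
    using assms by (auto simp: ass_l_def)
  then have "v \<otimes> r = v \<otimes> q"
    using assms(2,3) S_carrier[OF v(1)]
    by (simp add: minus_eq r_distr r_minus r_right_minus_eq[unfolded minus_eq])
  then show ?thesis
    using left_frac_expand[of s r v] left_frac_expand[of s q v] v(1) assms by auto
qed

end

text \<open>The induced map is \<open>s^-1 r \<mapsto> (\<phi> s)^-1 (\<phi> r)\<close>.
  \<open>ST\<close> makes it well defined, \<open>ker\<close> makes it injective once two fractions
  share a denominator, and \<open>sur\<close> expands any \<open>t^-1 b\<close> by \<open>c\<close>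
  to a fraction in the image. It is used with \<open>\<phi>\<close> the identity, an inclusion and
  the quotient map.\<close>

theorem localization_isoI:
  assumes A: "left_den A S" and B: "left_den B T"
    and hom: "\<phi> \<in> ring_hom A B"
    and smult: "\<And>c x. x \<in> carrier A \<Longrightarrow> \<phi> (c \<odot>\<^bsub>A\<^esub> x) = c \<odot>\<^bsub>B\<^esub> \<phi> x"
    and ST: "\<phi> ` S \<subseteq> T"
    and ker: "\<And>x. x \<in> carrier A \<Longrightarrow> \<phi> x \<in> ass_l B T \<Longrightarrow> x \<in> ass_l A S"
    and sur: "\<And>t b. t \<in> T \<Longrightarrow> b \<in> carrier B \<Longrightarrow>
      \<exists>c\<in>carrier B. \<exists>s\<in>S. \<exists>r\<in>carrier A. c \<otimes>\<^bsub>B\<^esub> t = \<phi> s \<and> c \<otimes>\<^bsub>B\<^esub> b = \<phi> r"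
  shows "localization A S \<simeq>\<^sub>K localization B T"
proof -
  interpret A: left_den A S by fact
  interpret B: left_den B T by fact
  interpret ring_hom_ring A B \<phi>
    by (rule ring_hom_ringI2) (unfold_locales, fact hom)
  have T: "\<phi> s \<in> T" if "s \<in> S" for s
    using ST that by auto
  \<comment> \<open>The union of the classes of all images of representatives; it is a single class
    because equivalent pairs have equivalent images.\<close>
  define h where "h U = frac_rel B T `` ((\<lambda>(s, r). (\<phi> s, \<phi> r)) ` U)" for U
  have h: "h (A.fr s r) = B.fr (\<phi> s) (\<phi> r)" if sr: "s \<in> S" "r \<in> carrier A" for s r
  proof -
    have *: "B.fr (\<phi> s') (\<phi> r') = B.fr (\<phi> s) (\<phi> r)"
      if sr': "(s', r') \<in> A.fr s r" for s' r'
    proof -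
      obtain c d where c: "c \<in> carrier A" "d \<in> carrier A" "s' \<in> S" "r' \<in> carrier A"
        "c \<otimes>\<^bsub>A\<^esub> s \<in> S" "d \<otimes>\<^bsub>A\<^esub> s' = c \<otimes>\<^bsub>A\<^esub> s" "d \<otimes>\<^bsub>A\<^esub> r' = c \<otimes>\<^bsub>A\<^esub> r"
        using A.mem_left_frac[OF sr'] by metis
      have s: "\<phi> d \<otimes>\<^bsub>B\<^esub> \<phi> s' = \<phi> c \<otimes>\<^bsub>B\<^esub> \<phi> s"
        using c sr by (metis A.S_carrier hom_mult)
      have r: "\<phi> d \<otimes>\<^bsub>B\<^esub> \<phi> r' = \<phi> c \<otimes>\<^bsub>B\<^esub> \<phi> r"
        using c sr by (metis hom_mult)
      have "\<phi> c \<otimes>\<^bsub>B\<^esub> \<phi> s \<in> T"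
        using T[OF c(5)] c sr by simp
      with s r c sr show ?thesis
        using B.left_frac_expand[of "\<phi> s" "\<phi> r" "\<phi> c"] B.left_frac_expand[of "\<phi> s'" "\<phi> r'" "\<phi> d"]
        by (simp add: T)
    qed
    have "h (A.fr s r) = (\<Union>p\<in>A.fr s r. B.fr (\<phi> (fst p)) (\<phi> (snd p)))"
      unfolding h_def left_frac_def[of B] by auto
    also have "\<dots> = (\<Union>p\<in>A.fr s r. B.fr (\<phi> s) (\<phi> r))"
      by (rule SUP_cong[OF refl]) (metis * prod.collapse)
    also have "\<dots> = B.fr (\<phi> s) (\<phi> r)"
      using A.self_mem_left_frac[OF sr] by blast
    finally show ?thesis .
  qed
  have car: "h x \<in> carrier (B.Loc)" if "x \<in> carrier (A.Loc)" for x
    using that by (auto simp: A.carrier_localization B.carrier_localization h) (metis T hom_closed)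
  have "h (x \<otimes>\<^bsub>A.Loc\<^esub> y) = h x \<otimes>\<^bsub>B.Loc\<^esub> h y"
    if xy: "x \<in> carrier (A.Loc)" "y \<in> carrier (A.Loc)" for x y
  proof -
    obtain s r t q where sr: "s \<in> S" "r \<in> carrier A" "t \<in> S" "q \<in> carrier A"
      "x = A.fr s r" "y = A.fr t q"
      using xy unfolding A.carrier_localization by auto
    obtain u a where u: "u \<in> S" "a \<in> carrier A" "u \<otimes>\<^bsub>A\<^esub> r = a \<otimes>\<^bsub>A\<^esub> t"
      using A.ore sr by metis
    have "\<phi> u \<otimes>\<^bsub>B\<^esub> \<phi> r = \<phi> a \<otimes>\<^bsub>B\<^esub> \<phi> t"
      using u sr by (metis A.S_carrier hom_mult)
    then have "h x \<otimes>\<^bsub>B.Loc\<^esub> h y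
        = B.fr (\<phi> u \<otimes>\<^bsub>B\<^esub> \<phi> s) (\<phi> a \<otimes>\<^bsub>B\<^esub> \<phi> q)"
      using sr u B.mult_left_frac[of "\<phi> s" "\<phi> r" "\<phi> t" "\<phi> q" "\<phi> u" "\<phi> a"] by (simp add: h T)
    also have "\<dots> = h (A.fr (u \<otimes>\<^bsub>A\<^esub> s) (a \<otimes>\<^bsub>A\<^esub> q))"
      using sr u by (simp add: h)
    also have "A.fr (u \<otimes>\<^bsub>A\<^esub> s) (a \<otimes>\<^bsub>A\<^esub> q) = x \<otimes>\<^bsub>A.Loc\<^esub> y"
      using sr u A.mult_left_frac by simp
    finally show ?thesis ..
  qed
  moreover have "h (x \<oplus>\<^bsub>A.Loc\<^esub> y) = h x \<oplus>\<^bsub>B.Loc\<^esub> h y"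
    if xy: "x \<in> carrier (A.Loc)" "y \<in> carrier (A.Loc)" for x y
  proof -
    obtain s r t q where sr: "s \<in> S" "r \<in> carrier A" "t \<in> S" "q \<in> carrier A"
      "x = A.fr s r" "y = A.fr t q"
      using xy unfolding A.carrier_localization by auto
    obtain u a where u: "u \<in> S" "a \<in> carrier A" "u \<otimes>\<^bsub>A\<^esub> s = a \<otimes>\<^bsub>A\<^esub> t"
      using A.ore[of s t] sr by auto
    have *: "\<phi> u \<otimes>\<^bsub>B\<^esub> \<phi> s = \<phi> a \<otimes>\<^bsub>B\<^esub> \<phi> t"
      using u sr by (metis A.S_carrier hom_mult)
    have uS: "u \<otimes>\<^bsub>A\<^esub> s \<in> S" and uT: "\<phi> u \<otimes>\<^bsub>B\<^esub> \<phi> s \<in> T"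
      using A.S_mult B.S_mult T u(1) sr(1) by blast+
    have "h x \<oplus>\<^bsub>B.Loc\<^esub> h y
        = B.fr (\<phi> u \<otimes>\<^bsub>B\<^esub> \<phi> s) (\<phi> u \<otimes>\<^bsub>B\<^esub> \<phi> r \<oplus>\<^bsub>B\<^esub> \<phi> a \<otimes>\<^bsub>B\<^esub> \<phi> q)"
      unfolding sr(5,6) h[OF sr(1,2)] h[OF sr(3,4)]
      using sr u(1,2) by (intro B.add_left_frac[OF _ _ _ _ _ _ * uT]) (simp_all add: T)
    also have "\<dots> = h (A.fr (u \<otimes>\<^bsub>A\<^esub> s) (u \<otimes>\<^bsub>A\<^esub> r \<oplus>\<^bsub>A\<^esub> a \<otimes>\<^bsub>A\<^esub> q))"
      using sr(1-4) u(1,2) uS by (simp add: h)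
    also have "A.fr (u \<otimes>\<^bsub>A\<^esub> s) (u \<otimes>\<^bsub>A\<^esub> r \<oplus>\<^bsub>A\<^esub> a \<otimes>\<^bsub>A\<^esub> q) = x \<oplus>\<^bsub>A.Loc\<^esub> y"
      unfolding sr(5,6) using sr(1-4) u uS by (intro A.add_left_frac[symmetric]) simp_all
    finally show ?thesis ..
  qed
  moreover have "h \<one>\<^bsub>A.Loc\<^esub> = \<one>\<^bsub>B.Loc\<^esub>"
    by (simp add: A.one_localization B.one_localization h)
  moreover have "h (c \<odot>\<^bsub>A.Loc\<^esub> x) = c \<odot>\<^bsub>B.Loc\<^esub> h x"
    if "x \<in> carrier (A.Loc)" for c x
    using that
    by (auto simp: A.carrier_localization A.smult_left_frac B.smult_left_frac h T smult)
  moreover have "inj_on h (carrier (A.Loc))"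
  proof (rule inj_onI)
    fix x y
    assume xy: "x \<in> carrier (A.Loc)" "y \<in> carrier (A.Loc)" and eq: "h x = h y"
    obtain s r t q where sr: "s \<in> S" "r \<in> carrier A" "t \<in> S" "q \<in> carrier A"
      "x = A.fr s r" "y = A.fr t q"
      using xy unfolding A.carrier_localization by auto
    obtain u a where u: "u \<in> S" "a \<in> carrier A" "u \<otimes>\<^bsub>A\<^esub> s = a \<otimes>\<^bsub>A\<^esub> t"
      using A.ore[of s t] sr by auto
    have uS: "u \<otimes>\<^bsub>A\<^esub> s \<in> S" "a \<otimes>\<^bsub>A\<^esub> t \<in> S"
      using A.S_mult u sr by metis+
    have x: "x = A.fr (u \<otimes>\<^bsub>A\<^esub> s) (u \<otimes>\<^bsub>A\<^esub> r)"
      using sr u uS A.left_frac_expand[of s r u] by simp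
    have y: "y = A.fr (u \<otimes>\<^bsub>A\<^esub> s) (a \<otimes>\<^bsub>A\<^esub> q)"
      using sr u uS A.left_frac_expand[of t q a] by simp
    have "B.fr (\<phi> (u \<otimes>\<^bsub>A\<^esub> s)) (\<phi> (u \<otimes>\<^bsub>A\<^esub> r)) = B.fr (\<phi> (u \<otimes>\<^bsub>A\<^esub> s)) (\<phi> (a \<otimes>\<^bsub>A\<^esub> q))"
      using eq h[OF uS(1), of "u \<otimes>\<^bsub>A\<^esub> r"] h[OF uS(1), of "a \<otimes>\<^bsub>A\<^esub> q"] sr(1-4) u(1,2)
      unfolding x y by (metis A.m_closed A.S_carrier)
    then have "\<phi> (u \<otimes>\<^bsub>A\<^esub> r) \<ominus>\<^bsub>B\<^esub> \<phi> (a \<otimes>\<^bsub>A\<^esub> q) \<in> ass_l B T"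
      using sr(1-4) u(1,2) uS by (intro B.left_frac_eqD[OF T[OF uS(1)]]) (auto simp del: hom_mult)
    then have "\<phi> (u \<otimes>\<^bsub>A\<^esub> r \<ominus>\<^bsub>A\<^esub> a \<otimes>\<^bsub>A\<^esub> q) \<in> ass_l B T"
      using sr(1-4) u(1,2) by (simp add: A.minus_eq B.minus_eq)
    then have "u \<otimes>\<^bsub>A\<^esub> r \<ominus>\<^bsub>A\<^esub> a \<otimes>\<^bsub>A\<^esub> q \<in> ass_l A S"
      using sr(1-4) u(1,2) by (intro ker) auto
    then show "x = y"
      unfolding x y using sr(1-4) u(1,2) by (intro A.left_frac_eqI uS) auto
  qed
  moreover have "h ` carrier (A.Loc) = carrier (B.Loc)"
  proof
    show "h ` carrier (A.Loc) \<subseteq> carrier (B.Loc)"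
      using car by auto
    show "carrier (B.Loc) \<subseteq> h ` carrier (A.Loc)"
    proof
      fix y assume "y \<in> carrier (B.Loc)"
      then obtain t b where t: "t \<in> T" "b \<in> carrier B" "y = B.fr t b"
        by (auto simp: B.carrier_localization)
      obtain c s r where c: "c \<in> carrier B" "s \<in> S" "r \<in> carrier A"
        "c \<otimes>\<^bsub>B\<^esub> t = \<phi> s" "c \<otimes>\<^bsub>B\<^esub> b = \<phi> r"
        using sur[OF t(1,2)] by auto
      have "y = B.fr (c \<otimes>\<^bsub>B\<^esub> t) (c \<otimes>\<^bsub>B\<^esub> b)"
        using t c T B.left_frac_expand[of t b c] by simp
      also have "\<dots> = h (A.fr s r)"
        using c by (simp add: h)
      finally show "y \<in> h ` carrier (A.Loc)"
        using c by (auto simp: A.carrier_localization)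
    qed
  qed
  ultimately show ?thesis
    unfolding alg_isomorphic_def using car
    by (intro bexI[of _ h] ring_iso_memI) (auto simp: bij_betw_def)
qed

lemma alg_isomorphic_trans:
  assumes "A \<simeq>\<^sub>K B" "B \<simeq>\<^sub>K C"
  shows "A \<simeq>\<^sub>K C"
proof -
  obtain f where f: "f \<in> ring_iso A B" "\<forall>c. \<forall>x\<in>carrier A. f (c \<odot>\<^bsub>A\<^esub> x) = c \<odot>\<^bsub>B\<^esub> f x"
    using assms(1) by (auto simp: alg_isomorphic_def)
  obtain g where g: "g \<in> ring_iso B C" "\<forall>c. \<forall>x\<in>carrier B. g (c \<odot>\<^bsub>B\<^esub> x) = c \<odot>\<^bsub>C\<^esub> g x"
    using assms(2) by (auto simp: alg_isomorphic_def)
  show ?thesis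
    unfolding alg_isomorphic_def
    by (rule bexI[OF _ ring_iso_set_trans[OF f(1) g(1)]])
      (use f g ring_iso_memE(1)[OF f(1)] in auto)
qed

text \<open>The inverse map respects an operation as soon as its result stays in the carrier of
  \<open>A\<close>. Asking for closure alone makes the lemma applicable to localizations, for which
  exactly these closure facts are proved.\<close>

lemma alg_isomorphic_sym:
  assumes "A \<simeq>\<^sub>K B"
    and closed: "\<And>x y. x \<in> carrier A \<Longrightarrow> y \<in> carrier A \<Longrightarrow> x \<otimes>\<^bsub>A\<^esub> y \<in> carrier A"
      "\<And>x y. x \<in> carrier A \<Longrightarrow> y \<in> carrier A \<Longrightarrow> x \<oplus>\<^bsub>A\<^esub> y \<in> carrier A"
      "\<And>c x. x \<in> carrier A \<Longrightarrow> c \<odot>\<^bsub>A\<^esub> x \<in> carrier A" "\<one>\<^bsub>A\<^esub> \<in> carrier A"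
  shows "B \<simeq>\<^sub>K A"
proof -
  obtain h where h: "h \<in> ring_iso A B" "\<forall>c. \<forall>x\<in>carrier A. h (c \<odot>\<^bsub>A\<^esub> x) = c \<odot>\<^bsub>B\<^esub> h x"
    using assms(1) by (auto simp: alg_isomorphic_def)
  define g where "g = inv_into (carrier A) h"
  note bij = ring_iso_memE(5)[OF h(1)]
  have g1: "g y \<in> carrier A" "h (g y) = y" if "y \<in> carrier B" for y
    using that bij unfolding g_def by (auto simp: bij_betw_def inv_into_into f_inv_into_f)
  have g2: "g (h x) = x" if "x \<in> carrier A" for x
    using that bij unfolding g_def by (auto simp: bij_betw_def)
  have m: "g (x \<otimes>\<^bsub>B\<^esub> y) = g x \<otimes>\<^bsub>A\<^esub> g y" "g (x \<oplus>\<^bsub>B\<^esub> y) = g x \<oplus>\<^bsub>A\<^esub> g y"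
    if "x \<in> carrier B" "y \<in> carrier B" for x y
    using that ring_iso_memE(2,3)[OF h(1)] g1 g2 closed by metis+
  have s: "g (c \<odot>\<^bsub>B\<^esub> x) = c \<odot>\<^bsub>A\<^esub> g x" if "x \<in> carrier B" for c x
    using that h(2) g1 g2 closed by metis
  have o: "g \<one>\<^bsub>B\<^esub> = \<one>\<^bsub>A\<^esub>"
    using ring_iso_memE(4)[OF h(1)] g2 closed by metis
  have "g \<in> ring_iso B A"
    using bij_betw_inv_into[OF bij] g1 m o by (intro ring_iso_memI) (auto simp: g_def)
  with s show ?thesis
    unfolding alg_isomorphic_def by blast
qed

lemma localization_iso_sym:
  assumes "left_den A S" "localization A S \<simeq>\<^sub>K B"
  shows "B \<simeq>\<^sub>K localization A S"
proof -
  interpret left_den A S by fact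
  show ?thesis
    by (rule alg_isomorphic_sym[OF assms(2)]) 
      (simp_all add: localization_closed localization_smult_closed localization_one_closed)
qed

section \<open>The largest left denominator set of left regular elements\<close>

text \<open>The submonoid generated by \<open>X\<close>, built one left factor at a time so that Ore
  multipliers can be composed factor by factor.\<close>

inductive_set mult_gen :: "('a, 'm) ring_scheme \<Rightarrow> 'a set \<Rightarrow> 'a set" for R X where
  one: "\<one>\<^bsub>R\<^esub> \<in> mult_gen R X"
| mult: "\<lbrakk>x \<in> X; y \<in> mult_gen R X\<rbrakk> \<Longrightarrow> x \<otimes>\<^bsub>R\<^esub> y \<in> mult_gen R X"

context ring
begin

lemma left_denominatorI:
  assumes "S \<subseteq> carrier R" "\<one> \<in> S" "\<zero> \<notin> S" "\<And>s t. \<lbrakk>s \<in> S; t \<in> S\<rbrakk> \<Longrightarrow> s \<otimes> t \<in> S"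
    and ore: "\<And>r s. \<lbrakk>r \<in> carrier R; s \<in> S\<rbrakk> \<Longrightarrow> \<exists>u\<in>S. \<exists>a\<in>carrier R. u \<otimes> r = a \<otimes> s"
    and "\<And>r s. \<lbrakk>r \<in> carrier R; s \<in> S; r \<otimes> s = \<zero>\<rbrakk> \<Longrightarrow> \<exists>t\<in>S. t \<otimes> r = \<zero>"
  shows "left_denominator R S"
proof -
  have "(S #> r) \<inter> (carrier R #> s) \<noteq> {}" if "r \<in> carrier R" "s \<in> S" for r s
    using ore[OF that] unfolding r_coset_def by auto
  then show ?thesis
    unfolding left_denominator_def left_Ore_def multiplicative_def
    using assms(1-4) assms(6) by (intro conjI ballI impI) simp_all
qed

lemma left_regular_mult:
  "\<lbrakk>x \<in> left_regular R; y \<in> left_regular R\<rbrakk> \<Longrightarrow> x \<otimes> y \<in> left_regular R"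
proof -
  assume xy: "x \<in> left_regular R" "y \<in> left_regular R"
  then have c: "x \<in> carrier R" "y \<in> carrier R"
    by (auto simp: left_regular_def)
  have "r = \<zero>" if "r \<in> carrier R" "r \<otimes> (x \<otimes> y) = \<zero>" for r
  proof -
    have "(r \<otimes> x) \<otimes> y = \<zero>"
      using that c by (simp add: m_assoc)
    then show ?thesis
      using that c xy unfolding left_regular_def by blast
  qed
  then show ?thesis
    using c by (simp add: left_regular_def)
qed

lemma one_left_regular: "\<one> \<in> left_regular R"
  by (auto simp: left_regular_def)

lemma zero_not_left_regular: "\<one> \<noteq> \<zero> \<Longrightarrow> \<zero> \<notin> left_regular R"
  by (auto simp: left_regular_def)

text \<open>For left regular \<open>s\<close>, \<open>r s = 0\<close> forces \<open>r = 0\<close>,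
  so the last condition on a left denominator set holds with \<open>t = 1\<close>.\<close>

lemma left_denominator_regularI:
  assumes "\<one> \<noteq> \<zero>" "S \<subseteq> left_regular R" "\<one> \<in> S" "\<And>s t. \<lbrakk>s \<in> S; t \<in> S\<rbrakk> \<Longrightarrow> s \<otimes> t \<in> S"
    and "\<And>r s. \<lbrakk>r \<in> carrier R; s \<in> S\<rbrakk> \<Longrightarrow> \<exists>u\<in>S. \<exists>a\<in>carrier R. u \<otimes> r = a \<otimes> s"
  shows "left_denominator R S"
proof (rule left_denominatorI)
  fix r s assume "r \<in> carrier R" "s \<in> S" "r \<otimes> s = \<zero>"
  then have "r = \<zero>"
    using assms(2) by (auto simp: left_regular_def)
  then show "\<exists>t\<in>S. t \<otimes> r = \<zero>"
    using assms(3) by (intro bexI[of _ \<one>]) auto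
qed (use assms zero_not_left_regular in \<open>auto simp: left_regular_def\<close>)

lemma left_den_ore:
  assumes "left_denominator R S" "r \<in> carrier R" "s \<in> S"
  shows "\<exists>u\<in>S. \<exists>a\<in>carrier R. u \<otimes> r = a \<otimes> s"
proof -
  have "(S #> r) \<inter> (carrier R #> s) \<noteq> {}"
    using assms by (auto simp: left_denominator_def left_Ore_def)
  then show ?thesis unfolding r_coset_def by auto
qed

lemma mult_gen_left_regular:
  assumes "X \<subseteq> left_regular R"
  shows "mult_gen R X \<subseteq> left_regular R"
proof
  fix x assume "x \<in> mult_gen R X"
  then show "x \<in> left_regular R"
    by induction (use assms in \<open>auto intro: left_regular_mult one_left_regular\<close>)
qed

lemma mult_gen_incl:
  assumes "X \<subseteq> carrier R" "x \<in> X"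
  shows "x \<in> mult_gen R X"
  using mult_gen.mult[OF assms(2) mult_gen.one[of R]] assms by auto

lemma left_denominator_mult_gen:
  assumes one: "\<one> \<noteq> \<zero>" and X: "X \<subseteq> left_regular R"
    and ore: "\<And>r x. \<lbrakk>r \<in> carrier R; x \<in> X\<rbrakk> \<Longrightarrow> \<exists>u\<in>mult_gen R X. \<exists>a\<in>carrier R. u \<otimes> r = a \<otimes> x"
  shows "left_denominator R (mult_gen R X)"
proof -
  note reg = mult_gen_left_regular[OF X]
  have car: "x \<in> carrier R" if "x \<in> mult_gen R X" for x
    using reg that by (auto simp: left_regular_def)
  have Xcar: "x \<in> carrier R" if "x \<in> X" for x
    using X that by (auto simp: left_regular_def)
  have closed: "x \<otimes> y \<in> mult_gen R X" if "x \<in> mult_gen R X" "y \<in> mult_gen R X" for x y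
    using that
  proof (induction x)
    case (mult x z)
    then have "x \<otimes> z \<otimes> y = x \<otimes> (z \<otimes> y)"
      using car Xcar by (simp add: m_assoc)
    with mult show ?case by (simp add: mult_gen.mult)
  qed (simp add: car)
  have "\<exists>u\<in>mult_gen R X. \<exists>a\<in>carrier R. u \<otimes> r = a \<otimes> s"
    if "s \<in> mult_gen R X" "r \<in> carrier R" for r s
    using that
  proof (induction s arbitrary: r)
    case one
    then show ?case
      by (intro bexI[of _ \<one>] bexI[of _ r]) (auto intro: mult_gen.one)
  next
    case (mult x y)
    \<comment> \<open>The right factor of \<open>x y\<close> is treated first:
      \<open>u r = a y\<close> and then \<open>v a = b x\<close> give
      \<open>(v u) r = b (x y)\<close>.\<close>
    obtain u a where u: "u \<in> mult_gen R X" "a \<in> carrier R" "u \<otimes> r = a \<otimes> y"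
      using mult.IH[OF mult.prems] by blast
    obtain v b where v: "v \<in> mult_gen R X" "b \<in> carrier R" "v \<otimes> a = b \<otimes> x"
      using ore[OF u(2) mult.hyps(1)] by auto
    have "(v \<otimes> u) \<otimes> r = v \<otimes> (a \<otimes> y)"
      using u(1) v(1) mult.prems u(3) car by (simp add: m_assoc)
    also have "\<dots> = b \<otimes> (x \<otimes> y)"
      using u(2) v mult.hyps car Xcar by (simp add: m_assoc[symmetric])
    finally show ?case
      using closed[OF v(1) u(1)] v(2) by blast
  qed
  then show ?thesis
    by (intro left_denominator_regularI one reg mult_gen.one closed) auto
qed

text \<open>The submonoid generated by the union of all left denominator sets of left regular
  elements is again such a set, because each generator finds its Ore multipliers in the set it comes
  from. It is therefore the largest one, and uniqueness makes the description in
  \<open>prime_S\<close> denote it.\<close>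

lemma prime_S_largest:
  assumes "\<one> \<noteq> \<zero>"
  shows "largest_left_den_in R (left_regular R) (prime_S R)"
proof -
  define X where "X = \<Union>{T. left_denominator R T \<and> T \<subseteq> left_regular R}"
  have X: "X \<subseteq> left_regular R"
    by (auto simp: X_def)
  then have Xc: "X \<subseteq> carrier R"
    by (auto simp: left_regular_def)
  have "left_denominator R (mult_gen R X)"
  proof (rule left_denominator_mult_gen[OF assms X])
    fix r x assume "r \<in> carrier R" "x \<in> X"
    then obtain T where T: "left_denominator R T" "T \<subseteq> left_regular R" "x \<in> T"
      by (auto simp: X_def)
    then have "T \<subseteq> mult_gen R X"
      using mult_gen_incl[OF Xc] by (auto simp: X_def)
    with left_den_ore[OF T(1) \<open>r \<in> carrier R\<close> T(3)]
    show "\<exists>u\<in>mult_gen R X. \<exists>a\<in>carrier R. u \<otimes> r = a \<otimes> x" by blast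
  qed
  then have "largest_left_den_in R (left_regular R) (mult_gen R X)"
    using mult_gen_left_regular[OF X] mult_gen_incl[OF Xc]
    unfolding largest_left_den_in_def by (auto simp: X_def)
  moreover have "S = S'" if "largest_left_den_in R (left_regular R) S"
    "largest_left_den_in R (left_regular R) S'" for S S'
    using that unfolding largest_left_den_in_def by blast
  ultimately show ?thesis
    unfolding prime_S_def by (metis (no_types, lifting) theI')
qed

text \<open>Maximality in usable form: \<open>prime_S R\<close> together with \<open>x\<close>
  generates another left denominator set of left regular elements, which is therefore contained in
  \<open>prime_S R\<close>.\<close>

lemma prime_S_absorb:
  assumes one: "\<one> \<noteq> \<zero>" and x: "x \<in> left_regular R"
    and ore: "\<And>r. r \<in> carrier R \<Longrightarrow> \<exists>u\<in>prime_S R. \<exists>a\<in>carrier R. u \<otimes> r = a \<otimes> x"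
  shows "x \<in> prime_S R"
proof -
  note largest = prime_S_largest[OF one, unfolded largest_left_den_in_def]
  let ?X = "insert x (prime_S R)"
  have X: "?X \<subseteq> left_regular R"
    using largest x by auto
  then have Xc: "?X \<subseteq> carrier R"
    by (auto simp: left_regular_def)
  have "left_denominator R (mult_gen R ?X)"
  proof (rule left_denominator_mult_gen[OF one X])
    fix r y assume "r \<in> carrier R" "y \<in> ?X"
    then have "\<exists>u\<in>prime_S R. \<exists>a\<in>carrier R. u \<otimes> r = a \<otimes> y"
    proof (cases "y = x")
      case True
      then show ?thesis using ore[OF \<open>r \<in> carrier R\<close>] by simp
    next
      case False
      then show ?thesis
        using \<open>y \<in> ?X\<close> \<open>r \<in> carrier R\<close> largest by (intro left_den_ore) auto
    qed
    then show "\<exists>u\<in>mult_gen R ?X. \<exists>a\<in>carrier R. u \<otimes> r = a \<otimes> y"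
      using mult_gen_incl[OF Xc] by blast
  qed
  then have "mult_gen R ?X \<subseteq> prime_S R"
    using largest mult_gen_left_regular[OF X] by auto
  then show ?thesis
    using mult_gen_incl[OF Xc] by auto
qed

end

context k_algebra
begin

lemma k_algebra_restrict:
  assumes "subalgebra_of A D"
  shows "k_algebra (A\<lparr>carrier := D\<rparr>)"
proof -
  interpret D: ring "A\<lparr>carrier := D\<rparr>"
    using assms subring_is_ring by (simp add: subalgebra_of_def)
  have "D \<subseteq> carrier A"
    using assms subringE(1) by (auto simp: subalgebra_of_def)
  then show ?thesis
    by unfold_locales (use assms in \<open>auto simp: subalgebra_of_def mult_smult smult_add subset_eq\<close>)
qed

lemma smult_coset:
  assumes "ideal I A" "\<And>c x. x \<in> I \<Longrightarrow> c \<odot> x \<in> I" "x \<in> carrier A"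
  shows "c \<odot>\<^bsub>quot_algebra A I\<^esub> (I +> x) = I +> (c \<odot> x)"
proof -
  interpret ideal I A by fact
  have "I +> (c \<odot> y) = I +> (c \<odot> x)" if y: "y \<in> I +> x" for y
  proof -
    obtain i where i: "i \<in> I" "y = i \<oplus> x"
      using y by (auto simp: a_r_coset_def')
    then have "c \<odot> y = c \<odot> i \<oplus> c \<odot> x"
      using assms(3) smult_add by auto
    then have "c \<odot> y \<in> I +> (c \<odot> x)"
      using i assms(2) by (auto simp: a_r_coset_def')
    then show ?thesis
      using a_repr_independence' assms(3) by (metis smult_closed)
  qed
  moreover have "x \<in> I +> x"
    using a_rcos_self assms(3) by simp
  ultimately have "(\<Union>y\<in>I +> x. I +> (c \<odot> y)) = I +> (c \<odot> x)"
    by blast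
  then show ?thesis
    by (simp add: quot_algebra_def ring.defs module.defs)
qed

lemma quot_algebra_simps:
  "carrier (quot_algebra A I) = a_rcosets I" "monoid.mult (quot_algebra A I) = rcoset_mult A I"
  "one (quot_algebra A I) = I +> \<one>" "zero (quot_algebra A I) = I" "add (quot_algebra A I) = set_add A"
  by (simp_all add: quot_algebra_def ring.defs FactRing_def)

text \<open>\<open>quot_algebra A I\<close> and \<open>A Quot I\<close> are records of different
  types with the same ring operations; the axioms are unfolded down to these operations, where the
  two statements coincide.\<close>

lemma ring_quot_algebra:
  assumes "ideal I A"
  shows "ring (quot_algebra A I)"
proof -
  interpret ideal I A by fact
  have "ring (A Quot I)" by (rule quotient_is_ring)
  then show ?thesis
    unfolding ring_def ring_axioms_def abelian_group_def abelian_monoid_def abelian_group_axioms_def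
      comm_group_def group_def group_axioms_def comm_monoid_def comm_monoid_axioms_def
      Group.monoid_def Units_def
    unfolding quot_algebra_simps FactRing_def ring.simps monoid.simps partial_object.simps .
qed

lemma coset_ring_hom:
  assumes "ideal I A"
  shows "(+>) I \<in> ring_hom A (quot_algebra A I)"
  using ideal.rcos_ring_hom[OF assms] unfolding ring_hom_def
  by (simp add: quot_algebra_simps FactRing_def)

lemma carrier_quot_algebra: "carrier (quot_algebra A I) = (+>) I ` carrier A"
  by (auto simp: quot_algebra_simps A_RCOSETS_def')

lemma k_algebra_quot:
  assumes I: "ideal I A" "\<And>c x. x \<in> I \<Longrightarrow> c \<odot> x \<in> I"
  shows "k_algebra (quot_algebra A I)"
proof -
  interpret Q: ring "quot_algebra A I" by (rule ring_quot_algebra[OF I(1)])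
  note hom = coset_ring_hom[OF I(1)]
  note hs = ring_hom_mult[OF hom, symmetric] ring_hom_add[OF hom, symmetric]
  show ?thesis
    by unfold_locales
      (auto simp: carrier_quot_algebra smult_coset[OF I] hs mult_smult smult_add)
qed

end

section \<open>Localization relative to a commuting set of left regular elements\<close>

text \<open>The ring theory separated from the operators; the instance takes \<open>Delta\<close>
  for \<open>D\<close> and the set of all \<partial>^\<alpha> for \<open>T\<close>.
  \<open>reach\<close> brings any element into the domain \<open>D\<close>, and \<open>shift\<close>
  moves elements of \<open>T\<close> to the right across it.\<close>

locale shift_frame = k_algebra +
  fixes D T
  assumes one_neq_zero: "\<one> \<noteq> \<zero>"
    and D_subalgebra: "subalgebra_of A D"
    and T_D: "T \<subseteq> D" and T_one: "\<one> \<in> T" and T_mult: "\<lbrakk>t \<in> T; u \<in> T\<rbrakk> \<Longrightarrow> t \<otimes> u \<in> T"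
    and T_comm: "\<lbrakk>t \<in> T; u \<in> T\<rbrakk> \<Longrightarrow> t \<otimes> u = u \<otimes> t"
    and T_regular: "T \<subseteq> left_regular A"
    and shift: "\<lbrakk>t \<in> T; d \<in> D\<rbrakk> \<Longrightarrow> \<exists>d'\<in>D. t \<otimes> d = d' \<otimes> t"
    and reach: "r \<in> carrier A \<Longrightarrow> \<exists>t\<in>T. t \<otimes> r \<in> D"
    and D_domain: "\<lbrakk>d \<in> D; d' \<in> D; d \<otimes> d' = \<zero>\<rbrakk> \<Longrightarrow> d = \<zero> \<or> d' = \<zero>"
begin

abbreviation I where "I \<equiv> ass_l A T"
abbreviation S where "S \<equiv> prime_S A"
abbreviation D' where "D' \<equiv> D \<inter> S"

text \<open>Intersected with \<open>D\<close> this is \<open>tilde_Delta\<close>.\<close>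

definition sat where "sat = {x \<in> carrier A. \<exists>t\<in>T. t \<otimes> x \<in> S}"

lemma D_carrier [simp]: "d \<in> D \<Longrightarrow> d \<in> carrier A"
  using D_subalgebra subringE(1) by (auto simp: subalgebra_of_def)

lemma D_mult [simp]: "\<lbrakk>d \<in> D; d' \<in> D\<rbrakk> \<Longrightarrow> d \<otimes> d' \<in> D"
  using D_subalgebra subringE(6) by (auto simp: subalgebra_of_def)

lemma D_minus: "\<lbrakk>d \<in> D; d' \<in> D\<rbrakk> \<Longrightarrow> d \<ominus> d' \<in> D"
  using D_subalgebra subringE(5,7) unfolding subalgebra_of_def minus_eq by metis

lemma D_zero [simp]: "\<zero> \<in> D"
  using D_subalgebra subringE(2) by (auto simp: subalgebra_of_def)

lemma T_in_D [simp]: "t \<in> T \<Longrightarrow> t \<in> D"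
  using T_D by auto

lemma T_cancel: "\<lbrakk>t \<in> T; r \<in> carrier A; r \<otimes> t = \<zero>\<rbrakk> \<Longrightarrow> r = \<zero>"
  using T_regular by (auto simp: left_regular_def)

lemma zero_notin_T: "\<zero> \<notin> T"
  using zero_not_left_regular[OF one_neq_zero] T_regular by auto

text \<open>\<open>u\<close> brings \<open>r\<close> into \<open>D\<close>, and then
  \<open>t\<close> moves across: \<open>(t u) r = d t\<close>.\<close>

lemma T_ore:
  assumes "r \<in> carrier A" "t \<in> T"
  shows "\<exists>u\<in>T. \<exists>a\<in>carrier A. u \<otimes> r = a \<otimes> t"
proof -
  obtain u where u: "u \<in> T" "u \<otimes> r \<in> D"
    using reach[OF assms(1)] by auto
  obtain d where "d \<in> D" "t \<otimes> (u \<otimes> r) = d \<otimes> t"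
    using shift[OF assms(2) u(2)] by auto
  then have "(t \<otimes> u) \<otimes> r = d \<otimes> t" "d \<in> carrier A"
    using assms u by (auto simp: m_assoc)
  then show ?thesis
    using T_mult[OF assms(2) u(1)] by blast
qed

lemma T_den: "left_denominator A T"
  using one_neq_zero T_regular T_one T_mult T_ore by (rule left_denominator_regularI)

section \<open>The completely prime ideal annihilated by \<open>T\<close>\<close>

lemma I_iff: "x \<in> I \<longleftrightarrow> x \<in> carrier A \<and> (\<exists>t\<in>T. t \<otimes> x = \<zero>)"
  by (auto simp: ass_l_def)

lemma I_carrier: "x \<in> I \<Longrightarrow> x \<in> carrier A"
  by (simp add: I_iff)

lemma zero_I: "\<zero> \<in> I"
  using T_one by (auto simp: I_iff)

lemma I_ideal: "ideal I A"
proof (rule idealI)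
  show "subgroup I (add_monoid A)"
  proof (rule add.subgroupI)
    show "I \<subseteq> carrier A"
      by (auto simp: I_iff)
    show "I \<noteq> {}"
      using zero_I by blast
  next
    fix x assume "x \<in> I"
    then show "\<ominus> x \<in> I"
      by (auto simp: I_iff r_minus)
  next
    fix x y assume "x \<in> I" "y \<in> I"
    then obtain t u where *: "x \<in> carrier A" "y \<in> carrier A" "t \<in> T" "u \<in> T"
      "t \<otimes> x = \<zero>" "u \<otimes> y = \<zero>"
      by (auto simp: I_iff)
    \<comment> \<open>Commutativity lets \<open>t u\<close> act with either factor first, so it
      kills both summands.\<close>
    have "(t \<otimes> u) \<otimes> (x \<oplus> y) = (u \<otimes> t) \<otimes> x \<oplus> (t \<otimes> u) \<otimes> y"
      using * T_comm[of t u] by (simp add: r_distr)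
    also have "\<dots> = \<zero>"
      using * by (simp add: m_assoc)
    finally show "x \<oplus> y \<in> I"
      using * T_mult[of t u] by (auto simp: I_iff)
  qed
next
  fix x r assume x: "x \<in> I" and r: "r \<in> carrier A"
  from x obtain t where t: "t \<in> T" "t \<otimes> x = \<zero>" "x \<in> carrier A"
    by (auto simp: I_iff)
  have "t \<otimes> (x \<otimes> r) = (t \<otimes> x) \<otimes> r"
    using t(1,3) r by (simp add: m_assoc)
  also have "\<dots> = \<zero>"
    using t(2) r by simp
  finally show "x \<otimes> r \<in> I"
    using t(1,3) r by (auto simp: I_iff)
  \<comment> \<open>Closure under left multiplication rests on the Ore condition:
    \<open>u r x = a t x = 0\<close>.\<close>
  obtain u a where u: "u \<in> T" "a \<in> carrier A" "u \<otimes> r = a \<otimes> t"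
    using T_ore[OF r t(1)] by auto
  have "u \<otimes> (r \<otimes> x) = a \<otimes> (t \<otimes> x)"
    using u t(1,3) r by (simp add: m_assoc[symmetric])
  then show "r \<otimes> x \<in> I"
    using u t r by (auto simp: I_iff)
qed (rule ring_axioms)

sublocale I: ideal I A by (rule I_ideal)

lemma I_smult: "x \<in> I \<Longrightarrow> c \<odot> x \<in> I"
proof -
  assume "x \<in> I"
  then obtain t where t: "t \<in> T" "t \<otimes> x = \<zero>" "x \<in> carrier A"
    by (auto simp: I_iff)
  have "c \<odot> \<zero> = \<zero>"
    using smult_add[of \<zero> \<zero> c] smult_closed[of \<zero> c] by (metis add.l_cancel_one' l_zero zero_closed)
  then have "t \<otimes> (c \<odot> x) = \<zero>"
    using t by (simp add: mult_smult)
  then show ?thesis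
    using t by (auto simp: I_iff)
qed

lemma D_inter_I:
  assumes "d \<in> D" "d \<in> I"
  shows "d = \<zero>"
proof -
  obtain t where "t \<in> T" "t \<otimes> d = \<zero>"
    using assms by (auto simp: I_iff)
  then show ?thesis
    using D_domain[of t d] zero_notin_T assms by auto
qed

text \<open>With \<open>t r\<close> and \<open>u s\<close> in \<open>D\<close> and
  \<open>u (t r) = d u\<close>, the product \<open>d (u s)\<close> equals
  \<open>(u t) (r s)\<close>. It lies in both \<open>D\<close> and \<open>I\<close>, hence vanishes,
  and one of its factors in the domain \<open>D\<close> is zero.\<close>

lemma I_prime:
  assumes r: "r \<in> carrier A" and s: "s \<in> carrier A" and rs: "r \<otimes> s \<in> I"
  shows "r \<in> I \<or> s \<in> I"
proof -
  obtain t u where t: "t \<in> T" "t \<otimes> r \<in> D" and u: "u \<in> T" "u \<otimes> s \<in> D"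
    using reach r s by meson
  obtain d where d: "d \<in> D" "u \<otimes> (t \<otimes> r) = d \<otimes> u"
    using shift[OF u(1) t(2)] by auto
  have "d \<otimes> (u \<otimes> s) = u \<otimes> (t \<otimes> r) \<otimes> s"
    unfolding d(2) using d(1) u(1) s by (simp add: m_assoc)
  also have "\<dots> = (u \<otimes> t) \<otimes> (r \<otimes> s)"
    using t(1) u(1) r s by (simp add: m_assoc)
  also have "\<dots> \<in> I"
    using I.I_l_closed[OF rs] t(1) u(1) by simp
  finally have "d \<otimes> (u \<otimes> s) = \<zero>"
    using D_inter_I d u by simp
  then consider "d = \<zero>" | "u \<otimes> s = \<zero>"
    using D_domain d u by blast
  then show ?thesis
  proof cases
    case 1
    then have "(u \<otimes> t) \<otimes> r = \<zero>"
      using d(2) t(1) u(1) r by (simp add: m_assoc)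
    then show ?thesis
      using T_mult[OF u(1) t(1)] r by (auto simp: I_iff)
  next
    case 2
    then show ?thesis
      using u(1) s by (auto simp: I_iff)
  qed
qed

section \<open>The largest left denominator set of left regular elements and its saturation\<close>

lemma S_largest: "left_denominator A S" "S \<subseteq> left_regular A"
  "\<lbrakk>left_denominator A X; X \<subseteq> left_regular A\<rbrakk> \<Longrightarrow> X \<subseteq> S"
  using prime_S_largest[OF one_neq_zero] by (auto simp: largest_left_den_in_def)

sublocale S: left_den A S
  by unfold_locales (rule S_largest)

lemma T_S: "t \<in> T \<Longrightarrow> t \<in> S"
  using S_largest(3)[OF T_den T_regular] by auto

lemma S_zero: "\<zero> \<notin> S"
  using S.S_multiplicative by (auto simp: multiplicative_def)

lemma sat_carrier: "x \<in> sat \<Longrightarrow> x \<in> carrier A"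
  by (simp add: sat_def)

lemma S_sat: "S \<subseteq> sat"
  using T_one by (auto simp: sat_def intro!: bexI[of _ \<one>])

text \<open>If \<open>u x = 0\<close>, then \<open>u (t x) = t (u x) = 0\<close> would be a product
  of two elements of \<open>S\<close>.\<close>

lemma sat_not_I:
  assumes "x \<in> sat"
  shows "x \<notin> I"
proof
  assume "x \<in> I"
  then obtain u where u: "u \<in> T" "u \<otimes> x = \<zero>"
    by (auto simp: I_iff)
  obtain t where t: "x \<in> carrier A" "t \<in> T" "t \<otimes> x \<in> S"
    using assms by (auto simp: sat_def)
  have "u \<otimes> (t \<otimes> x) = (t \<otimes> u) \<otimes> x"
    using t(1,2) u(1) T_comm[of t u] by (simp add: m_assoc[symmetric])
  also have "\<dots> = \<zero>"
    using t(1,2) u by (simp add: m_assoc)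
  finally show False
    using S_zero S.S_mult[OF T_S[OF u(1)] t(3)] by auto
qed

lemma S_cancel_right:
  assumes x: "x \<in> carrier A" and t: "t \<in> T" and xt: "x \<otimes> t \<in> S"
  shows "x \<in> S"
proof (rule prime_S_absorb[OF one_neq_zero])
  have tc: "t \<in> carrier A" using t by simp
  show "x \<in> left_regular A"
    unfolding left_regular_def
  proof (intro CollectI conjI x ballI impI)
    fix r assume r: "r \<in> carrier A" "r \<otimes> x = \<zero>"
    then have "r \<otimes> (x \<otimes> t) = \<zero>"
      using x tc by (simp add: m_assoc[symmetric])
    then show "r = \<zero>"
      using S_largest(2) xt r by (auto simp: left_regular_def)
  qed
  fix r assume r: "r \<in> carrier A"
  \<comment> \<open>The Ore condition is taken for \<open>r t\<close> against \<open>x t\<close>;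
    the common right factor \<open>t\<close> then cancels because it is left regular.\<close>
  obtain s a where s: "s \<in> S" "a \<in> carrier A" "s \<otimes> (r \<otimes> t) = a \<otimes> (x \<otimes> t)"
    using S.ore[OF _ xt, of "r \<otimes> t"] r tc by auto
  have sc: "s \<in> carrier A" using s(1) by simp
  have "(s \<otimes> r \<ominus> a \<otimes> x) \<otimes> t = s \<otimes> (r \<otimes> t) \<ominus> a \<otimes> (x \<otimes> t)"
    using r x tc s(2) sc by (simp add: minus_eq l_distr l_minus m_assoc)
  also have "\<dots> = \<zero>"
    unfolding s(3) using s(2) x tc by (simp add: minus_eq r_neg)
  finally have "s \<otimes> r \<ominus> a \<otimes> x = \<zero>"
    using T_cancel[OF t] r x s(2) sc by simp
  then have "s \<otimes> r = a \<otimes> x"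
    using r x s(2) sc by simp
  then show "\<exists>u\<in>S. \<exists>a\<in>carrier A. u \<otimes> r = a \<otimes> x"
    using s by blast
qed

lemma S_to_D':
  assumes "x \<in> S"
  shows "\<exists>u\<in>T. u \<otimes> x \<in> D'"
proof -
  obtain u where "u \<in> T" "u \<otimes> x \<in> D"
    using reach[of x] assms by auto
  then show ?thesis
    using S.S_mult[OF T_S assms] by auto
qed

lemma sat_to_D':
  assumes "x \<in> sat"
  shows "\<exists>u\<in>T. u \<otimes> x \<in> D'"
proof -
  obtain t where t: "x \<in> carrier A" "t \<in> T" "t \<otimes> x \<in> S"
    using assms by (auto simp: sat_def)
  obtain u where u: "u \<in> T" "u \<otimes> (t \<otimes> x) \<in> D'"
    using S_to_D'[OF t(3)] by auto
  then have "(u \<otimes> t) \<otimes> x \<in> D'"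
    using t(1,2) by (simp add: m_assoc)
  then show ?thesis
    using T_mult[OF u(1) t(2)] by blast
qed

lemma sat_mult:
  assumes x: "x \<in> sat" and y: "y \<in> sat"
  shows "x \<otimes> y \<in> sat"
proof -
  obtain t where t: "t \<in> T" "t \<otimes> x \<in> D'"
    using sat_to_D'[OF x] by auto
  obtain u where u: "u \<in> T" "u \<otimes> y \<in> S"
    using y by (auto simp: sat_def)
  \<comment> \<open>\<open>u\<close> need not commute with \<open>t x\<close>. The shift gives
    \<open>d u\<close> instead, and \<open>d u \<in> S\<close> yields \<open>d \<in> S\<close> by
    \<open>S_cancel_right\<close>. This is why \<open>t x\<close> was chosen in \<open>D\<close> and
    not merely in \<open>S\<close>.\<close>
  obtain d where d: "d \<in> D" "u \<otimes> (t \<otimes> x) = d \<otimes> u"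
    using shift[OF u(1)] t(2) by auto
  have "d \<otimes> u \<in> S"
    using S.S_mult[OF T_S[OF u(1)], of "t \<otimes> x"] t(2) d(2) by auto
  then have "d \<in> S"
    by (rule S_cancel_right[OF D_carrier[OF d(1)] u(1)])
  then have "d \<otimes> (u \<otimes> y) \<in> S"
    using u(2) by auto
  also have "d \<otimes> (u \<otimes> y) = (u \<otimes> (t \<otimes> x)) \<otimes> y"
    unfolding d(2) using d(1) u(1) sat_carrier[OF y] by (simp add: m_assoc)
  also have "\<dots> = (u \<otimes> t) \<otimes> (x \<otimes> y)"
    using t(1) u(1) sat_carrier[OF x] sat_carrier[OF y] by (simp add: m_assoc)
  finally show ?thesis
    using T_mult[OF u(1) t(1)] m_closed[OF sat_carrier[OF x] sat_carrier[OF y]]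
    unfolding sat_def by blast
qed

lemma sat_add_I:
  assumes x: "x \<in> sat" and z: "z \<in> I"
  shows "x \<oplus> z \<in> sat"
proof -
  obtain t where t: "t \<in> T" "t \<otimes> x \<in> S"
    using x by (auto simp: sat_def)
  obtain u where u: "u \<in> T" "u \<otimes> z = \<zero>"
    using z by (auto simp: I_iff)
  have c: "x \<in> carrier A" "z \<in> carrier A"
    using sat_carrier[OF x] I_carrier[OF z] by auto
  have "(u \<otimes> t) \<otimes> (x \<oplus> z) = (u \<otimes> t) \<otimes> x \<oplus> (t \<otimes> u) \<otimes> z"
    using c t(1) u(1) T_comm[of t u] by (simp add: r_distr)
  also have "\<dots> = u \<otimes> (t \<otimes> x)"
    using c t(1) u by (simp add: m_assoc)
  also have "\<dots> \<in> S"
    using T_S[OF u(1)] t(2) by auto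
  finally show ?thesis
    using T_mult[OF u(1) t(1)] c by (auto simp: sat_def)
qed

definition admissible where
  "admissible X \<longleftrightarrow> D' \<subseteq> X \<and> X \<subseteq> sat \<and> (\<forall>x\<in>X. \<forall>y\<in>X. x \<otimes> y \<in> X)"

text \<open>The multiplier lies in \<open>D'\<close>, hence in every admissible set: an Ore
  multiplier \<open>s \<in> S\<close> for \<open>t x\<close> is brought into \<open>D\<close> by an
  element of \<open>T\<close>.\<close>

lemma admissible_ore:
  assumes X: "admissible X" and r: "r \<in> carrier A" and x: "x \<in> X"
  shows "\<exists>u\<in>D'. \<exists>a\<in>carrier A. u \<otimes> r = a \<otimes> x"
proof -
  have "x \<in> sat" using X x by (auto simp: admissible_def)
  then obtain t where t: "x \<in> carrier A" "t \<in> T" "t \<otimes> x \<in> S"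
    by (auto simp: sat_def)
  obtain s a where s: "s \<in> S" "a \<in> carrier A" "s \<otimes> r = a \<otimes> (t \<otimes> x)"
    using S.ore[OF r t(3)] by auto
  obtain u where u: "u \<in> T" "u \<otimes> s \<in> D'"
    using S_to_D'[OF s(1)] by auto
  have "(u \<otimes> s) \<otimes> r = u \<otimes> (a \<otimes> (t \<otimes> x))"
    using u(1) s(1) r by (simp add: m_assoc s(3)[symmetric])
  also have "\<dots> = (u \<otimes> (a \<otimes> t)) \<otimes> x"
    using u(1) s(2) t(1,2) by (simp add: m_assoc)
  finally show ?thesis
    using u s(2) t(2) by (intro bexI[of _ "u \<otimes> s"] bexI[of _ "u \<otimes> (a \<otimes> t)"]) auto
qed

lemma D'_sat: "D' \<subseteq> sat"
  using S_sat by auto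

lemma T_D': "T \<subseteq> D'"
  using T_S by auto

text \<open>An element \<open>x\<close> of \<open>sat\<close> avoids \<open>I\<close>, so by
  complete primeness \<open>r x = 0\<close> or \<open>x r = 0\<close> forces
  \<open>r \<in> I\<close>. Conversely each element of \<open>I\<close> is annihilated by an element
  of \<open>T\<close>, and \<open>T\<close> is contained in \<open>X\<close>.\<close>

lemma admissible_den:
  assumes X: "admissible X"
  shows "left_denominator A X" "ass_l A X = I"
proof -
  have Xs: "x \<in> sat" if "x \<in> X" for x using X that by (auto simp: admissible_def)
  have D'X: "D' \<subseteq> X" using X by (auto simp: admissible_def)
  have TX: "T \<subseteq> X" using T_D' D'X by auto
  show "left_denominator A X"
  proof (rule left_denominatorI)
    show "X \<subseteq> carrier A" using Xs sat_carrier by auto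
    show "\<one> \<in> X" using TX T_one by auto
    show "\<zero> \<notin> X" using Xs sat_not_I zero_I by blast
    show "s \<otimes> t \<in> X" if "s \<in> X" "t \<in> X" for s t
      using X that by (auto simp: admissible_def)
    show "\<exists>u\<in>X. \<exists>a\<in>carrier A. u \<otimes> r = a \<otimes> s" if "r \<in> carrier A" "s \<in> X" for r s
      using admissible_ore[OF X that] D'X by blast
    show "\<exists>t\<in>X. t \<otimes> r = \<zero>" if "r \<in> carrier A" "s \<in> X" "r \<otimes> s = \<zero>" for r s
    proof -
      have "r \<in> I"
        using I_prime[of r s] that zero_I sat_not_I[OF Xs] sat_carrier[OF Xs] by metis
      then show ?thesis
        using TX by (auto simp: I_iff)
    qed
  qed
  show "ass_l A X = I"
  proof
    show "I \<subseteq> ass_l A X" using TX unfolding ass_l_def by blast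
    show "ass_l A X \<subseteq> I"
    proof
      fix r assume "r \<in> ass_l A X"
      then obtain x where "x \<in> X" "r \<in> carrier A" "x \<otimes> r = \<zero>"
        unfolding ass_l_def by blast
      then show "r \<in> I"
        using I_prime[of x r] zero_I sat_not_I[OF Xs] sat_carrier[OF Xs] by metis
    qed
  qed
qed

lemma admissible_Den_l: "admissible X \<Longrightarrow> X \<in> Den_l A I"
  using admissible_den by (simp add: Den_l_def)

lemma admissible_left_den: "admissible X \<Longrightarrow> left_den A X"
  using admissible_den(1) by unfold_locales

lemma admissible_D': "admissible D'"
  using D'_sat by (auto simp: admissible_def)

lemma admissible_S: "admissible S"
  using S_sat by (auto simp: admissible_def)

lemma admissible_tilde: "admissible (D \<inter> sat)"
  using D'_sat sat_mult by (auto simp: admissible_def)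

lemma admissible_set_add:
  assumes X: "X \<subseteq> sat" "D' \<subseteq> X <+>\<^bsub>A\<^esub> I" "\<And>x y. \<lbrakk>x \<in> X; y \<in> X\<rbrakk> \<Longrightarrow> x \<otimes> y \<in> X"
  shows "admissible (X <+>\<^bsub>A\<^esub> I)"
  unfolding admissible_def
proof (intro conjI ballI X)
  show "X <+>\<^bsub>A\<^esub> I \<subseteq> sat"
    using X(1) sat_add_I by (auto simp: set_add_def')
  fix a b assume "a \<in> X <+>\<^bsub>A\<^esub> I" "b \<in> X <+>\<^bsub>A\<^esub> I"
  then obtain x y z w where *: "x \<in> X" "y \<in> X" "z \<in> I" "w \<in> I" "a = x \<oplus> z" "b = y \<oplus> w"
    by (auto simp: set_add_def')
  have c: "x \<in> carrier A" "y \<in> carrier A" "z \<in> carrier A" "w \<in> carrier A"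
    using * X(1) sat_carrier I_carrier by auto
  \<comment> \<open>All terms other than \<open>x y\<close> contain a factor from
    \<open>I\<close>.\<close>
  have "a \<otimes> b = x \<otimes> y \<oplus> (x \<otimes> w \<oplus> z \<otimes> (y \<oplus> w))"
    unfolding * using c by (simp add: l_distr r_distr a_ac)
  moreover have "x \<otimes> w \<oplus> z \<otimes> (y \<oplus> w) \<in> I"
    using * c by (simp add: I.I_l_closed I.I_r_closed)
  ultimately show "a \<otimes> b \<in> X <+>\<^bsub>A\<^esub> I"
    using X(3)[OF *(1,2)] unfolding set_add_def' by blast
qed

lemma subset_set_add_I: "X \<subseteq> carrier A \<Longrightarrow> X \<subseteq> X <+>\<^bsub>A\<^esub> I"
proof
  fix x assume "X \<subseteq> carrier A" "x \<in> X"
  then have "x = x \<oplus> \<zero>" by auto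
  then show "x \<in> X <+>\<^bsub>A\<^esub> I"
    using \<open>x \<in> X\<close> zero_I unfolding set_add_def' by blast
qed

lemma admissible_add_I:
  assumes "admissible X"
  shows "admissible (X <+>\<^bsub>A\<^esub> I)"
proof (rule admissible_set_add)
  show "D' \<subseteq> X <+>\<^bsub>A\<^esub> I"
    using assms subset_set_add_I[of X] sat_carrier by (auto simp: admissible_def)
qed (use assms in \<open>auto simp: admissible_def\<close>)

text \<open>The identity satisfies \<open>localization_isoI\<close>: both kernels are
  \<open>I\<close>, and a denominator in \<open>sat\<close> is pushed into \<open>D'\<close> by some
  \<open>u \<in> T\<close>.\<close>

lemma localization_admissible:
  assumes "admissible X"
  shows "localization A D' \<simeq>\<^sub>K localization A X"
proof (rule localization_isoI[where \<phi> = id])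
  show "left_den A D'" "left_den A X"
    using admissible_left_den admissible_D' assms by auto
  show "id ` D' \<subseteq> X"
    using assms by (auto simp: admissible_def)
  show "id \<in> ring_hom A A"
    by (rule id_ring_hom)
  show "x \<in> ass_l A D'" if "id x \<in> ass_l A X" for x
    using that admissible_den(2)[OF assms] admissible_den(2)[OF admissible_D'] by simp
  fix t b assume "t \<in> X" "b \<in> carrier A"
  have "t \<in> sat"
    using \<open>t \<in> X\<close> assms unfolding admissible_def by blast
  from sat_to_D'[OF this] obtain u where "u \<in> T" "u \<otimes> t \<in> D'"
    by blast
  then show "\<exists>c\<in>carrier A. \<exists>s\<in>D'. \<exists>r\<in>carrier A. c \<otimes> t = id s \<and> c \<otimes> b = id r"
    using \<open>b \<in> carrier A\<close>
    by - (rule bexI[of _ u], rule bexI[of _ "u \<otimes> t"], rule bexI[of _ "u \<otimes> b"], simp_all)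
qed auto

lemma localization_admissible2:
  assumes "admissible X" "admissible Y"
  shows "localization A X \<simeq>\<^sub>K localization A Y"
  using alg_isomorphic_trans localization_admissible[OF assms(2)]
    localization_iso_sym[OF admissible_left_den[OF admissible_D'] localization_admissible[OF assms(1)]]
  by blast

section \<open>Passage to the factor algebra \<open>A / I\<close>\<close>

abbreviation B where "B \<equiv> quot_algebra A I"
abbreviation \<pi> where "\<pi> \<equiv> (+>) I"

lemma pi_hom: "\<pi> \<in> ring_hom A B"
  by (rule coset_ring_hom[OF I_ideal])

lemma B_k_algebra: "k_algebra B"
  using k_algebra_quot[OF I_ideal I_smult] .

lemma pi_eq_zero_iff: "x \<in> carrier A \<Longrightarrow> \<pi> x = \<zero>\<^bsub>B\<^esub> \<longleftrightarrow> x \<in> I"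
  using I.rcos_const_imp_mem I.a_rcos_const by (auto simp: quot_algebra_simps)

lemma B_carrierE:
  assumes "b \<in> carrier B"
  obtains x where "x \<in> carrier A" "b = \<pi> x"
  using assms by (auto simp: carrier_quot_algebra)

lemma pi_mult: "\<lbrakk>x \<in> carrier A; y \<in> carrier A\<rbrakk> \<Longrightarrow> \<pi> x \<otimes>\<^bsub>B\<^esub> \<pi> y = \<pi> (x \<otimes> y)"
  using ring_hom_mult[OF pi_hom] by simp

text \<open>Modulo the completely prime ideal \<open>I\<close> the images of elements of
  \<open>X\<close> are regular on both sides, which settles reversibility and the vanishing of
  \<open>ass_l\<close>; the Ore condition is inherited from \<open>A\<close>.\<close>

lemma admissible_quot:
  assumes X: "admissible X"
  shows "left_denominator B (\<pi> ` X)" "ass_l B (\<pi> ` X) = {\<zero>\<^bsub>B\<^esub>}"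
proof -
  interpret X: left_den A X by (rule admissible_left_den[OF X])
  interpret B: k_algebra B by (rule B_k_algebra)
  have Xs: "x \<in> sat" if "x \<in> X" for x using X that by (auto simp: admissible_def)
  have Bc: "\<pi> x \<in> carrier B" if "x \<in> carrier A" for x
    using that by (auto simp: carrier_quot_algebra)
  have XI: "x \<notin> I" if "x \<in> X" for x using Xs sat_not_I that by auto
  have one: "\<pi> \<one> = \<one>\<^bsub>B\<^esub>" by (simp add: quot_algebra_simps)
  show "left_denominator B (\<pi> ` X)"
  proof (rule B.left_denominatorI)
    show "\<pi> ` X \<subseteq> carrier B" using Bc by auto
    show "\<one>\<^bsub>B\<^esub> \<in> \<pi> ` X" using one X.S_one by (metis image_eqI)
    show "\<zero>\<^bsub>B\<^esub> \<notin> \<pi> ` X"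
    proof
      assume "\<zero>\<^bsub>B\<^esub> \<in> \<pi> ` X"
      then obtain x where x: "x \<in> X" "\<pi> x = \<zero>\<^bsub>B\<^esub>" by auto
      then show False
        using pi_eq_zero_iff[OF X.S_carrier] XI by blast
    qed
    show "s \<otimes>\<^bsub>B\<^esub> t \<in> \<pi> ` X" if "s \<in> \<pi> ` X" "t \<in> \<pi> ` X" for s t
      using that by (auto simp: pi_mult)
    show "\<exists>u\<in>\<pi> ` X. \<exists>a\<in>carrier B. u \<otimes>\<^bsub>B\<^esub> r = a \<otimes>\<^bsub>B\<^esub> s"
      if rs: "r \<in> carrier B" "s \<in> \<pi> ` X" for r s
    proof -
      obtain x y where xy: "x \<in> carrier A" "r = \<pi> x" "y \<in> X" "s = \<pi> y"
        using rs B_carrierE by (metis imageE)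
      obtain u a where u: "u \<in> X" "a \<in> carrier A" "u \<otimes> x = a \<otimes> y"
        using X.ore[OF xy(1,3)] by auto
      have "\<pi> u \<otimes>\<^bsub>B\<^esub> r = \<pi> a \<otimes>\<^bsub>B\<^esub> s"
        using xy u by (simp add: pi_mult)
      then show ?thesis using u Bc by blast
    qed
    show "\<exists>t\<in>\<pi> ` X. t \<otimes>\<^bsub>B\<^esub> r = \<zero>\<^bsub>B\<^esub>"
      if rs: "r \<in> carrier B" "s \<in> \<pi> ` X" "r \<otimes>\<^bsub>B\<^esub> s = \<zero>\<^bsub>B\<^esub>" for r s
    proof -
      obtain x y where xy: "x \<in> carrier A" "r = \<pi> x" "y \<in> X" "s = \<pi> y"
        using rs(1,2) B_carrierE by (metis imageE)
      have "x \<otimes> y \<in> I"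
        using rs(3) xy pi_eq_zero_iff[of "x \<otimes> y"] by (simp add: pi_mult)
      then have "x \<in> I" using I_prime[of x y] XI xy by auto
      then have "r = \<zero>\<^bsub>B\<^esub>" using xy pi_eq_zero_iff by simp
      moreover have "\<pi> \<one> \<in> \<pi> ` X" "\<pi> \<one> \<otimes>\<^bsub>B\<^esub> \<zero>\<^bsub>B\<^esub> = \<zero>\<^bsub>B\<^esub>"
        using X.S_one Bc by simp_all
      ultimately show ?thesis by blast
    qed
  qed
  show "ass_l B (\<pi> ` X) = {\<zero>\<^bsub>B\<^esub>}"
  proof
    have "\<pi> \<one> \<in> \<pi> ` X" "\<pi> \<one> \<otimes>\<^bsub>B\<^esub> \<zero>\<^bsub>B\<^esub> = \<zero>\<^bsub>B\<^esub>"
      using X.S_one Bc by simp_all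
    then show "{\<zero>\<^bsub>B\<^esub>} \<subseteq> ass_l B (\<pi> ` X)"
      unfolding ass_l_def[of B] using B.zero_closed by blast
    show "ass_l B (\<pi> ` X) \<subseteq> {\<zero>\<^bsub>B\<^esub>}"
    proof
      fix b assume b: "b \<in> ass_l B (\<pi> ` X)"
      then obtain x y where xy: "x \<in> carrier A" "b = \<pi> x" "y \<in> X" "\<pi> y \<otimes>\<^bsub>B\<^esub> b = \<zero>\<^bsub>B\<^esub>"
        using B_carrierE unfolding ass_l_def by blast
      have "y \<otimes> x \<in> I"
        using xy pi_eq_zero_iff[of "y \<otimes> x"] by (simp add: pi_mult)
      then have "x \<in> I" using I_prime[of y x] XI xy by auto
      then show "b \<in> {\<zero>\<^bsub>B\<^esub>}" using xy pi_eq_zero_iff by simp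
    qed
  qed
qed

lemma admissible_quot_Den_l: "admissible X \<Longrightarrow> \<pi> ` X \<in> Den_l B {\<zero>\<^bsub>B\<^esub>}"
  using admissible_quot by (simp add: Den_l_def)

lemma admissible_quot_left_den: "admissible X \<Longrightarrow> left_den B (\<pi> ` X)"
  using admissible_quot(1) B_k_algebra by (simp add: left_den_def left_den_axioms_def)

text \<open>The kernel of \<open>\<pi>\<close> is exactly \<open>ass_l A X\<close>, so the quotient
  identifies nothing that the localization does not identify already. As \<open>\<pi>\<close> is
  surjective, fractions need no expansion and \<open>c = \<one>\<close> serves.\<close>

lemma localization_quot:
  assumes X: "admissible X"
  shows "localization A X \<simeq>\<^sub>K localization B (\<pi> ` X)"
proof (rule localization_isoI[where \<phi> = \<pi>])
  interpret B: k_algebra B by (rule B_k_algebra)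
  show "left_den A X" "left_den B (\<pi> ` X)"
    using admissible_left_den admissible_quot_left_den X by auto
  show "\<pi> (c \<odot> x) = c \<odot>\<^bsub>B\<^esub> \<pi> x" if "x \<in> carrier A" for c x
    using smult_coset[OF I_ideal I_smult that] by simp
  show "x \<in> ass_l A X" if "x \<in> carrier A" "\<pi> x \<in> ass_l B (\<pi> ` X)" for x
    using that admissible_quot(2)[OF X] admissible_den(2)[OF X] pi_eq_zero_iff by simp
  fix t b assume t: "t \<in> \<pi> ` X" and b: "b \<in> carrier B"
  then have "t \<in> carrier B"
    using X sat_carrier by (auto simp: admissible_def carrier_quot_algebra)
  then have "\<one>\<^bsub>B\<^esub> \<otimes>\<^bsub>B\<^esub> t = t" "\<one>\<^bsub>B\<^esub> \<otimes>\<^bsub>B\<^esub> b = b"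
    using b by auto
  moreover obtain s r where "s \<in> X" "t = \<pi> s" "r \<in> carrier A" "b = \<pi> r"
    using t B_carrierE[OF b] by blast
  ultimately show "\<exists>c\<in>carrier B. \<exists>s\<in>X. \<exists>r\<in>carrier A. c \<otimes>\<^bsub>B\<^esub> t = \<pi> s \<and> c \<otimes>\<^bsub>B\<^esub> b = \<pi> r"
    using B.one_closed by blast
qed (use pi_hom in auto)

lemma localization_quot2:
  assumes "admissible X" "admissible Y"
  shows "localization B (\<pi> ` X) \<simeq>\<^sub>K localization A Y"
  using alg_isomorphic_trans[OF localization_iso_sym[OF admissible_left_den localization_quot]
      localization_admissible2] assms by blast

lemma localization_quot3:
  assumes "admissible X" "admissible Y"
  shows "localization B (\<pi> ` X) \<simeq>\<^sub>K localization B (\<pi> ` Y)"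
  using alg_isomorphic_trans[OF localization_quot2[OF assms] localization_quot] assms by blast

text \<open>By \<open>D \<inter> I = 0\<close>; this is what identifies \<open>D'\<close> with its
  image in \<open>A / I\<close>.\<close>

lemma pi_inj_D: "inj_on \<pi> D"
proof (rule inj_onI)
  fix x y assume xy: "x \<in> D" "y \<in> D" "\<pi> x = \<pi> y"
  then have "x \<in> I +> y"
    using I.a_rcos_self[of x] by simp
  then obtain i where i: "i \<in> I" "x = i \<oplus> y"
    by (auto simp: a_r_coset_def')
  then have "x \<ominus> y = i"
    using I_carrier[OF i(1)] xy by (simp add: minus_eq a_assoc r_neg)
  then have "x \<ominus> y \<in> I" using i by simp
  then have "x \<ominus> y = \<zero>"
    using D_inter_I D_minus xy by auto
  then show "x = y"
    using xy by simp
qed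

section \<open>The subalgebra \<open>D\<close> as a ring of its own\<close>

lemma D_k_algebra: "k_algebra (A\<lparr>carrier := D\<rparr>)"
  by (rule k_algebra_restrict[OF D_subalgebra])

lemma D'_Den_l_D: "D' \<in> Den_l (A\<lparr>carrier := D\<rparr>) {\<zero>}"
proof -
  interpret R: k_algebra "A\<lparr>carrier := D\<rparr>" by (rule D_k_algebra)
  interpret X: left_den A D' by (rule admissible_left_den[OF admissible_D'])
  have reg: "r = \<zero>" if "r \<in> D" "s \<in> D'" "r \<otimes> s = \<zero> \<or> s \<otimes> r = \<zero>" for r s
    using that D_domain S_zero by blast
  have ore: "\<exists>u\<in>D'. \<exists>a\<in>D. u \<otimes> r = a \<otimes> s" if rs: "r \<in> D" "s \<in> D'" for r s
  proof -
    obtain u a where u: "u \<in> D'" "a \<in> carrier A" "u \<otimes> r = a \<otimes> s"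
      using X.ore[of r s] rs by auto
    \<comment> \<open>The coefficient \<open>a\<close> is only known to lie in \<open>A\<close>; a
      further factor \<open>t\<close> brings it into \<open>D\<close> and keeps \<open>t u\<close>
      in \<open>D'\<close>.\<close>
    obtain t where t: "t \<in> T" "t \<otimes> a \<in> D"
      using reach[OF u(2)] by auto
    have "(t \<otimes> u) \<otimes> r = (t \<otimes> a) \<otimes> s"
      using t u rs by (simp add: m_assoc)
    moreover have "t \<otimes> u \<in> D'"
      using t(1) u(1) T_S by auto
    ultimately show ?thesis using t(2) by blast
  qed
  have "left_denominator (A\<lparr>carrier := D\<rparr>) D'"
  proof (rule R.left_denominatorI)
    fix r s assume rs: "r \<in> carrier (A\<lparr>carrier := D\<rparr>)" "s \<in> D'"
    show "\<exists>u\<in>D'. \<exists>a\<in>carrier (A\<lparr>carrier := D\<rparr>).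
        u \<otimes>\<^bsub>A\<lparr>carrier := D\<rparr>\<^esub> r = a \<otimes>\<^bsub>A\<lparr>carrier := D\<rparr>\<^esub> s"
      using ore[of r s] rs by simp
    assume "r \<otimes>\<^bsub>A\<lparr>carrier := D\<rparr>\<^esub> s = \<zero>\<^bsub>A\<lparr>carrier := D\<rparr>\<^esub>"
    then have "r = \<zero>"
      using reg[of r s] rs by simp
    then show "\<exists>t\<in>D'. t \<otimes>\<^bsub>A\<lparr>carrier := D\<rparr>\<^esub> r = \<zero>\<^bsub>A\<lparr>carrier := D\<rparr>\<^esub>"
      using X.S_one by (intro bexI[of _ \<one>]) simp_all
  qed (use X.S_one S_zero in auto)
  moreover have "ass_l (A\<lparr>carrier := D\<rparr>) D' = {\<zero>}"
  proof
    show "ass_l (A\<lparr>carrier := D\<rparr>) D' \<subseteq> {\<zero>}"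
      using reg by (simp add: ass_l_def) blast
    show "{\<zero>} \<subseteq> ass_l (A\<lparr>carrier := D\<rparr>) D'"
      using X.S_one by (simp add: ass_l_def) (use S.S_one in blast)
  qed
  ultimately show ?thesis
    by (simp add: Den_l_def)
qed

lemma localization_D: "localization (A\<lparr>carrier := D\<rparr>) D' \<simeq>\<^sub>K localization A S"
proof (rule localization_isoI[where \<phi> = id])
  show "left_den (A\<lparr>carrier := D\<rparr>) D'"
    using D'_Den_l_D D_k_algebra by (simp add: left_den_def left_den_axioms_def Den_l_def)
  show "left_den A S"
    using admissible_left_den admissible_S by auto
  show "id \<in> ring_hom (A\<lparr>carrier := D\<rparr>) A"
    by (auto simp: ring_hom_def)
  show "x \<in> ass_l (A\<lparr>carrier := D\<rparr>) D'"
    if "x \<in> carrier (A\<lparr>carrier := D\<rparr>)" "id x \<in> ass_l A S" for x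
  proof -
    have "x = \<zero>"
      using that admissible_den(2)[OF admissible_S] D_inter_I by simp
    then show ?thesis
      using D'_Den_l_D by (simp add: Den_l_def)
  qed
  fix t b assume t: "t \<in> S" and b: "b \<in> carrier A"
  obtain u where u: "u \<in> T" "u \<otimes> t \<in> D'"
    using S_to_D'[OF t] by auto
  \<comment> \<open>\<open>u\<close> has moved the denominator into \<open>D'\<close>; left
    multiplication by \<open>v \<in> T\<close> clears the numerator and keeps the denominator
    there.\<close>
  obtain v where v: "v \<in> T" "v \<otimes> (u \<otimes> b) \<in> D"
    using reach[of "u \<otimes> b"] u(1) b by auto
  have "v \<otimes> (u \<otimes> t) \<in> D'"
    using v(1) u(2) T_S by auto
  then have "(v \<otimes> u) \<otimes> t \<in> D'" "(v \<otimes> u) \<otimes> b \<in> D" "v \<otimes> u \<in> carrier A"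
    using u(1) v t b by (auto simp: m_assoc)
  then show "\<exists>c\<in>carrier A. \<exists>s\<in>D'. \<exists>r\<in>carrier (A\<lparr>carrier := D\<rparr>). c \<otimes> t = id s \<and> c \<otimes> b = id r"
    by auto
qed auto

text \<open>A competitor consists of left regular elements, so it lies in \<open>S\<close> by
  maximality of \<open>S\<close>, and it lies in \<open>D\<close> by assumption.\<close>

lemma largest_D': "largest_left_den_in A (left_regular A \<inter> D) D'"
  using admissible_den(1)[OF admissible_D'] S_largest
  unfolding largest_left_den_in_def by blast

lemma multiplicative_regular_D: "multiplicative A (left_regular A \<inter> D)"
  unfolding multiplicative_def
proof (intro conjI ballI)
  show "left_regular A \<inter> D \<subseteq> carrier A"
    by auto
  show "\<one> \<in> left_regular A \<inter> D"
    using one_left_regular T_one by simp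
  show "\<zero> \<notin> left_regular A \<inter> D"
    using zero_not_left_regular[OF one_neq_zero] by simp
qed (simp add: left_regular_mult)

text \<open>Left regularity in \<open>A\<close> passes to the subring \<open>D + I\<close>, where
  fewer multipliers have to be tested.\<close>

lemma D'_subset_dprime:
  "D' \<subseteq> S \<inter> (left_regular (A\<lparr>carrier := D <+>\<^bsub>A\<^esub> I\<rparr>) <+>\<^bsub>A\<^esub> I)"
proof
  fix d assume d: "d \<in> D'"
  have DI: "D <+>\<^bsub>A\<^esub> I \<subseteq> carrier A"
    using I_carrier by (auto simp: set_add_def')
  have dc: "d \<in> carrier A" "d \<in> D <+>\<^bsub>A\<^esub> I"
    using d subset_set_add_I[of D] D_carrier by blast+
  have "d \<in> left_regular (A\<lparr>carrier := D <+>\<^bsub>A\<^esub> I\<rparr>)"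
    using d dc DI S_largest(2) by (auto simp: left_regular_def subset_iff)
  moreover have "left_regular (A\<lparr>carrier := D <+>\<^bsub>A\<^esub> I\<rparr>) \<subseteq> carrier A"
    using DI by (auto simp: left_regular_def)
  ultimately show "d \<in> S \<inter> (left_regular (A\<lparr>carrier := D <+>\<^bsub>A\<^esub> I\<rparr>) <+>\<^bsub>A\<^esub> I)"
    using subset_set_add_I d by auto
qed

text \<open>Membership in \<open>S\<close> bounds the set by \<open>sat\<close>. For closure under
  products, left regular elements of the subring \<open>D + I\<close> multiply to left regular ones
  and the remaining terms are absorbed by \<open>I\<close>.\<close>

lemma admissible_dprime:
  "admissible ((S \<inter> (left_regular (A\<lparr>carrier := D <+>\<^bsub>A\<^esub> I\<rparr>) <+>\<^bsub>A\<^esub> I)) <+>\<^bsub>A\<^esub> I)" (is "admissible (?X <+>\<^bsub>A\<^esub> I)")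
proof (rule admissible_set_add)
  show "?X \<subseteq> sat" using S_sat by auto
  show "D' \<subseteq> ?X <+>\<^bsub>A\<^esub> I"
    using D'_subset_dprime subset_set_add_I[of ?X] S.S_carrier by blast
  fix x y assume x: "x \<in> ?X" and y: "y \<in> ?X"
  have mul: "(a \<oplus> z) \<otimes> (b \<oplus> w) = a \<otimes> b \<oplus> (a \<otimes> w \<oplus> z \<otimes> (b \<oplus> w))"
    "a \<otimes> w \<oplus> z \<otimes> (b \<oplus> w) \<in> I"
    if "a \<in> carrier A" "b \<in> carrier A" "z \<in> I" "w \<in> I" for a b z w
    using that I_carrier[OF that(3)] I_carrier[OF that(4)]
    by (simp_all add: l_distr r_distr a_ac I.I_l_closed I.I_r_closed)
  let ?C = "left_regular (A\<lparr>carrier := D <+>\<^bsub>A\<^esub> I\<rparr>)"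
  have DI: "D <+>\<^bsub>A\<^esub> I \<subseteq> carrier A"
    using I_carrier by (auto simp: set_add_def')
  have DIm: "a \<otimes> b \<in> D <+>\<^bsub>A\<^esub> I" if ab: "a \<in> D <+>\<^bsub>A\<^esub> I" "b \<in> D <+>\<^bsub>A\<^esub> I" for a b
  proof -
    obtain d e z w where *: "d \<in> D" "e \<in> D" "z \<in> I" "w \<in> I" "a = d \<oplus> z" "b = e \<oplus> w"
      using ab by (auto simp: set_add_def')
    then show ?thesis
      using mul[of d e z w] D_mult[of d e] unfolding set_add_def' by auto
  qed
  have Cm: "a \<otimes> b \<in> ?C" if "a \<in> ?C" "b \<in> ?C" for a b
  proof -
    have ab: "a \<in> D <+>\<^bsub>A\<^esub> I" "b \<in> D <+>\<^bsub>A\<^esub> I"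
      using that by (auto simp: left_regular_def)
    moreover have "r = \<zero>" if r: "r \<in> D <+>\<^bsub>A\<^esub> I" "r \<otimes> (a \<otimes> b) = \<zero>" for r
    proof -
      have "(r \<otimes> a) \<otimes> b = \<zero>"
        using r ab DI by (subst m_assoc) auto
      then have "r \<otimes> a = \<zero>"
        using \<open>b \<in> ?C\<close> DIm[OF r(1) ab(1)] by (auto simp: left_regular_def)
      then show ?thesis
        using \<open>a \<in> ?C\<close> r by (auto simp: left_regular_def)
    qed
    ultimately show ?thesis
      using DIm by (auto simp: left_regular_def)
  qed
  obtain a b z w where *: "a \<in> ?C" "b \<in> ?C" "z \<in> I" "w \<in> I" "x = a \<oplus> z" "y = b \<oplus> w"
    using x y by (auto simp: set_add_def')
  have "a \<in> carrier A" "b \<in> carrier A"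
    using * DI by (auto simp: left_regular_def)
  then have "x \<otimes> y \<in> ?C <+>\<^bsub>A\<^esub> I"
    using mul[of a b z w] * Cm[of a b] unfolding set_add_def' by auto
  moreover have "x \<otimes> y \<in> S" using x y by auto
  ultimately show "x \<otimes> y \<in> ?X" by auto
qed

end

section \<open>Linear operators on polynomials\<close>

abbreviation (input) "lkp \<equiv> Poly_Mapping.lookup"
abbreviation (input) "sgl \<equiv> Poly_Mapping.single"

lemma lookup_pscale [simp]: "lkp (pscale c p) m = c * lkp p m"
  unfolding pscale_def mult_map_scale_conv_mult[symmetric]
  by (simp add: Poly_Mapping.map.rep_eq when_def)

lemma lookup_xpow: "lkp (xpow m) k = (if m = k then 1 else 0)"
  by (simp add: xpow_def lookup_single when_def)

lemma pscale_simps [simp]: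
  "pscale c (pscale d p) = pscale (c * d) p" "pscale 1 p = p" "pscale 0 p = 0" "pscale c 0 = 0"
  by (rule poly_mapping_eqI; simp)+

lemma pscale_distribs:
  "pscale c (p + q) = pscale c p + pscale c q" "pscale (c + d) p = pscale c p + pscale d p"
  by (rule poly_mapping_eqI; simp add: lookup_add algebra_simps)+

lemma pscale_minus_one: "pscale (-1) p + p = 0"
  by (rule poly_mapping_eqI) (simp add: lookup_add)

lemma pscale_mult: "pscale c p * q = pscale c (p * q)" "p * pscale c q = pscale c (p * q)"
  by (simp_all add: pscale_def algebra_simps)

lemma xpow_add: "xpow (m + k) = xpow m * xpow k"
  by (simp add: xpow_def mult_single)

lemma xpow_zero: "xpow 0 = 1"
  by (simp add: xpow_def)

lemma lookup_lin_ext_superset: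
  assumes "finite X" "Poly_Mapping.keys p \<subseteq> X"
  shows "lkp (lin_ext g p) k = (\<Sum>m\<in>X. lkp p m * lkp (g m) k)"
  unfolding lin_ext_def lookup_sum lookup_pscale
  by (rule sum.mono_neutral_left) (use assms in \<open>auto simp: in_keys_iff\<close>)

lemma lin_ext_xpow [simp]: "lin_ext g (xpow m) = g m"
  by (simp add: lin_ext_def lookup_xpow xpow_def)

text \<open>The membership condition of \<open>End_alg\<close>, but with possibly different
  variables in source and target, as the substitution \<open>embed_var\<close> requires.\<close>

definition plin :: "(('n, 'k::comm_ring_1) pol \<Rightarrow> ('m, 'k) pol) \<Rightarrow> bool" where
  "plin f \<longleftrightarrow> (\<forall>p q. f (p + q) = f p + f q) \<and> (\<forall>c p. f (pscale c p) = pscale c (f p))"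

lemma plinD: "plin f \<Longrightarrow> f (p + q) = f p + f q" "plin f \<Longrightarrow> f (pscale c p) = pscale c (f p)"
  by (auto simp: plin_def)

lemma plin_0: "plin f \<Longrightarrow> f 0 = 0"
  using plinD(2)[of f 0 0] by simp

lemma plin_sum: "plin f \<Longrightarrow> f (\<Sum>x\<in>X. g x) = (\<Sum>x\<in>X. f (g x))"
  by (induction X rule: infinite_finite_induct) (auto simp: plin_0 plinD)

lemma plin_lin_ext [simp]: "plin (lin_ext g)"
  unfolding plin_def
proof (intro conjI allI; rule poly_mapping_eqI)
  fix p q :: "('a, 'b) pol" and k
  let ?X = "Poly_Mapping.keys p \<union> Poly_Mapping.keys q"
  have "Poly_Mapping.keys (p + q) \<subseteq> ?X"
    by (rule keys_add)
  then show "lkp (lin_ext g (p + q)) k = lkp (lin_ext g p + lin_ext g q) k"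
    using lookup_lin_ext_superset[of ?X "p + q" g k] lookup_lin_ext_superset[of ?X p g k]
      lookup_lin_ext_superset[of ?X q g k]
    by (simp add: lookup_add distrib_right sum.distrib)
next
  fix c and p :: "('a, 'b) pol" and k
  have "Poly_Mapping.keys (pscale c p) \<subseteq> Poly_Mapping.keys p"
    by (auto simp: in_keys_iff)
  then show "lkp (lin_ext g (pscale c p)) k = lkp (pscale c (lin_ext g p)) k"
    using lookup_lin_ext_superset[of "Poly_Mapping.keys p" "pscale c p" g k]
      lookup_lin_ext_superset[of "Poly_Mapping.keys p" p g k]
    by (simp add: sum_distrib_left mult.assoc)
qed

lemma pol_expand: "p = (\<Sum>m\<in>Poly_Mapping.keys p. pscale (lkp p m) (xpow m))"
  by (rule poly_mapping_eqI) (simp add: lookup_sum lookup_xpow if_distrib sum.delta in_keys_iff cong: if_cong)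

lemma plin_expand: "plin f \<Longrightarrow> f p = lin_ext (\<lambda>m. f (xpow m)) p"
  by (subst pol_expand[of p]) (simp add: plin_sum plinD lin_ext_def)

lemma plin_eqI:
  assumes "plin f" "plin g" "\<And>m. f (xpow m) = g (xpow m)"
  shows "f = g"
proof
  fix p show "f p = g p"
    using plin_expand[OF assms(1), of p] plin_expand[OF assms(2), of p] assms(3) by simp
qed

lemma plin_id [simp]: "plin id" "plin (\<lambda>p. p)"
  by (simp_all add: plin_def)

lemma plin_zero [simp]: "plin (\<lambda>p. 0)"
  by (simp add: plin_def)

lemma plin_comp [simp]: "plin f \<Longrightarrow> plin g \<Longrightarrow> plin (f \<circ> g)"
  by (simp add: plin_def)

lemma plin_add [simp]: "plin f \<Longrightarrow> plin g \<Longrightarrow> plin (\<lambda>p. f p + g p)"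
  by (simp add: plin_def pscale_distribs algebra_simps)

lemma plin_scale [simp]: "plin f \<Longrightarrow> plin (\<lambda>p. pscale c (f p))"
  by (simp add: plin_def pscale_distribs mult.commute)

lemma plin_mult_right: "plin f \<Longrightarrow> plin (\<lambda>p. f p * q)"
  by (simp add: plin_def pscale_mult distrib_right)

lemma plin_mult_left: "plin f \<Longrightarrow> plin (\<lambda>p. q * f p)"
  by (simp add: plin_def pscale_mult distrib_left)

lemma plin_compose: "plin f \<Longrightarrow> plin g \<Longrightarrow> plin (\<lambda>p. f (g p))"
  by (simp add: plin_def)

lemma plin_funpow [simp]: "plin f \<Longrightarrow> plin ((f :: ('n, 'k::comm_ring_1) pol_op) ^^ k)"
  by (induction k) simp_all

section \<open>The endomorphism algebra, its subspaces and subalgebras\<close>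

lemma End_simps [simp]:
  "carrier End_alg = {f. plin f}" "monoid.mult End_alg = (\<circ>)" "one End_alg = id" "zero End_alg = (\<lambda>p. 0)"
  "add End_alg = (\<lambda>f g p. f p + g p)" "module.smult End_alg = (\<lambda>c f p. pscale c (f p))"
  by (simp_all add: End_alg_def plin_def)

lemma k_algebra_End: "k_algebra (End_alg :: ('k::field_char_0, ('n, 'k) pol_op) module)"
proof -
  have "abelian_group (End_alg :: ('k, ('n, 'k) pol_op) module)"
  proof (rule abelian_groupI)
    fix f :: "('n, 'k) pol_op" assume "f \<in> carrier End_alg"
    then show "\<exists>g\<in>carrier End_alg. g \<oplus>\<^bsub>End_alg\<^esub> f = \<zero>\<^bsub>End_alg\<^esub>"
      by (intro bexI[of _ "\<lambda>p. pscale (-1) (f p)"]) (simp_all add: pscale_minus_one)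
  qed (auto simp: add_ac)
  moreover have "Group.monoid (End_alg :: ('k, ('n, 'k) pol_op) module)"
    by (rule Group.monoidI) (auto simp: comp_assoc)
  ultimately have "ring (End_alg :: ('k, ('n, 'k) pol_op) module)"
    by (rule ringI) (auto simp: plinD)
  then show ?thesis
    by (rule k_algebra.intro) (unfold_locales, auto simp: plinD pscale_distribs)
qed

lemma (in k_algebra) carrier_subalgebra: "subalgebra_of A (carrier A)"
  by (simp add: subalgebra_of_def carrier_is_subring)

lemma (in k_algebra) subalgebra_hull:
  assumes "X \<subseteq> carrier A"
  shows "subalgebra_of A (subalgebra_of A hull X)"
proof -
  have "subring (subalgebra_of A hull X) A"
    unfolding hull_def
    by (rule subring_Inter) (use assms carrier_subalgebra in \<open>auto simp: subalgebra_of_def\<close>)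
  then show ?thesis
    by (auto simp: subalgebra_of_def hull_def)
qed

lemma (in k_algebra) subspace_hull:
  assumes "X \<subseteq> carrier A"
  shows "subspace_of A (subspace_of A hull X)"
proof -
  have "subgroup (subspace_of A hull X) (add_monoid A)"
  proof (rule add.subgroupI)
    have "subspace_of A (carrier A)"
      by (auto simp: subspace_of_def additive_subgroup_def add.subgroup_self)
    then show "subspace_of A hull X \<subseteq> carrier A"
      using hull_minimal[of X "carrier A" "subspace_of A"] assms by blast
    show "subspace_of A hull X \<noteq> {}"
      using additive_subgroup.zero_closed unfolding hull_def subspace_of_def by fastforce
    show "\<ominus> a \<in> subspace_of A hull X" if "a \<in> subspace_of A hull X" for a
      using that additive_subgroup.a_inv_closed[of _ A a] ring_axioms
      unfolding hull_def subspace_of_def by (auto simp: additive_subgroup_def a_inv_def subgroup.m_inv_closed)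
    show "a \<oplus> b \<in> subspace_of A hull X"
      if "a \<in> subspace_of A hull X" "b \<in> subspace_of A hull X" for a b
      using that additive_subgroup.a_closed[of _ A a b] unfolding hull_def subspace_of_def by auto
  qed
  then show ?thesis
    by (auto simp: subspace_of_def hull_def additive_subgroup_def)
qed

lemma subspace_EndI:
  assumes "\<And>f. f \<in> V \<Longrightarrow> plin f" "(\<lambda>p. 0) \<in> V"
    and "\<And>f g. \<lbrakk>f \<in> V; g \<in> V\<rbrakk> \<Longrightarrow> (\<lambda>p. f p + g p) \<in> V"
    and "\<And>c f. f \<in> V \<Longrightarrow> (\<lambda>p. pscale c (f p)) \<in> V"
  shows "subspace_of End_alg V"
proof -
  interpret k_algebra "End_alg :: ('b, ('a, 'b) pol_op) module" by (rule k_algebra_End)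
  have "\<ominus>\<^bsub>End_alg\<^esub> f = (\<lambda>p. pscale (-1) (f p))" if "f \<in> V" for f :: "('a, 'b) pol_op"
  proof (rule minus_equality)
    show "(\<lambda>p. pscale (-1) (f p)) \<oplus>\<^bsub>End_alg\<^esub> f = \<zero>\<^bsub>End_alg\<^esub>"
      by (simp add: pscale_minus_one)
  qed (use assms(1) that in auto)
  then have "subgroup V (add_monoid End_alg)"
    using assms by (intro add.subgroupI) auto
  then show ?thesis
    using assms(4) by (simp add: subspace_of_def additive_subgroup_def)
qed

lemma subspace_EndD:
  assumes "subspace_of End_alg V"
  shows "f \<in> V \<Longrightarrow> plin f" "(\<lambda>p. 0) \<in> V"
    "\<lbrakk>f \<in> V; g \<in> V\<rbrakk> \<Longrightarrow> (\<lambda>p. f p + g p) \<in> V" "f \<in> V \<Longrightarrow> (\<lambda>p. pscale c (f p)) \<in> V"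
  using assms additive_subgroup.a_subset[of V End_alg] additive_subgroup.zero_closed[of V End_alg]
    additive_subgroup.a_closed[of V End_alg f g]
  by (auto simp: subspace_of_def)

text \<open>The ambient algebra \<open>C\<close> is kept general so that subalgebras of
  \<open>End_alg\<close> and of \<open>Jac\<close> are both covered; additive inverses come from
  scaling by -1.\<close>

lemma subalgebra_restrictI:
  assumes C: "subalgebra_of End_alg C"
    and "B \<subseteq> C" "id \<in> B" "\<And>f g. \<lbrakk>f \<in> B; g \<in> B\<rbrakk> \<Longrightarrow> f \<circ> g \<in> B"
    and "\<And>f g. \<lbrakk>f \<in> B; g \<in> B\<rbrakk> \<Longrightarrow> (\<lambda>p. f p + g p) \<in> B"
    and "\<And>c f. f \<in> B \<Longrightarrow> (\<lambda>p. pscale c (f p)) \<in> B"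
  shows "subalgebra_of (End_alg\<lparr>carrier := C\<rparr>) B"
proof -
  interpret k_algebra "End_alg\<lparr>carrier := C\<rparr>"
    by (rule k_algebra.k_algebra_restrict[OF k_algebra_End C])
  have C': "(\<lambda>p. pscale c (f p)) \<in> C" if "f \<in> C" for c f
    using C that by (simp add: subalgebra_of_def)
  have "\<ominus>\<^bsub>End_alg\<lparr>carrier := C\<rparr>\<^esub> f = (\<lambda>p. pscale (-1) (f p))" if "f \<in> B" for f
  proof (rule minus_equality)
    show "(\<lambda>p. pscale (-1) (f p)) \<oplus>\<^bsub>End_alg\<lparr>carrier := C\<rparr>\<^esub> f = \<zero>\<^bsub>End_alg\<lparr>carrier := C\<rparr>\<^esub>"
      by (simp add: pscale_minus_one)
  qed (use assms(2) C' that in auto)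
  then have "subring B (End_alg\<lparr>carrier := C\<rparr>)"
    using assms by (intro subringI) auto
  then show ?thesis
    using assms(6) by (simp add: subalgebra_of_def)
qed

lemma subalgebra_EndI:
  assumes "\<And>f. f \<in> B \<Longrightarrow> plin f" "id \<in> B" "\<And>f g. \<lbrakk>f \<in> B; g \<in> B\<rbrakk> \<Longrightarrow> f \<circ> g \<in> B"
    and "\<And>f g. \<lbrakk>f \<in> B; g \<in> B\<rbrakk> \<Longrightarrow> (\<lambda>p. f p + g p) \<in> B"
    and "\<And>c f. f \<in> B \<Longrightarrow> (\<lambda>p. pscale c (f p)) \<in> B"
  shows "subalgebra_of End_alg B"
proof -
  have "End_alg\<lparr>carrier := carrier End_alg\<rparr> = End_alg"
    by (simp add: End_alg_def)
  moreover have "subalgebra_of (End_alg\<lparr>carrier := carrier End_alg\<rparr>) B"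
    by (rule subalgebra_restrictI[OF k_algebra.carrier_subalgebra[OF k_algebra_End]])
      (use assms in auto)
  ultimately show ?thesis by metis
qed

section \<open>The generators on monomials and the Jacobian algebra\<close>

lemma opX_xpow [simp]: "opX i (xpow m) = xpow (m + sgl i 1)"
  by (simp add: opX_def xpow_add[symmetric] add.commute)

lemma plin_opX [simp]: "plin (opX i)"
  unfolding opX_def by (intro plin_mult_left) simp

lemma opD_xpow [simp]: "opD i (xpow m) = pscale (of_nat (lkp m i)) (xpow (m - sgl i 1))"
  by (simp add: opD_def)

lemma plin_opD [simp]: "plin (opD i)"
  by (simp add: opD_def)

lemma plin_opH [simp]: "plin (opH i)"
  by (simp add: opH_def)

lemma opH_xpow [simp]: "opH i (xpow m) = pscale (of_nat (lkp m i + 1)) (xpow m)"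
  by (simp add: opH_def lookup_add)

text \<open>\<open>H_i + j\<close> is diagonal on monomials with eigenvalue
  \<open>m_i + 1 + j\<close>, a positive integer and hence invertible in characteristic
  zero.\<close>

lemma opHinv_eq:
  fixes i :: 'n
  shows "(opHinv i j :: ('n, 'k::field_char_0) pol_op)
    = lin_ext (\<lambda>m. pscale (inverse (of_nat (lkp m i + 1 + j))) (xpow m))" (is "_ = ?g")
proof -
  let ?f = "\<lambda>p::('n, 'k) pol. opH i p + pscale (of_nat j) p"
  have f: "plin ?f" by simp
  have nz: "(of_nat (lkp m i + 1 + j) :: 'k) \<noteq> 0" for m :: "'n \<Rightarrow>\<^sub>0 nat"
    using of_nat_neq_0 by (metis Suc_eq_plus1 add_Suc)
  have fx: "?f (xpow m) = pscale (of_nat (lkp m i + 1 + j)) (xpow m)" for m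
    by (simp add: pscale_distribs(2)[symmetric] add.assoc)
  have "?f \<circ> ?g = id"
  proof (rule plin_eqI)
    fix m
    have "?f (pscale c (xpow m)) = pscale c (?f (xpow m))" for c
      using plinD(2)[OF f] .
    then show "(?f \<circ> ?g) (xpow m) = id (xpow m)"
      using nz[of m] unfolding fx by simp
  qed (use f in simp_all)
  moreover have "?g \<circ> ?f = id"
  proof (rule plin_eqI)
    fix m
    show "(?g \<circ> ?f) (xpow m) = id (xpow m)"
      unfolding comp_apply fx using nz[of m] by (simp only: plinD(2)[OF plin_lin_ext]) simp
  qed (use f in simp_all)
  ultimately show ?thesis
    unfolding opHinv_def by (rule inv_unique_comp)
qed

lemma opHinv_xpow [simp]: "opHinv i j (xpow m) = pscale (inverse (of_nat (lkp m i + 1 + j))) (xpow m)"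
  by (simp add: opHinv_eq)

lemma plin_opHinv [simp]: "plin (opHinv i j)"
  by (simp add: opHinv_eq)

lemma Jac_simps [simp]:
  "monoid.mult Jac = (\<circ>)" "one Jac = id" "zero Jac = (\<lambda>p. 0)"
  "add Jac = (\<lambda>f g p. f p + g p)" "module.smult Jac = (\<lambda>c f p. pscale c (f p))"
  by (simp_all add: Jac_def)

lemma carrier_Jac:
  "carrier Jac = subalgebra_of End_alg hull (range opX \<union> range opD \<union> range (\<lambda>i. opHinv i 0))"
  by (simp add: Jac_def)

lemma Jac_subalgebra: "subalgebra_of End_alg (carrier Jac)"
  unfolding carrier_Jac by (rule k_algebra.subalgebra_hull[OF k_algebra_End]) auto

lemma Jac_restrict: "Jac = End_alg\<lparr>carrier := carrier Jac\<rparr>"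
  by (simp add: Jac_def)

lemma Jac_gens [simp]: "opX i \<in> carrier Jac" "opD i \<in> carrier Jac" "opHinv i 0 \<in> carrier Jac"
  using hull_subset[of "range opX \<union> range opD \<union> range (\<lambda>i. opHinv i 0)" "subalgebra_of End_alg"]
  unfolding carrier_Jac by auto

lemma Jac_closed [simp]:
  fixes f g :: "('n::finite, 'k::field_char_0) pol_op"
  shows "(id :: ('n, 'k) pol_op) \<in> carrier Jac" "(\<lambda>p. 0 :: ('n, 'k) pol) \<in> carrier Jac"
  "\<lbrakk>f \<in> carrier Jac; g \<in> carrier Jac\<rbrakk> \<Longrightarrow> f \<circ> g \<in> carrier Jac"
  "\<lbrakk>f \<in> carrier Jac; g \<in> carrier Jac\<rbrakk> \<Longrightarrow> (\<lambda>p. f p + g p) \<in> carrier Jac"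
  "f \<in> carrier Jac \<Longrightarrow> (\<lambda>p. pscale c (f p)) \<in> carrier Jac"
proof -
  have sub: "subring (carrier Jac :: ('n, 'k) pol_op set) End_alg"
    by (rule Jac_subalgebra[unfolded subalgebra_of_def, THEN conjunct1])
  have smult: "\<forall>c. \<forall>v\<in>carrier Jac. c \<odot>\<^bsub>End_alg\<^esub> (v :: ('n, 'k) pol_op) \<in> carrier Jac"
    by (rule Jac_subalgebra[unfolded subalgebra_of_def, THEN conjunct2])
  show "(id :: ('n, 'k) pol_op) \<in> carrier Jac" "(\<lambda>p. 0 :: ('n, 'k) pol) \<in> carrier Jac"
    using subringE(2,3)[OF sub] by simp_all
  show "f \<circ> g \<in> carrier Jac" "(\<lambda>p. f p + g p) \<in> carrier Jac"
    if "f \<in> carrier Jac" "g \<in> carrier Jac"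
    using subringE(6,7)[OF sub that] by simp_all
  show "(\<lambda>p. pscale c (f p)) \<in> carrier Jac" if "f \<in> carrier Jac"
    using smult that by simp
qed

lemma Jac_plin [simp]: "f \<in> carrier Jac \<Longrightarrow> plin f"
  using subringE(1)[OF Jac_subalgebra[unfolded subalgebra_of_def, THEN conjunct1]] by auto

lemma k_algebra_Jac: "k_algebra Jac"
  using k_algebra.k_algebra_restrict[OF k_algebra_End Jac_subalgebra] Jac_restrict by metis

lemma Jac_minimal:
  assumes "subalgebra_of End_alg B" "\<And>i. opX i \<in> B" "\<And>i. opD i \<in> B" "\<And>i. opHinv i 0 \<in> B"
  shows "carrier Jac \<subseteq> B"
  unfolding carrier_Jac by (rule hull_minimal) (use assms in auto)

lemma subalgebra_JacI:
  assumes "B \<subseteq> carrier Jac" "id \<in> B" "\<And>f g. \<lbrakk>f \<in> B; g \<in> B\<rbrakk> \<Longrightarrow> f \<circ> g \<in> B"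
    and "\<And>f g. \<lbrakk>f \<in> B; g \<in> B\<rbrakk> \<Longrightarrow> (\<lambda>p. f p + g p) \<in> B"
    and "\<And>c f. f \<in> B \<Longrightarrow> (\<lambda>p. pscale c (f p)) \<in> B"
  shows "subalgebra_of Jac B"
  using subalgebra_restrictI[OF Jac_subalgebra assms] Jac_restrict by metis

lemma opHinv_Jac [simp]: "(opHinv i j :: ('n::finite, 'k::field_char_0) pol_op) \<in> carrier Jac"
proof (induction j)
  case (Suc j)
  \<comment> \<open>On \<open>x^m\<close> the operator \<open>\<partial>_i (H_i + j)^-1 x_i\<close>
    has eigenvalue \<open>(m_i + 1) / (m_i + j + 2)\<close>, that is
    \<open>1 - (j + 1) / (m_i + j + 2)\<close>. Solving for the last fraction expresses
    \<open>(H_i + j + 1)^-1\<close> through \<open>(H_i + j)^-1\<close>.\<close>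
  let ?f = "\<lambda>p. pscale (inverse (of_nat (j + 1)))
    (id p + pscale (-1) ((opD i \<circ> (opHinv i j \<circ> opX i)) p)) :: ('n, 'k) pol"
  have "opHinv i (Suc j) = ?f"
  proof (rule plin_eqI)
    fix m :: "'n \<Rightarrow>\<^sub>0 nat"
    define a where "a = (of_nat (lkp m i) :: 'k)"
    define b where "b = (of_nat j :: 'k)"
    have "of_nat (lkp m i + j + 2) \<noteq> (0 :: 'k)"
      unfolding of_nat_eq_0_iff by simp
    then have ab: "a + b + 2 \<noteq> 0"
      by (simp add: a_def b_def add_ac)
    have "of_nat (j + 1) \<noteq> (0 :: 'k)"
      unfolding of_nat_eq_0_iff by simp
    then have b: "b + 1 \<noteq> 0"
      by (simp add: b_def add_ac)
    have eq: "inverse (a + b + 2) = inverse (b + 1) * (1 + - (inverse (a + b + 2) * (a + 1)))"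
      using ab b by (simp add: field_simps)
    have "?f (xpow m)
        = pscale (inverse (b + 1)) (xpow m + pscale (- (inverse (a + b + 2) * (a + 1))) (xpow m))"
      by (simp add: plinD lookup_add a_def b_def add_ac)
    also have "\<dots> = pscale (inverse (b + 1)) (pscale (1 + - (inverse (a + b + 2) * (a + 1))) (xpow m))"
      by (simp only: pscale_distribs pscale_simps)
    also have "\<dots> = pscale (inverse (a + b + 2)) (xpow m)"
      by (simp only: eq[symmetric] pscale_simps)
    also have "\<dots> = opHinv i (Suc j) (xpow m)"
      by (simp add: a_def b_def add_ac)
    finally show "opHinv i (Suc j) (xpow m) = ?f (xpow m)" ..
  qed (intro plin_opHinv plin_scale plin_add plin_id plin_comp plin_opD plin_opX)+
  moreover have "opD i \<circ> (opHinv i j \<circ> opX i) \<in> (carrier Jac :: ('n, 'k) pol_op set)"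
    by (intro Jac_closed(3) Jac_gens Suc.IH)
  then have "?f \<in> carrier Jac"
    by (intro Jac_closed(5) Jac_closed(4)[OF Jac_closed(1)])
  ultimately show ?case by simp
qed simp

lemma opH_Jac [simp]: "opH i \<in> carrier Jac"
  by (simp add: opH_def)

section \<open>The domain \<open>\<Delta>\<close>\<close>

text \<open>On each line parallel to a coordinate axis, \<open>h\<close> is a quotient of
  one-variable polynomials whose denominator has no root at a natural number. The quotient may
  depend on the line, so rational functions in several variables are avoided, yet one nonzero value
  still propagates to almost all later points of the line.\<close>

definition line_rational :: "(('n \<Rightarrow>\<^sub>0 nat) \<Rightarrow> 'k::field_char_0) \<Rightarrow> bool" where
  "line_rational h \<longleftrightarrow> (\<forall>m i. \<exists>p q. \<forall>t. poly q (of_nat t) \<noteq> 0 \<and>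
     h (m + sgl i t) * poly q (of_nat t) = poly p (of_nat t))"

lemma line_rationalE:
  assumes "line_rational h"
  obtains q p where "\<And>t. poly q (of_nat t) \<noteq> 0"
    "\<And>t. h (m + sgl i t) * poly q (of_nat t) = poly p (of_nat t)"
  using assms unfolding line_rational_def by meson

lemma line_rationalI:
  assumes "\<And>m i. \<exists>p q. \<forall>t. poly q (of_nat t) \<noteq> 0 \<and>
     h (m + sgl i t) * poly q (of_nat t) = poly p (of_nat t)"
  shows "line_rational h"
  using assms unfolding line_rational_def by blast

lemma line_rational_const [simp]: "line_rational (\<lambda>_. c)"
  by (rule line_rationalI, rule exI[of _ "[:c:]"], rule exI[of _ 1]) simp

lemma
  assumes "line_rational g" "line_rational h"
  shows line_rational_add: "line_rational (\<lambda>m. g m + h m)"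
    and line_rational_mult: "line_rational (\<lambda>m. g m * h m)"
proof -
  have "\<exists>p q. \<forall>t. poly q (of_nat t) \<noteq> 0 \<and>
        (g (m + sgl i t) + h (m + sgl i t)) * poly q (of_nat t) = poly p (of_nat t)"
      "\<exists>p q. \<forall>t. poly q (of_nat t) \<noteq> 0 \<and>
        (g (m + sgl i t) * h (m + sgl i t)) * poly q (of_nat t) = poly p (of_nat t)" for m i
  proof -
    obtain p q where 1: "\<And>t. poly q (of_nat t) \<noteq> 0"
      "\<And>t. g (m + sgl i t) * poly q (of_nat t) = poly p (of_nat t)"
      by (rule line_rationalE[OF assms(1), where m = m and i = i]) (rule that)
    obtain p' q' where 2: "\<And>t. poly q' (of_nat t) \<noteq> 0"
      "\<And>t. h (m + sgl i t) * poly q' (of_nat t) = poly p' (of_nat t)"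
      by (rule line_rationalE[OF assms(2), where m = m and i = i]) (rule that)
    have "(a + b) * (c * d) = (a * c) * d + (b * d) * c" "(a * b) * (c * d) = (a * c) * (b * d)" for a b c d :: 'b
      by (simp_all add: algebra_simps)
    then have "poly (q * q') (of_nat t) \<noteq> 0 \<and>
          (g (m + sgl i t) + h (m + sgl i t)) * poly (q * q') (of_nat t) = poly (p * q' + p' * q) (of_nat t)"
        "poly (q * q') (of_nat t) \<noteq> 0 \<and>
          (g (m + sgl i t) * h (m + sgl i t)) * poly (q * q') (of_nat t) = poly (p * p') (of_nat t)" for t
      by (simp_all only: poly_mult poly_add 1 2 mult_eq_0_iff simp_thms)
    then show "\<exists>p q. \<forall>t. poly q (of_nat t) \<noteq> 0 \<and>
        (g (m + sgl i t) + h (m + sgl i t)) * poly q (of_nat t) = poly p (of_nat t)"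
      "\<exists>p q. \<forall>t. poly q (of_nat t) \<noteq> 0 \<and>
        (g (m + sgl i t) * h (m + sgl i t)) * poly q (of_nat t) = poly p (of_nat t)"
      by blast+
  qed
  note * = this
  show "line_rational (\<lambda>m. g m + h m)"
    by (rule line_rationalI) (rule *(1))
  show "line_rational (\<lambda>m. g m * h m)"
    by (rule line_rationalI) (rule *(2))
qed

lemma line_rational_sum:
  "(\<And>x. x \<in> X \<Longrightarrow> line_rational (h x)) \<Longrightarrow> line_rational (\<lambda>m. \<Sum>x\<in>X. h x m)"
  by (induction X rule: infinite_finite_induct) (auto intro: line_rational_add)

lemma line_rational_shift:
  assumes "line_rational h"
  shows "line_rational (\<lambda>m. h (m + a))"
proof (rule line_rationalI)
  fix m i
  have "m + sgl i t + a = (m + a) + sgl i t" for t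
    by (simp add: add_ac)
  then show "\<exists>p q. \<forall>t. poly q (of_nat t) \<noteq> 0 \<and>
      h (m + sgl i t + a) * poly q (of_nat t) = poly p (of_nat t)"
    using line_rationalE[OF assms, where m = "m + a" and i = i] by metis
qed

lemma line_rational_coord:
  fixes j :: 'n
  shows "line_rational (\<lambda>m. of_nat (lkp m j + c) :: 'k::field_char_0)"
proof (rule line_rationalI)
  fix m :: "'n \<Rightarrow>\<^sub>0 nat" and i
  show "\<exists>p q. \<forall>t. poly q (of_nat t) \<noteq> (0 :: 'k) \<and>
      of_nat (lkp (m + sgl i t) j + c) * poly q (of_nat t) = poly p (of_nat t)"
    by (rule exI[of _ "if i = j then [:of_nat (lkp m j + c), 1:] else [:of_nat (lkp m j + c):]"],
        rule exI[of _ 1]) (simp add: lookup_add lookup_single when_def)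
qed

lemma line_rational_inverse_coord:
  fixes j :: 'n
  shows "line_rational (\<lambda>m. inverse (of_nat (lkp m j + 1 + c)) :: 'k::field_char_0)"
proof (rule line_rationalI)
  fix m :: "'n \<Rightarrow>\<^sub>0 nat" and i
  have nz: "of_nat (lkp m j + 1 + c + t) \<noteq> (0 :: 'k)" for t
    unfolding of_nat_eq_0_iff by simp
  let ?q = "if i = j then [:of_nat (lkp m j + 1 + c), 1:] else [:of_nat (lkp m j + 1 + c):]"
  have "poly ?q (of_nat t) = (of_nat (lkp (m + sgl i t) j + 1 + c) :: 'k)" for t
    by (simp add: lookup_add lookup_single when_def add_ac)
  moreover have "of_nat (lkp (m + sgl i t) j + 1 + c) \<noteq> (0 :: 'k)" for t
    unfolding of_nat_eq_0_iff by simp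
  ultimately show "\<exists>p q. \<forall>t. poly q (of_nat t) \<noteq> (0 :: 'k) \<and>
      inverse (of_nat (lkp (m + sgl i t) j + 1 + c)) * poly q (of_nat t) = poly p (of_nat t)"
    by (intro exI[of _ 1] exI[of _ ?q]) simp
qed

text \<open>The numerator is nonzero because its value at \<open>t = 0\<close> is, so it has
  finitely many roots, and in characteristic zero only finitely many naturals map to them.\<close>

lemma line_rational_nonzero_ray:
  assumes "line_rational h" "h a \<noteq> 0"
  shows "\<exists>N. \<forall>t\<ge>N. h (a + sgl i t) \<noteq> 0"
proof -
  obtain p q where pq: "\<And>t. poly q (of_nat t) \<noteq> 0"
    "\<And>t. h (a + sgl i t) * poly q (of_nat t) = poly p (of_nat t)"
    by (rule line_rationalE[OF assms(1), where m = a and i = i]) (rule that)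
  have "p \<noteq> 0"
    using pq(1)[of 0] pq(2)[of 0] assms(2) by auto
  then have "finite {x. poly p x = 0}"
    by (rule poly_roots_finite)
  then have "finite (of_nat -` {x. poly p x = 0})"
    by (rule finite_vimageI) (rule inj_of_nat)
  then obtain N where N: "\<forall>t\<in>of_nat -` {x. poly p x = 0}. t < N"
    by (meson finite_nat_set_iff_bounded)
  have "h (a + sgl i t) \<noteq> 0" if "t \<ge> N" for t
  proof
    assume "h (a + sgl i t) = 0"
    then have "poly p (of_nat t) = 0"
      using pq(2)[of t] by simp
    then have "t < N" using N by blast
    with that show False by simp
  qed
  then show ?thesis by blast
qed

text \<open>Points with nonvanishing values are moved upwards along one coordinate axis at a time
  until they meet.\<close>

lemma line_rational_common_nonzero:
  fixes g h :: "('n::finite \<Rightarrow>\<^sub>0 nat) \<Rightarrow> 'k::field_char_0"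
  assumes g: "line_rational g" "g a \<noteq> 0" and h: "line_rational h" "h b \<noteq> 0"
  obtains c where "g c \<noteq> 0" "h c \<noteq> 0" "\<And>i. lkp z i \<le> lkp c i"
proof -
  have "finite J \<Longrightarrow> \<exists>a b. g a \<noteq> 0 \<and> h b \<noteq> 0 \<and> (\<forall>i\<in>J. lkp a i = lkp b i \<and> lkp z i \<le> lkp a i)" for J
  proof (induction J rule: finite_induct)
    case empty
    then show ?case using g h by auto
  next
    case (insert i J)
    then obtain a b where ab: "g a \<noteq> 0" "h b \<noteq> 0" "\<forall>i\<in>J. lkp a i = lkp b i \<and> lkp z i \<le> lkp a i"
      by auto
    obtain M N where M: "\<forall>t\<ge>M. g (a + sgl i t) \<noteq> 0" and N: "\<forall>t\<ge>N. h (b + sgl i t) \<noteq> 0"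
      using line_rational_nonzero_ray[OF g(1) ab(1), of i] line_rational_nonzero_ray[OF h(1) ab(2), of i]
      by auto
    \<comment> \<open>Both \<open>i\<close>-th coordinates are raised to \<open>L\<close>; its
      summands ensure that the increments are at least \<open>M\<close> and \<open>N\<close> and
      that \<open>L\<close> is at least \<open>z_i\<close>.\<close>
    define L where "L = M + N + lkp a i + lkp b i + lkp z i"
    have "g (a + sgl i (L - lkp a i)) \<noteq> 0" "h (b + sgl i (L - lkp b i)) \<noteq> 0"
      using M N by (auto simp: L_def)
    moreover have "lkp (a + sgl i (L - lkp a i)) j = lkp (b + sgl i (L - lkp b i)) j
        \<and> lkp z j \<le> lkp (a + sgl i (L - lkp a i)) j" if "j \<in> insert i J" for j
      using that ab(3) insert.hyps(2) by (auto simp: lookup_add lookup_single when_def L_def)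
    ultimately show ?case by blast
  qed
  from this[of UNIV] obtain a b where ab: "g a \<noteq> 0" "h b \<noteq> 0"
    "\<forall>i. lkp a i = lkp b i \<and> lkp z i \<le> lkp a i"
    by auto
  then have "a = b"
    by (intro poly_mapping_eqI) auto
  with ab that show ?thesis by blast
qed

lemma line_rational_nonzero_shift:
  fixes h :: "('n::finite \<Rightarrow>\<^sub>0 nat) \<Rightarrow> 'k::field_char_0"
  assumes "line_rational h" "h b \<noteq> 0"
  obtains c where "h (c + z) \<noteq> 0"
proof -
  obtain c where c: "h c \<noteq> 0" "\<And>i. lkp z i \<le> lkp c i"
    using line_rational_common_nonzero[OF assms assms, where z = z] by blast
  \<comment> \<open>The subtraction is truncated; the lower bound by \<open>z\<close> makes it
    exact.\<close>
  have "(c - z) + z = c"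
    by (rule poly_mapping_eqI) (use c(2) in \<open>simp add: lookup_add lookup_minus\<close>)
  with c(1) that[of "c - z"] show ?thesis by simp
qed

text \<open>The lexicographically largest elements of \<open>X\<close> and \<open>Y\<close> have
  this property, as for leading terms of a product of polynomials. The induction treats one
  coordinate at a time by passing to the elements with maximal \<open>i\<close>-th
  coordinate.\<close>

lemma unique_sum_pair:
  fixes X Y :: "('n::finite \<Rightarrow>\<^sub>0 nat) set"
  assumes "finite X" "X \<noteq> {}" "finite Y" "Y \<noteq> {}"
  obtains a b where "a \<in> X" "b \<in> Y"
    "\<And>a' b'. \<lbrakk>a' \<in> X; b' \<in> Y; a' + b' = a + b\<rbrakk> \<Longrightarrow> a' = a \<and> b' = b"
proof -
  have "\<exists>a\<in>X. \<exists>b\<in>Y. \<forall>a'\<in>X. \<forall>b'\<in>Y. a' + b' = a + b \<longrightarrow> (\<forall>i\<in>J. lkp a' i = lkp a i \<and> lkp b' i = lkp b i)"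
    if "finite J" for J
    using that assms
  proof (induction J arbitrary: X Y rule: finite_induct)
    case empty
    then show ?case by auto
  next
    case (insert i J)
    define M where "M = Max ((\<lambda>a. lkp a i) ` X)"
    define N where "N = Max ((\<lambda>a. lkp a i) ` Y)"
    let ?X = "{a \<in> X. lkp a i = M}" and ?Y = "{a \<in> Y. lkp a i = N}"
    have M: "lkp a i \<le> M" if "a \<in> X" for a using that insert.prems by (simp add: M_def)
    have N: "lkp a i \<le> N" if "a \<in> Y" for a using that insert.prems by (simp add: N_def)
    have "M \<in> (\<lambda>a. lkp a i) ` X" "N \<in> (\<lambda>a. lkp a i) ` Y"
      unfolding M_def N_def using insert.prems by (auto intro!: Max_in)
    then have ne: "?X \<noteq> {}" "?Y \<noteq> {}"
      by auto
    have "\<exists>a\<in>?X. \<exists>b\<in>?Y.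
        \<forall>a'\<in>?X. \<forall>b'\<in>?Y. a' + b' = a + b \<longrightarrow>
          (\<forall>i\<in>J. lkp a' i = lkp a i \<and> lkp b' i = lkp b i)"
      by (rule insert.IH[OF _ ne(1) _ ne(2)]) (use insert.prems in simp_all)
    then obtain a b where ab: "a \<in> X" "lkp a i = M" "b \<in> Y" "lkp b i = N"
      and uniq: "\<forall>a'\<in>?X. \<forall>b'\<in>?Y. a' + b' = a + b \<longrightarrow>
          (\<forall>i\<in>J. lkp a' i = lkp a i \<and> lkp b' i = lkp b i)"
      by blast
    have "\<forall>j\<in>insert i J. lkp a' j = lkp a j \<and> lkp b' j = lkp b j"
      if "a' \<in> X" "b' \<in> Y" "a' + b' = a + b" for a' b'
    proof -
      have "lkp a' i + lkp b' i = M + N"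
        using that(3) ab(2,4) by (metis lookup_add)
      then have i: "lkp a' i = M" "lkp b' i = N"
        using M[OF that(1)] N[OF that(2)] by linarith+
      then have "\<forall>j\<in>J. lkp a' j = lkp a j \<and> lkp b' j = lkp b j"
        using uniq that by blast
      with i ab(2,4) show ?thesis by simp
    qed
    with ab(1,3) show ?case by blast
  qed
  from this[OF finite_UNIV] obtain a b where ab: "a \<in> X" "b \<in> Y"
    and uniq: "\<forall>a'\<in>X. \<forall>b'\<in>Y. a' + b' = a + b \<longrightarrow> (\<forall>i\<in>UNIV. lkp a' i = lkp a i \<and> lkp b' i = lkp b i)"
    by blast
  show ?thesis
  proof (rule that[OF ab])
    fix a' b' assume "a' \<in> X" "b' \<in> Y" "a' + b' = a + b"
    with uniq have "\<forall>i. lkp a' i = lkp a i \<and> lkp b' i = lkp b i" by simp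
    then show "a' = a \<and> b' = b"
      by (simp add: poly_mapping_eq_iff fun_eq_iff)
  qed
qed

text \<open>\<open>X\<close> collects the exponents \<open>a\<close> of the possible terms
  \<partial>^a of \<open>f\<close>; writing \<open>m = k + a\<close> avoids truncated
  subtraction.\<close>

definition lowers_by :: "('n, 'k::field_char_0) pol_op \<Rightarrow> ('n \<Rightarrow>\<^sub>0 nat) set \<Rightarrow> bool" where
  "lowers_by f X \<longleftrightarrow> (\<forall>m k. lkp (f (xpow m)) k \<noteq> 0 \<longrightarrow> (\<exists>a\<in>X. m = k + a))"

definition shift_coeff :: "('n, 'k::field_char_0) pol_op \<Rightarrow> ('n \<Rightarrow>\<^sub>0 nat) \<Rightarrow> ('n \<Rightarrow>\<^sub>0 nat) \<Rightarrow> 'k" where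
  "shift_coeff f a k = lkp (f (xpow (k + a))) k"

text \<open>The operators \<open>\<Sum>\<^sub>a h\<^sub>a \<partial>\<^sup>a\<close> with coefficients \<open>h\<^sub>a\<close> acting diagonally on monomials;
  \<open>shift_coeff f a\<close> is \<open>h\<^sub>a\<close> up to the scalars produced by \<open>\<partial>\<^sup>a\<close>.\<close>

definition skew_operator :: "('n, 'k::field_char_0) pol_op \<Rightarrow> bool" where
  "skew_operator f \<longleftrightarrow> plin f \<and> (\<exists>X. finite X \<and> lowers_by f X) \<and> (\<forall>a. line_rational (shift_coeff f a))"

lemma lookup_lowers_by:
  assumes f: "plin f" and X: "finite X" "lowers_by f X"
  shows "lkp (f p) k = (\<Sum>a\<in>X. lkp p (k + a) * shift_coeff f a k)"
proof -
  let ?K = "Poly_Mapping.keys p" and ?t = "\<lambda>l. lkp p l * lkp (f (xpow l)) k"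
  have "lkp (f p) k = sum ?t (?K \<union> (+) k ` X)"
    unfolding plin_expand[OF f, of p] by (rule lookup_lin_ext_superset) (use X in auto)
  also have "\<dots> = sum ?t ((+) k ` X)"
    by (rule sum.mono_neutral_right) (use X in \<open>auto simp: lowers_by_def\<close>)
  also have "\<dots> = (\<Sum>a\<in>X. ?t (k + a))"
    by (subst sum.reindex) auto
  finally show ?thesis by (simp add: shift_coeff_def)
qed

lemma skew_operator_comp:
  assumes f: "skew_operator f" and g: "skew_operator g"
  shows "skew_operator (f \<circ> g)"
proof -
  obtain X Y where X: "finite X" "lowers_by f X" and Y: "finite Y" "lowers_by g Y"
    using f g by (auto simp: skew_operator_def)
  have pf: "plin f" and pg: "plin g" using f g by (auto simp: skew_operator_def)
  note expand = lookup_lowers_by[OF pf X]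
  have "lowers_by (f \<circ> g) ((\<lambda>(a, b). a + b) ` (X \<times> Y))"
    unfolding lowers_by_def
  proof (intro allI impI)
    fix m k assume "lkp ((f \<circ> g) (xpow m)) k \<noteq> 0"
    then have "(\<Sum>a\<in>X. lkp (g (xpow m)) (k + a) * shift_coeff f a k) \<noteq> 0"
      by (simp add: expand)
    then obtain a where a: "a \<in> X" "lkp (g (xpow m)) (k + a) \<noteq> 0"
      by (metis (no_types, lifting) mult_eq_0_iff sum.not_neutral_contains_not_neutral)
    then obtain b where "b \<in> Y" "m = (k + a) + b"
      using Y(2) by (auto simp: lowers_by_def)
    with a(1) show "\<exists>c\<in>(\<lambda>(a, b). a + b) ` (X \<times> Y). m = k + c"
      by (intro bexI[of _ "a + b"]) (auto simp: add_ac)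
  qed
  moreover have "line_rational (shift_coeff (f \<circ> g) c)" for c
  proof -
    \<comment> \<open>The term with index \<open>a\<close> contributes only if
      \<open>c = a + b\<close> for some \<open>b\<close>, and is then the coefficient of
      \<open>g\<close> at \<open>b\<close> translated by \<open>a\<close>; otherwise it vanishes
      identically.\<close>
    have *: "line_rational (\<lambda>k. lkp (g (xpow (k + c))) (k + a))" for a
    proof (cases "\<exists>b. c = a + b")
      case True
      then obtain b where b: "c = a + b" by auto
      have "(\<lambda>k. lkp (g (xpow (k + c))) (k + a)) = (\<lambda>k. shift_coeff g b (k + a))"
        by (simp add: shift_coeff_def b add_ac)
      then show ?thesis
        using g line_rational_shift[of "shift_coeff g b" a] by (simp add: skew_operator_def)
    next
      case False
      have "lkp (g (xpow (k + c))) (k + a) = 0" for k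
      proof (rule ccontr)
        assume "lkp (g (xpow (k + c))) (k + a) \<noteq> 0"
        then obtain b where "k + c = (k + a) + b"
          using Y(2) by (auto simp: lowers_by_def)
        then show False using False by (simp add: add.assoc)
      qed
      then show ?thesis by simp
    qed
    have "shift_coeff (f \<circ> g) c
        = (\<lambda>k. \<Sum>a\<in>X. lkp (g (xpow (k + c))) (k + a) * shift_coeff f a k)"
      by (rule ext) (subst shift_coeff_def, simp add: expand)
    then show ?thesis
      using f by (auto intro!: line_rational_sum line_rational_mult * simp: skew_operator_def)
  qed
  ultimately show ?thesis
    using pf pg X(1) Y(1) unfolding skew_operator_def by (meson finite_SigmaI finite_imageI plin_comp)
qed

text \<open>A leading term argument without normal forms: for the pair \<open>(a, b)\<close> of
  \<open>unique_sum_pair\<close>, the coefficient of \<open>x^c\<close> in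
  \<open>f (g x^(c + a + b))\<close> is the single product
  \<open>shift_coeff g b (c + a) * shift_coeff f a c\<close>, and line rationality provides a
  \<open>c\<close> at which both factors are nonzero.\<close>

lemma skew_operator_domain:
  fixes f g :: "('n::finite, 'k::field_char_0) pol_op"
  assumes f: "skew_operator f" and g: "skew_operator g" and fg: "f \<circ> g = (\<lambda>p. 0)"
  shows "f = (\<lambda>p. 0) \<or> g = (\<lambda>p. 0)"
proof (rule ccontr)
  assume "\<not> ?thesis"
  then have nz: "f \<noteq> (\<lambda>p. 0)" "g \<noteq> (\<lambda>p. 0)" by auto
  have *: "\<exists>X. finite X \<and> X \<noteq> {} \<and> lowers_by h X \<and> (\<forall>a\<in>X. \<exists>k. shift_coeff h a k \<noteq> 0)"
    if h: "skew_operator h" "h \<noteq> (\<lambda>p. 0)" for h :: "('n, 'k) pol_op"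
  proof -
    obtain X where X: "finite X" "lowers_by h X"
      using h(1) by (auto simp: skew_operator_def)
    \<comment> \<open>Indices with identically zero coefficient are discarded, so that whichever
      pair is extremal really contributes.\<close>
    define Y where "Y = {a \<in> X. \<exists>k. shift_coeff h a k \<noteq> 0}"
    have low: "lowers_by h Y"
      using X(2) unfolding lowers_by_def Y_def shift_coeff_def by blast
    have "\<exists>m. h (xpow m) \<noteq> 0"
      using plin_eqI[of h "\<lambda>p. 0"] h by (auto simp: skew_operator_def)
    then obtain m k where "lkp (h (xpow m)) k \<noteq> 0"
      by (metis lookup_zero poly_mapping_eqI)
    then have "Y \<noteq> {}"
      using low unfolding lowers_by_def by blast
    with low X(1) show ?thesis
      by (intro exI[of _ Y]) (auto simp: Y_def)
  qed
  obtain X where X: "finite X" "X \<noteq> {}" "lowers_by f X" "\<forall>a\<in>X. \<exists>k. shift_coeff f a k \<noteq> 0"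
    using *[OF f nz(1)] by auto
  obtain Y where Y: "finite Y" "Y \<noteq> {}" "lowers_by g Y" "\<forall>a\<in>Y. \<exists>k. shift_coeff g a k \<noteq> 0"
    using *[OF g nz(2)] by auto
  obtain a b where ab: "a \<in> X" "b \<in> Y"
    "\<And>a' b'. \<lbrakk>a' \<in> X; b' \<in> Y; a' + b' = a + b\<rbrakk> \<Longrightarrow> a' = a \<and> b' = b"
    using unique_sum_pair[OF X(1,2) Y(1,2)] by blast
  obtain u v where u: "shift_coeff f a u \<noteq> 0" and v: "shift_coeff g b v \<noteq> 0"
    using X(4) Y(4) ab(1,2) by blast
  have lf: "line_rational (shift_coeff f a)" and lg: "line_rational (shift_coeff g b)"
    using f g by (auto simp: skew_operator_def)
  \<comment> \<open>The common point is sought for \<open>shift_coeff f a\<close> and the translate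
    of \<open>shift_coeff g b\<close> by \<open>a\<close>, so the translate must first be seen to be
    nonzero somewhere.\<close>
  obtain w where w: "shift_coeff g b (w + a) \<noteq> 0"
    using line_rational_nonzero_shift[OF lg v] by blast
  obtain c where c: "shift_coeff f a c \<noteq> 0" "shift_coeff g b (c + a) \<noteq> 0"
    using line_rational_common_nonzero[OF lf u line_rational_shift[OF lg], of w a] w by blast
  have pf: "plin f" using f by (simp add: skew_operator_def)
  have "lkp ((f \<circ> g) (xpow (c + (a + b)))) c
      = (\<Sum>a'\<in>X. lkp (g (xpow (c + (a + b)))) (c + a') * shift_coeff f a' c)"
    using lookup_lowers_by[OF pf X(1,3)] by simp
  also have "\<dots> = (\<Sum>a'\<in>{a}. lkp (g (xpow (c + (a + b)))) (c + a') * shift_coeff f a' c)"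
  proof (rule sum.mono_neutral_right[OF X(1)])
    show "{a} \<subseteq> X" using ab by simp
    show "\<forall>a'\<in>X - {a}. lkp (g (xpow (c + (a + b)))) (c + a') * shift_coeff f a' c = 0"
    proof
      fix a' assume a': "a' \<in> X - {a}"
      have "lkp (g (xpow (c + (a + b)))) (c + a') = 0"
      proof (rule ccontr)
        assume "lkp (g (xpow (c + (a + b)))) (c + a') \<noteq> 0"
        then obtain b' where "b' \<in> Y" "c + (a + b) = (c + a') + b'"
          using Y(3) by (auto simp: lowers_by_def)
        then have "b' \<in> Y" "a' + b' = a + b" by (simp_all add: add.assoc)
        then show False using ab(3)[of a' b'] a' by auto
      qed
      then show "lkp (g (xpow (c + (a + b)))) (c + a') * shift_coeff f a' c = 0" by simp
    qed
  qed
  also have "\<dots> = shift_coeff g b (c + a) * shift_coeff f a c"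
    by (simp add: shift_coeff_def add.assoc)
  finally show False
    using c fg by (simp add: fun_eq_iff)
qed

lemma skew_operator_diagonal:
  assumes "plin f" "\<And>m. f (xpow m) = pscale (h m) (xpow m)" "line_rational h"
  shows "skew_operator f"
proof -
  have "lowers_by f {0}"
    using assms(2) by (auto simp: lowers_by_def lookup_xpow)
  moreover have "shift_coeff f a = (\<lambda>k. if a = 0 then h k else 0)" for a
    using assms(2) by (auto simp: shift_coeff_def lookup_xpow)
  moreover have "line_rational (\<lambda>k. if a = 0 then h k else 0)" for a :: "'a \<Rightarrow>\<^sub>0 nat"
    using assms(3) by (cases "a = 0") simp_all
  ultimately show ?thesis
    using assms(1) unfolding skew_operator_def by (auto intro!: exI[of _ "{0}"])
qed

lemma skew_operator_opD:
  fixes i :: 'n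
  shows "skew_operator (opD i :: ('n, 'k::field_char_0) pol_op)"
proof -
  \<comment> \<open>The subtraction is truncated; the excluded case \<open>m_i = 0\<close> is the
    one in which \<open>\<partial>_i x^m\<close> vanishes.\<close>
  have e: "m = (m - sgl i 1) + sgl i 1" if "lkp m i \<noteq> 0" for m :: "'n \<Rightarrow>\<^sub>0 nat"
    by (rule poly_mapping_eqI) (use that in \<open>auto simp: lookup_add lookup_minus lookup_single when_def\<close>)
  have "lowers_by (opD i :: ('n, 'k) pol_op) {sgl i 1}"
    unfolding lowers_by_def using e by (auto simp: lookup_xpow split: if_splits)
  moreover have "shift_coeff (opD i :: ('n, 'k) pol_op) a = (\<lambda>k. if a = sgl i 1 then of_nat (lkp k i + 1) else 0)" for a
  proof
    fix k
    show "shift_coeff (opD i :: ('n, 'k) pol_op) a k = (if a = sgl i 1 then of_nat (lkp k i + 1) else 0)"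
    proof (cases "a = sgl i 1")
      case True
      then show ?thesis by (simp add: shift_coeff_def lookup_xpow lookup_add)
    next
      case False
      have "lkp (k + a) i = 0 \<or> (k + a) - sgl i 1 \<noteq> k"
        using e[of "k + a"] False by (metis add_left_cancel)
      with False show ?thesis by (auto simp: shift_coeff_def lookup_xpow)
    qed
  qed
  moreover have "line_rational (\<lambda>k. of_nat (lkp k i + 1) :: 'k)"
    by (rule line_rational_coord)
  then have "line_rational (\<lambda>k. if a = sgl i 1 then of_nat (lkp k i + 1) else 0 :: 'k)" for a
    by (cases "a = sgl i 1") simp_all
  ultimately show ?thesis
    unfolding skew_operator_def by (metis finite.emptyI finite_insert plin_opD)
qed

lemma skew_operator_add:
  assumes f: "skew_operator f" and g: "skew_operator g"
  shows "skew_operator (\<lambda>p. f p + g p)"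
proof -
  obtain X Y where X: "finite X" "lowers_by f X" and Y: "finite Y" "lowers_by g Y"
    using f g by (auto simp: skew_operator_def)
  have "lowers_by (\<lambda>p. f p + g p) (X \<union> Y)"
    unfolding lowers_by_def
  proof (intro allI impI)
    fix m k assume "lkp (f (xpow m) + g (xpow m)) k \<noteq> 0"
    then have "lkp (f (xpow m)) k \<noteq> 0 \<or> lkp (g (xpow m)) k \<noteq> 0"
      by (auto simp: lookup_add)
    then show "\<exists>a\<in>X \<union> Y. m = k + a"
      using X(2) Y(2) unfolding lowers_by_def by blast
  qed
  moreover have "shift_coeff (\<lambda>p. f p + g p) a = (\<lambda>k. shift_coeff f a k + shift_coeff g a k)" for a
    by (simp add: shift_coeff_def lookup_add fun_eq_iff)
  ultimately show ?thesis
    using f g X(1) Y(1) unfolding skew_operator_def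
    by (auto intro!: line_rational_add exI[of _ "X \<union> Y"])
qed

lemma skew_operator_scale:
  assumes f: "skew_operator f"
  shows "skew_operator (\<lambda>p. pscale c (f p))"
proof -
  obtain X where X: "finite X" "lowers_by f X"
    using f by (auto simp: skew_operator_def)
  then have "lowers_by (\<lambda>p. pscale c (f p)) X"
    by (auto simp: lowers_by_def)
  moreover have "shift_coeff (\<lambda>p. pscale c (f p)) a = (\<lambda>k. c * shift_coeff f a k)" for a
    by (simp add: shift_coeff_def fun_eq_iff)
  ultimately show ?thesis
    using f X(1) unfolding skew_operator_def by (auto intro!: line_rational_mult)
qed

section \<open>Generation of \<open>Delta\<close>\<close>

lemma L_plus_subalgebra: "subalgebra_of Jac L_plus"
  unfolding L_plus_def by (rule k_algebra.subalgebra_hull[OF k_algebra_Jac]) auto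

lemma L_plus_carrier: "L_plus \<subseteq> carrier Jac"
  using L_plus_subalgebra subringE(1) by (auto simp: subalgebra_of_def)

lemma Delta_subalgebra: "subalgebra_of Jac Delta"
  unfolding Delta_def
  by (rule k_algebra.subalgebra_hull[OF k_algebra_Jac]) (use L_plus_carrier in auto)

lemma Delta_minimal:
  assumes B: "subalgebra_of Jac B"
    and "\<And>i. opH i \<in> B" "\<And>i j. opHinv i j \<in> B" "\<And>i. opD i \<in> B"
  shows "Delta \<subseteq> B"
proof -
  have "L_plus \<subseteq> B"
    unfolding L_plus_def by (rule hull_minimal) (use assms in auto)
  then show ?thesis
    unfolding Delta_def using assms by (intro hull_minimal) auto
qed

lemma Delta_gens:
  fixes i :: "'n::finite"
  shows "(opH i :: ('n, 'k::field_char_0) pol_op) \<in> Delta"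
    and "(opHinv i j :: ('n, 'k) pol_op) \<in> Delta" and "(opD i :: ('n, 'k) pol_op) \<in> Delta"
proof -
  have "L_plus \<union> range opD \<subseteq> (Delta :: ('n, 'k) pol_op set)"
    unfolding Delta_def by (rule hull_subset)
  moreover have "range opH \<union> {opHinv i j | i j. True} \<subseteq> (L_plus :: ('n, 'k) pol_op set)"
    unfolding L_plus_def by (rule hull_subset)
  ultimately show "(opH i :: ('n, 'k) pol_op) \<in> Delta" "(opHinv i j :: ('n, 'k) pol_op) \<in> Delta"
    "(opD i :: ('n, 'k) pol_op) \<in> Delta"
    by blast+
qed

lemma Delta_carrier: "Delta \<subseteq> carrier Jac"
  using Delta_subalgebra subringE(1) by (auto simp: subalgebra_of_def)

lemma Delta_closed:
  fixes f g :: "('n::finite, 'k::field_char_0) pol_op"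
  shows "(id :: ('n, 'k) pol_op) \<in> Delta"
  and "\<lbrakk>f \<in> Delta; g \<in> Delta\<rbrakk> \<Longrightarrow> f \<circ> g \<in> Delta"
  and "\<lbrakk>f \<in> Delta; g \<in> Delta\<rbrakk> \<Longrightarrow> (\<lambda>p. f p + g p) \<in> Delta"
  and "f \<in> Delta \<Longrightarrow> (\<lambda>p. pscale c (f p)) \<in> Delta"
proof -
  have sub: "subring (Delta :: ('n, 'k) pol_op set) Jac"
    by (rule Delta_subalgebra[unfolded subalgebra_of_def, THEN conjunct1])
  have smult: "\<forall>c. \<forall>v\<in>Delta. c \<odot>\<^bsub>Jac\<^esub> (v :: ('n, 'k) pol_op) \<in> Delta"
    by (rule Delta_subalgebra[unfolded subalgebra_of_def, THEN conjunct2])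
  show "(id :: ('n, 'k) pol_op) \<in> Delta"
    using subringE(3)[OF sub] by simp
  show "f \<circ> g \<in> Delta" "(\<lambda>p. f p + g p) \<in> Delta" if "f \<in> Delta" "g \<in> Delta"
    using subringE(6,7)[OF sub that] by simp_all
  show "(\<lambda>p. pscale c (f p)) \<in> Delta" if "f \<in> Delta"
    using smult that by simp
qed

lemma Delta_skew_operator:
  fixes f :: "('n::finite, 'k::field_char_0) pol_op"
  assumes "f \<in> Delta"
  shows "skew_operator f"
proof -
  let ?B = "{f :: ('n, 'k) pol_op. f \<in> carrier Jac \<and> skew_operator f}"
  have "Delta \<subseteq> ?B"
  proof (rule Delta_minimal)
    have "skew_operator (id :: ('n, 'k) pol_op)"
      by (rule skew_operator_diagonal[where h = "\<lambda>_. 1"]) simp_all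
    then show "subalgebra_of Jac ?B"
      by (intro subalgebra_JacI)
        (auto intro: skew_operator_comp skew_operator_add skew_operator_scale)
    show "opH i \<in> ?B" for i
      by (auto intro!: skew_operator_diagonal[OF plin_opH opH_xpow] line_rational_coord)
    show "opHinv i j \<in> ?B" for i j
      by (auto intro!: skew_operator_diagonal[OF plin_opHinv opHinv_xpow] line_rational_inverse_coord)
    show "opD i \<in> ?B" for i
      by (simp add: skew_operator_opD)
  qed
  with assms show ?thesis by auto
qed

lemma Delta_domain:
  "\<lbrakk>f \<in> Delta; g \<in> Delta; f \<circ> g = (\<lambda>p. 0)\<rbrakk> \<Longrightarrow> f = (\<lambda>p. 0) \<or> g = (\<lambda>p. 0)"
  by (rule skew_operator_domain) (auto intro: Delta_skew_operator)

section \<open>The monoid of the \<open>\<partial>\<^sup>\<alpha>\<close>\<close>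

lemma opD_commute: "opD i \<circ> opD j = opD j \<circ> opD i"
proof (rule plin_eqI)
  fix m
  have "m - sgl j 1 - sgl i 1 = m - sgl i 1 - sgl j (1::nat)"
    by (rule poly_mapping_eqI) (simp add: lookup_minus)
  then show "(opD i \<circ> opD j) (xpow m) = (opD j \<circ> opD i) (xpow m)"
    by (cases "i = j") (simp_all add: plinD lookup_minus lookup_single when_def mult.commute)
qed simp_all

text \<open>Partial products over \<open>J\<close>, which make induction over the variables
  possible; \<open>J = UNIV\<close> gives \<open>opD_pow\<close>.\<close>

definition opD_prod :: "'n set \<Rightarrow> ('n \<Rightarrow> nat) \<Rightarrow> ('n, 'k::field_char_0) pol_op" where
  "opD_prod J \<alpha> = Finite_Set.fold (\<lambda>i f. (opD i ^^ \<alpha> i) \<circ> f) id J"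

lemma opD_pow_eq: "opD_pow \<alpha> = opD_prod UNIV \<alpha>"
  by (simp add: opD_pow_def opD_prod_def)

lemma funpow_commute: "f \<circ> g = g \<circ> f \<Longrightarrow> (f ^^ k) \<circ> g = g \<circ> (f ^^ k)"
  by (induction k) (simp_all add: fun_eq_iff)

lemma opD_power_commute: "(opD i ^^ k) \<circ> (opD j ^^ l) = (opD j ^^ l) \<circ> (opD i ^^ k)"
  by (metis funpow_commute opD_commute)

lemma opD_prod_empty [simp]: "opD_prod {} \<alpha> = id"
  by (simp add: opD_prod_def)

lemma opD_prod_insert:
  assumes "finite J" "i \<notin> J"
  shows "opD_prod (insert i J) \<alpha> = ((opD i :: ('a, 'b::field_char_0) pol_op) ^^ \<alpha> i) \<circ> opD_prod J \<alpha>"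
proof -
  interpret comp_fun_commute "\<lambda>i f. ((opD i :: ('a, 'b) pol_op) ^^ \<alpha> i) \<circ> f"
  proof
    fix x y
    let ?d = "opD :: 'a \<Rightarrow> ('a, 'b) pol_op"
    show "(\<circ>) (?d y ^^ \<alpha> y) \<circ> (\<circ>) (?d x ^^ \<alpha> x) = (\<circ>) (?d x ^^ \<alpha> x) \<circ> (\<circ>) (?d y ^^ \<alpha> y)"
      by (simp add: fun_eq_iff
          opD_power_commute[where i = y and j = x, unfolded fun_eq_iff comp_apply, rule_format])
  qed
  show ?thesis
    unfolding opD_prod_def using assms by (rule fold_insert)
qed

lemma opD_prod_power_commute:
  fixes i :: 'n
  defines "d \<equiv> opD :: 'n \<Rightarrow> ('n, 'k::field_char_0) pol_op"
  shows "finite J \<Longrightarrow> (d i ^^ k) \<circ> opD_prod J \<alpha> = opD_prod J \<alpha> \<circ> (d i ^^ k)"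
proof (induction J rule: finite_induct)
  case (insert j J)
  have "(d i ^^ k) \<circ> ((d j ^^ \<alpha> j) \<circ> opD_prod J \<alpha>) = ((d j ^^ \<alpha> j) \<circ> (d i ^^ k)) \<circ> opD_prod J \<alpha>"
    unfolding comp_assoc[symmetric] d_def opD_power_commute[where i = i and j = j] ..
  also have "\<dots> = ((d j ^^ \<alpha> j) \<circ> opD_prod J \<alpha>) \<circ> (d i ^^ k)"
    unfolding comp_assoc insert.IH ..
  finally show ?case
    unfolding opD_prod_insert[OF insert.hyps] d_def .
qed simp

lemma opD_prod_add:
  fixes J :: "'n set"
  defines "d \<equiv> opD :: 'n \<Rightarrow> ('n, 'k::field_char_0) pol_op"
    and "e \<equiv> opD_prod :: 'n set \<Rightarrow> ('n \<Rightarrow> nat) \<Rightarrow> ('n, 'k) pol_op"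
  shows "finite J \<Longrightarrow> e J \<alpha> \<circ> e J \<beta> = e J (\<lambda>i. \<alpha> i + \<beta> i)"
proof (induction J rule: finite_induct)
  case (insert j J)
  have "((d j ^^ \<alpha> j) \<circ> e J \<alpha>) \<circ> ((d j ^^ \<beta> j) \<circ> e J \<beta>)
      = (d j ^^ \<alpha> j) \<circ> ((e J \<alpha> \<circ> (d j ^^ \<beta> j)) \<circ> e J \<beta>)"
    unfolding comp_assoc ..
  also have "\<dots> = ((d j ^^ \<alpha> j) \<circ> (d j ^^ \<beta> j)) \<circ> (e J \<alpha> \<circ> e J \<beta>)"
    unfolding d_def e_def opD_prod_power_commute[OF insert.hyps(1), symmetric] comp_assoc ..
  also have "\<dots> = (d j ^^ (\<alpha> j + \<beta> j)) \<circ> e J (\<lambda>i. \<alpha> i + \<beta> i)"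
    unfolding funpow_add insert.IH ..
  finally show ?case
    unfolding opD_prod_insert[OF insert.hyps] d_def e_def .
qed (simp add: e_def)

lemma opD_prod_zero: "finite J \<Longrightarrow> opD_prod J (\<lambda>_. 0) = id"
  by (induction J rule: finite_induct) (simp_all add: opD_prod_insert)

lemma opD_prod_single:
  "finite J \<Longrightarrow> opD_prod J ((\<lambda>_. 0)(i := k)) = (if i \<in> J then opD i ^^ k else id)"
  by (induction J rule: finite_induct) (auto simp: opD_prod_insert)

lemma opD_prod_induct:
  assumes "P id" "\<And>f g. \<lbrakk>P f; P g\<rbrakk> \<Longrightarrow> P (f \<circ> g)" "\<And>i. P (opD i)"
  shows "finite J \<Longrightarrow> P (opD_prod J \<alpha>)"
proof (induction J rule: finite_induct)
  case (insert i J)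
  have "P (opD i ^^ k)" for k
    by (induction k) (unfold funpow.simps, (rule assms | assumption)+)
  with insert.IH show ?case
    unfolding opD_prod_insert[OF insert.hyps] by (rule assms(2)[rotated])
qed (unfold opD_prod_empty, rule assms(1))

lemma opD_pow_induct:
  assumes "P id" "\<And>f g. \<lbrakk>P f; P g\<rbrakk> \<Longrightarrow> P (f \<circ> g)" "\<And>i. P (opD i)"
  shows "P (opD_pow \<alpha>)"
  unfolding opD_pow_eq by (rule opD_prod_induct[where P = P]) (use assms in auto)

lemma opD_pow_comp: "opD_pow \<alpha> \<circ> opD_pow \<beta> = opD_pow (\<lambda>i. \<alpha> i + \<beta> i)"
  by (simp add: opD_pow_eq opD_prod_add)

lemma opD_pow_zero: "opD_pow (\<lambda>_. 0) = id"
  by (simp add: opD_pow_eq opD_prod_zero)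

lemma opD_pow_single: "opD_pow ((\<lambda>_. 0)(i := k)) = opD i ^^ k"
  by (simp add: opD_pow_eq opD_prod_single)

lemma opD_power_in_range: "opD i ^^ k \<in> range opD_pow"
  using opD_pow_single by (metis rangeI)

text \<open>Formal integration in x_i is a right inverse; it divides by \<open>m_i + 1\<close>,
  which is where characteristic zero enters. Surjectivity is what makes \<partial>^\<alpha> left
  regular under composition.\<close>

lemma surj_opD: "surj (opD i :: ('n, 'k::field_char_0) pol_op)"
proof -
  let ?g = "lin_ext (\<lambda>m. pscale (inverse (of_nat (lkp m i + 1))) (xpow (m + sgl i 1))) :: ('n, 'k) pol_op"
  have "opD i \<circ> ?g = id"
  proof (rule plin_eqI)
    fix m :: "'n \<Rightarrow>\<^sub>0 nat"
    have "of_nat (lkp m i + 1) \<noteq> (0 :: 'k)"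
      unfolding of_nat_eq_0_iff by simp
    then show "(opD i \<circ> ?g) (xpow m) = id (xpow m)"
      by (simp add: plinD lookup_add del: of_nat_add)
  qed simp_all
  then show ?thesis
    by (intro surjI[where f = ?g]) (simp add: fun_eq_iff)
qed

lemma surj_opD_pow: "surj (opD_pow \<alpha> :: ('n::finite, 'k::field_char_0) pol_op)"
  by (rule opD_pow_induct[where P = surj]) (rule surj_id, erule (1) comp_surj[rotated], rule surj_opD)

text \<open>Checked on generators:
  \<open>\<partial>_i H_j = (H_j + \<delta>_ij) \<partial>_i\<close> and \<open>\<partial>_i (H_j +
  k)^-1 = (H_j + k + \<delta>_ij)^-1 \<partial>_i\<close>, the remaining ones commuting with
  \<partial>_i.\<close>

lemma Delta_shift_opD:
  fixes d :: "('n::finite, 'k::field_char_0) pol_op"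
  assumes "d \<in> Delta"
  shows "\<exists>d'\<in>Delta. opD i \<circ> d = d' \<circ> opD i"
proof -
  let ?B = "{d :: ('n, 'k) pol_op. d \<in> Delta \<and> (\<exists>d'\<in>Delta. opD i \<circ> d = d' \<circ> opD i)}"
  have "Delta \<subseteq> ?B"
  proof (rule Delta_minimal)
    show "subalgebra_of Jac ?B"
    proof (rule subalgebra_JacI)
      show "?B \<subseteq> carrier Jac" using Delta_carrier by auto
      show "id \<in> ?B" by (auto intro!: Delta_closed bexI[of _ id])
    next
      fix f g assume "f \<in> ?B" "g \<in> ?B"
      then obtain f' g' where *: "f \<in> Delta" "g \<in> Delta" "f' \<in> Delta" "g' \<in> Delta"
        "opD i \<circ> f = f' \<circ> opD i" "opD i \<circ> g = g' \<circ> opD i"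
        by blast
      have "opD i \<circ> (f \<circ> g) = (f' \<circ> g') \<circ> opD i"
        using *(5,6) by (metis comp_assoc)
      with * show "f \<circ> g \<in> ?B" using Delta_closed(2) by blast
      have "opD i \<circ> (\<lambda>p. f p + g p) = (\<lambda>p. f' p + g' p) \<circ> opD i"
        using *(5,6) by (simp add: fun_eq_iff plinD)
      moreover have "(\<lambda>p. f p + g p) \<in> Delta" "(\<lambda>p. f' p + g' p) \<in> Delta"
        using * Delta_closed(3) by auto
      ultimately show "(\<lambda>p. f p + g p) \<in> ?B" by blast
    next
      fix c f assume "f \<in> ?B"
      then obtain f' where *: "f \<in> Delta" "f' \<in> Delta" "opD i \<circ> f = f' \<circ> opD i"
        by blast
      have "opD i \<circ> (\<lambda>p. pscale c (f p)) = (\<lambda>p. pscale c (f' p)) \<circ> opD i"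
        using *(3) by (simp add: fun_eq_iff plinD)
      moreover have "(\<lambda>p. pscale c (f p)) \<in> Delta" "(\<lambda>p. pscale c (f' p)) \<in> Delta"
        using * Delta_closed(4) by auto
      ultimately show "(\<lambda>p. pscale c (f p)) \<in> ?B" by blast
    qed
  next
    fix j
    \<comment> \<open>\<open>?c\<close> is the Kronecker delta. For \<open>m_i = 0\<close> the
      truncated exponent can violate the identity \<open>l\<close>, but
      \<open>\<partial>_i x^m = 0\<close> there.\<close>
    let ?c = "if i = j then 1 else 0 :: nat"
    have l: "lkp (m - sgl i 1) j + ?c = lkp m j" if "lkp m i \<noteq> 0" for m :: "'n \<Rightarrow>\<^sub>0 nat"
      using that by (auto simp: lookup_minus lookup_single when_def)
    have "opD i \<circ> opH j = (\<lambda>p. opH j p + pscale (of_nat ?c) (id p)) \<circ> (opD i :: ('n, 'k) pol_op)"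
    proof (rule plin_eqI)
      fix m :: "'n \<Rightarrow>\<^sub>0 nat"
      let ?Q = "\<lambda>p :: ('n, 'k) pol. opH j p + pscale (of_nat ?c) (id p)"
      have Q: "plin ?Q"
        by (intro plin_add plin_scale plin_opH plin_id)
      let ?y = "xpow (m - sgl i 1) :: ('n, 'k) pol"
      have "?Q ?y = pscale (of_nat (lkp (m - sgl i 1) j + ?c + 1)) ?y"
        by (simp add: pscale_distribs add_ac)
      then have "(?Q \<circ> opD i) (xpow m)
          = pscale (of_nat (lkp m i) * of_nat (lkp (m - sgl i 1) j + ?c + 1)) ?y"
        unfolding comp_apply opD_xpow plinD(2)[OF Q] by (simp only: pscale_simps)
      also have "\<dots> = pscale (of_nat (lkp m i) * of_nat (lkp m j + 1)) ?y"
        using l[of m] by (cases "lkp m i = 0") (simp_all only: of_nat_0 mult_zero_left not_False_eq_True)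
      also have "\<dots> = (opD i \<circ> opH j) (xpow m)"
        by (simp add: plinD mult.commute)
      finally show "(opD i \<circ> opH j) (xpow m) = (?Q \<circ> opD i) (xpow m)" ..
    qed (intro plin_comp plin_add plin_scale plin_opH plin_opD plin_id)+
    moreover have "(\<lambda>p. opH j p + pscale (of_nat ?c) (id p)) \<in> (Delta :: ('n, 'k) pol_op set)"
      by (intro Delta_closed Delta_gens)
    ultimately show "opH j \<in> ?B"
      using Delta_gens(1) by blast
    fix k
    have "opD i \<circ> opHinv j k = (opHinv j (k + ?c) :: ('n, 'k) pol_op) \<circ> opD i"
    proof (rule plin_eqI)
      fix m :: "'n \<Rightarrow>\<^sub>0 nat"
      let ?y = "xpow (m - sgl i 1) :: ('n, 'k) pol"
      have "(opHinv j (k + ?c) \<circ> opD i) (xpow m)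
          = pscale (of_nat (lkp m i) * inverse (of_nat (lkp (m - sgl i 1) j + 1 + (k + ?c)))) ?y"
        unfolding comp_apply opD_xpow plinD(2)[OF plin_opHinv] opHinv_xpow by (simp only: pscale_simps)
      also have "\<dots> = pscale (of_nat (lkp m i) * inverse (of_nat (lkp m j + 1 + k))) ?y"
      proof (cases "lkp m i = 0")
        case False
        have "lkp (m - sgl i 1) j + 1 + (k + ?c) = lkp m j + 1 + k"
          using l[OF False] by linarith
        then show ?thesis by (simp only:)
      qed (simp only: of_nat_0 mult_zero_left)
      also have "\<dots> = (opD i \<circ> opHinv j k) (xpow m)"
        by (simp add: plinD mult.commute)
      finally show "(opD i \<circ> opHinv j k) (xpow m) = ((opHinv j (k + ?c) \<circ> opD i) (xpow m) :: ('n, 'k) pol)" ..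
    qed (intro plin_comp plin_opHinv plin_opD)+
    then show "opHinv j k \<in> ?B"
      using Delta_gens(2) by blast
  next
    fix j
    have "opD i \<circ> opD j = opD j \<circ> (opD i :: ('n, 'k) pol_op)"
      by (rule opD_commute)
    then show "opD j \<in> ?B"
      using Delta_gens(3) by blast
  qed
  with assms show ?thesis by auto
qed

lemma Delta_shift_opD_pow:
  fixes d :: "('n::finite, 'k::field_char_0) pol_op"
  assumes "d \<in> Delta"
  shows "\<exists>d'\<in>Delta. opD_pow \<alpha> \<circ> d = d' \<circ> opD_pow \<alpha>"
proof -
  have "\<forall>d\<in>Delta. \<exists>d'\<in>Delta. opD_pow \<alpha> \<circ> (d :: ('n, 'k) pol_op) = d' \<circ> opD_pow \<alpha>"
  proof (rule opD_pow_induct[where P = "\<lambda>t. \<forall>d\<in>Delta. \<exists>d'\<in>Delta. t \<circ> d = d' \<circ> t"])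
    show "\<forall>d\<in>Delta. \<exists>d'\<in>Delta. f \<circ> g \<circ> d = d' \<circ> (f \<circ> g)"
      if fg: "\<forall>d\<in>Delta. \<exists>d'\<in>Delta. f \<circ> d = d' \<circ> f" "\<forall>d\<in>Delta. \<exists>d'\<in>Delta. g \<circ> d = d' \<circ> g"
      for f g :: "('n, 'k) pol_op"
    proof
      fix d :: "('n, 'k) pol_op" assume "d \<in> Delta"
      then obtain d1 where d1: "d1 \<in> Delta" "g \<circ> d = d1 \<circ> g" using fg(2) by blast
      obtain d2 where d2: "d2 \<in> Delta" "f \<circ> d1 = d2 \<circ> f" using fg(1) d1(1) by blast
      have "f \<circ> g \<circ> d = d2 \<circ> (f \<circ> g)"
        unfolding comp_assoc d1(2) unfolding comp_assoc[symmetric] d2(2) ..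
      with d2(1) show "\<exists>d'\<in>Delta. f \<circ> g \<circ> d = d' \<circ> (f \<circ> g)" by blast
    qed
  qed (auto intro: Delta_shift_opD)
  with assms show ?thesis by blast
qed

lemma opD_pow_Delta: "opD_pow \<alpha> \<in> Delta"
  by (rule opD_pow_induct[where P = "\<lambda>t. t \<in> Delta"])
    (rule Delta_closed(1), erule (1) Delta_closed(2), rule Delta_gens(3))

text \<open>The generators that have to be moved are the x_i, and \<partial>_i x_i = H_i. For a
  product \<open>f g\<close>, the power that clears \<open>g\<close> is shifted across the already
  cleared \<open>f\<close>.\<close>

lemma Jac_reach_Delta:
  fixes r :: "('n::finite, 'k::field_char_0) pol_op"
  assumes "r \<in> carrier Jac"
  shows "\<exists>\<alpha>. opD_pow \<alpha> \<circ> r \<in> Delta"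
proof -
  let ?B = "{r :: ('n, 'k) pol_op. r \<in> carrier Jac \<and> (\<exists>\<alpha>. opD_pow \<alpha> \<circ> r \<in> Delta)}"
  have opD_pow_comm: "opD_pow \<alpha> \<circ> opD_pow \<beta> = opD_pow \<beta> \<circ> (opD_pow \<alpha> :: ('n, 'k) pol_op)" for \<alpha> \<beta>
    by (simp add: opD_pow_comp add.commute)
  have base: "r \<in> ?B" if "r \<in> Delta" for r :: "('n, 'k) pol_op"
    using that Delta_carrier by (auto intro!: exI[of _ "\<lambda>_. 0"] simp: opD_pow_zero)
  have "carrier Jac \<subseteq> ?B"
  proof (rule Jac_minimal)
    show "subalgebra_of End_alg ?B"
    proof (rule subalgebra_EndI)
      show "id \<in> ?B" by (rule base) (rule Delta_closed)
    next
      fix f g assume "f \<in> ?B" "g \<in> ?B"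
      then obtain \<alpha> \<beta> where *: "f \<in> carrier Jac" "g \<in> carrier Jac"
        "opD_pow \<alpha> \<circ> f \<in> Delta" "opD_pow \<beta> \<circ> g \<in> Delta" by blast
      obtain d where d: "d \<in> Delta" "opD_pow \<beta> \<circ> (opD_pow \<alpha> \<circ> f) = d \<circ> opD_pow \<beta>"
        using Delta_shift_opD_pow[OF *(3)] by blast
      have "opD_pow (\<lambda>i. \<beta> i + \<alpha> i) \<circ> (f \<circ> g) = d \<circ> (opD_pow \<beta> \<circ> g)"
        unfolding opD_pow_comp[symmetric] comp_assoc[symmetric] d(2)[unfolded comp_assoc[symmetric]] ..
      then have "opD_pow (\<lambda>i. \<beta> i + \<alpha> i) \<circ> (f \<circ> g) \<in> Delta"
        using Delta_closed(2)[OF d(1) *(4)] by simp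
      then show "f \<circ> g \<in> ?B"
        using Jac_closed(3)[OF *(1,2)] by blast
      have plin: "plin (opD_pow \<gamma> :: ('n, 'k) pol_op)" for \<gamma>
        by (rule Jac_plin[OF subsetD[OF Delta_carrier opD_pow_Delta]])
      have "opD_pow (\<lambda>i. \<beta> i + \<alpha> i) \<circ> (\<lambda>p. f p + g p)
          = (\<lambda>p. (opD_pow \<beta> \<circ> (opD_pow \<alpha> \<circ> f)) p + (opD_pow \<alpha> \<circ> (opD_pow \<beta> \<circ> g)) p)"
      proof
        fix p
        have "opD_pow \<beta> (opD_pow \<alpha> (g p)) = opD_pow \<alpha> (opD_pow \<beta> (g p))"
          using fun_cong[OF opD_pow_comm[of \<beta> \<alpha>], of "g p"] by (simp only: comp_apply)
        then show "(opD_pow (\<lambda>i. \<beta> i + \<alpha> i) \<circ> (\<lambda>p. f p + g p)) p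
            = (opD_pow \<beta> \<circ> (opD_pow \<alpha> \<circ> f)) p + (opD_pow \<alpha> \<circ> (opD_pow \<beta> \<circ> g)) p"
          unfolding opD_pow_comp[symmetric] by (simp only: comp_apply plinD(1)[OF plin])
      qed
      moreover have "(\<lambda>p. (opD_pow \<beta> \<circ> (opD_pow \<alpha> \<circ> f)) p + (opD_pow \<alpha> \<circ> (opD_pow \<beta> \<circ> g)) p) \<in> Delta"
        by (intro Delta_closed(3)[OF Delta_closed(2)[OF opD_pow_Delta *(3)] Delta_closed(2)[OF opD_pow_Delta *(4)]])
      ultimately have "opD_pow (\<lambda>i. \<beta> i + \<alpha> i) \<circ> (\<lambda>p. f p + g p) \<in> Delta"
        by (simp only:)
      then show "(\<lambda>p. f p + g p) \<in> ?B"
        using Jac_closed(4)[OF *(1,2)] by blast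
    next
      fix c f assume "f \<in> ?B"
      then obtain \<alpha> where *: "f \<in> carrier Jac" "opD_pow \<alpha> \<circ> f \<in> Delta" by blast
      have "plin (opD_pow \<alpha> :: ('n, 'k) pol_op)"
        by (rule Jac_plin[OF subsetD[OF Delta_carrier opD_pow_Delta]])
      then have "opD_pow \<alpha> \<circ> (\<lambda>p. pscale c (f p)) = (\<lambda>p. pscale c ((opD_pow \<alpha> \<circ> f) p))"
        by (simp add: fun_eq_iff plinD)
      then have "opD_pow \<alpha> \<circ> (\<lambda>p. pscale c (f p)) \<in> Delta"
        using Delta_closed(4)[OF *(2)] by simp
      then show "(\<lambda>p. pscale c (f p)) \<in> ?B"
        using Jac_closed(5)[OF *(1)] by blast
    qed auto
  next
    fix i
    have "opD_pow ((\<lambda>_. 0)(i := 1)) \<circ> opX i = (opH i :: ('n, 'k) pol_op)"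
      unfolding opD_pow_single opH_def by simp
    then have "opD_pow ((\<lambda>_. 0)(i := 1)) \<circ> opX i \<in> (Delta :: ('n, 'k) pol_op set)"
      using Delta_gens(1) by simp
    then show "opX i \<in> ?B" using Jac_gens(1) by blast
    show "opD i \<in> ?B" "opHinv i 0 \<in> ?B"
      by (rule base, rule Delta_gens)+
  qed
  with assms show ?thesis by auto
qed

lemma shift_frame_Jac: "shift_frame (Jac :: ('k::field_char_0, ('n::finite, 'k) pol_op) module) Delta (range opD_pow)"
proof -
  interpret k_algebra "Jac :: ('k, ('n, 'k) pol_op) module" by (rule k_algebra_Jac)
  show ?thesis
  proof
    have "id (1 :: ('n, 'k) pol) \<noteq> 0" by simp
    then show "\<one>\<^bsub>Jac :: ('k, ('n, 'k) pol_op) module\<^esub> \<noteq> \<zero>\<^bsub>Jac\<^esub>"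
      unfolding Jac_simps by metis
    show "subalgebra_of (Jac :: ('k, ('n, 'k) pol_op) module) Delta"
      by (rule Delta_subalgebra)
    show "range opD_pow \<subseteq> (Delta :: ('n, 'k) pol_op set)"
      using opD_pow_Delta by auto
    show "\<one>\<^bsub>Jac :: ('k, ('n, 'k) pol_op) module\<^esub> \<in> range opD_pow"
      using opD_pow_zero by (metis Jac_simps(2) rangeI)
  next
    fix t u :: "('n, 'k) pol_op" assume "t \<in> range opD_pow" "u \<in> range opD_pow"
    then show "t \<otimes>\<^bsub>Jac\<^esub> u \<in> range opD_pow" "t \<otimes>\<^bsub>Jac\<^esub> u = u \<otimes>\<^bsub>Jac\<^esub> t"
      by (auto simp: opD_pow_comp add.commute)
  next
    have "r = (\<lambda>p. 0)" if "r \<circ> opD_pow \<alpha> = (\<lambda>p. 0)" for r :: "('n, 'k) pol_op" and \<alpha>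
    proof
      fix p :: "('n, 'k) pol"
      obtain q where "p = opD_pow \<alpha> q"
        using surj_opD_pow[of \<alpha>] by (metis surjD)
      then show "r p = 0" using fun_cong[OF that, of q] by simp
    qed
    then show "range opD_pow \<subseteq> left_regular (Jac :: ('k, ('n, 'k) pol_op) module)"
      using opD_pow_Delta Delta_carrier by (auto simp: left_regular_def)
  next
    fix t d :: "('n, 'k) pol_op" assume "t \<in> range opD_pow" "d \<in> Delta"
    then show "\<exists>d'\<in>Delta. t \<otimes>\<^bsub>Jac\<^esub> d = d' \<otimes>\<^bsub>Jac\<^esub> t"
      using Delta_shift_opD_pow by auto
  next
    fix r :: "('n, 'k) pol_op" assume "r \<in> carrier Jac"
    then show "\<exists>t\<in>range opD_pow. t \<otimes>\<^bsub>Jac\<^esub> r \<in> Delta"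
      using Jac_reach_Delta by auto
  next
    fix d d' :: "('n, 'k) pol_op" assume "d \<in> Delta" "d' \<in> Delta" "d \<otimes>\<^bsub>Jac\<^esub> d' = \<zero>\<^bsub>Jac\<^esub>"
    then show "d = \<zero>\<^bsub>Jac\<^esub> \<or> d' = \<zero>\<^bsub>Jac\<^esub>"
      using Delta_domain by simp
  qed
qed

section \<open>The ideal \<open>\<aa>\<close>\<close>

lemma plin_eqI_unit:
  fixes f g :: "(unit, 'k::comm_ring_1) pol \<Rightarrow> ('n, 'k) pol"
  assumes "plin f" "plin g" "\<And>k. f (xpow (sgl () k)) = g (xpow (sgl () k))"
  shows "f = g"
proof (rule plin_eqI[OF assms(1,2)])
  fix m :: "unit \<Rightarrow>\<^sub>0 nat"
  have "m = sgl () (lkp m ())"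
    by (rule poly_mapping_eqI) simp
  then show "f (xpow m) = g (xpow m)"
    using assms(3) by metis
qed

section \<open>Elementary tensors as operators\<close>

lemma plin_embed_var [simp]: "plin (embed_var i)"
  by (simp add: embed_var_def)

lemma embed_var_xpow [simp]: "embed_var i (xpow m) = xpow (sgl i (lkp m ()))"
  by (simp add: embed_var_def)

lemma plin_tensor_op [simp]: "plin (tensor_op a)"
  by (simp add: tensor_op_def)

lemma tensor_op_xpow:
  "tensor_op a (xpow m) = (\<Prod>i\<in>UNIV. embed_var i (a i (xpow (sgl () (lkp m i)))))"
  by (simp add: tensor_op_def)

lemma prod_xpow: "(\<Prod>j\<in>X. xpow (g j)) = (xpow (\<Sum>j\<in>X. g j) :: ('n, 'k::comm_ring_1) pol)"
  by (induction X rule: infinite_finite_induct) (simp_all add: xpow_zero xpow_add)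

lemma lookup_sum_single: "lkp (\<Sum>j\<in>UNIV. sgl j (u j)) (i :: 'n::finite) = (u i :: nat)"
  by (simp add: lookup_sum lookup_single when_def)

lemma prod_update:
  fixes q :: "'n::finite \<Rightarrow> 'a"
  shows "(\<Prod>j\<in>UNIV. F j ((q(i := r)) j)) = F i r * (\<Prod>j\<in>UNIV - {i}. F j (q j) :: 'b::comm_monoid_mult)"
  by (subst prod.remove[of UNIV i]) (auto intro!: arg_cong2[where f = "(*)"] prod.cong)

text \<open>Both sides are linear in each \<open>q j\<close>; replacing the \<open>q j\<close> by monomials one index at a time
  reduces the identity to the definition of \<^const>\<open>tensor_op\<close>.\<close>

lemma tensor_op_prod:
  fixes b :: "'n::finite \<Rightarrow> (unit, 'k::field_char_0) pol_op"
  assumes b: "\<And>j. plin (b j)"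
  shows "tensor_op b (\<Prod>j\<in>UNIV. embed_var j (q j)) = (\<Prod>j\<in>UNIV. embed_var j (b j (q j)))"
proof -
  have "tensor_op b (\<Prod>j\<in>UNIV. embed_var j (q j)) = (\<Prod>j\<in>UNIV. embed_var j (b j (q j)))"
    if "finite J" "\<And>j. j \<notin> J \<Longrightarrow> \<exists>m. q j = xpow m" for J q
    using that
  proof (induction J arbitrary: q rule: finite_induct)
    case empty
    then have "\<exists>u. \<forall>j. q j = xpow (u j)" by (intro choice) simp
    then obtain u where u: "q = (\<lambda>j. xpow (u j))" by (auto simp: fun_eq_iff)
    have "u j = sgl () (lkp (u j) ())" for j
      by (rule poly_mapping_eqI) simp
    then show ?case
      by (simp add: u prod_xpow tensor_op_xpow lookup_sum_single)
  next
    case (insert i J)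
    let ?F = "\<lambda>r. tensor_op b (\<Prod>j\<in>UNIV. embed_var j ((q(i := r)) j))"
    let ?G = "\<lambda>r. \<Prod>j\<in>UNIV. embed_var j (b j ((q(i := r)) j))"
    have F: "?F = (\<lambda>r. tensor_op b (embed_var i r * (\<Prod>j\<in>UNIV - {i}. embed_var j (q j))))"
      unfolding prod_update ..
    have G: "?G = (\<lambda>r. embed_var i (b i r) * (\<Prod>j\<in>UNIV - {i}. embed_var j (b j (q j))))"
      by (rule ext) (rule prod_update)
    have "?F = ?G"
    proof (rule plin_eqI)
      show "plin ?F"
        unfolding F by (intro plin_compose[OF plin_tensor_op] plin_mult_right plin_embed_var)
      show "plin ?G"
        unfolding G by (intro plin_mult_right plin_compose[OF plin_embed_var] b)
      show "?F (xpow m) = ?G (xpow m)" for m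
        by (rule insert.IH) (use insert.prems in auto)
    qed
    from fun_cong[OF this, of "q i"] show ?case by simp
  qed
  from this[of UNIV] show ?thesis by simp
qed

lemma tensor_op_comp:
  fixes a b :: "'n::finite \<Rightarrow> (unit, 'k::field_char_0) pol_op"
  assumes "\<And>j. plin (b j)"
  shows "tensor_op b \<circ> tensor_op a = tensor_op (\<lambda>j. b j \<circ> a j)"
  by (rule plin_eqI) (simp_all add: tensor_op_xpow tensor_op_prod[OF assms])

lemma tensor_op_id: "tensor_op (\<lambda>_. id) = id"
proof (rule plin_eqI)
  fix m :: "'n::finite \<Rightarrow>\<^sub>0 nat"
  have "(\<Sum>j\<in>UNIV. sgl j (lkp m j)) = m"
    by (rule poly_mapping_eqI) (rule lookup_sum_single)
  then show "tensor_op (\<lambda>_. id) (xpow m) = id (xpow m)"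
    by (simp add: tensor_op_xpow prod_xpow)
qed simp_all

lemma tensor_op_slot:
  "tensor_op (a(i := f)) (xpow m)
    = embed_var i (f (xpow (sgl () (lkp m i)))) * (\<Prod>j\<in>UNIV - {i}. embed_var j (a j (xpow (sgl () (lkp m j)))))"
  unfolding tensor_op_xpow by (rule prod_update[of "\<lambda>j f. embed_var j (f (xpow (sgl () (lkp m j))))"])

lemma tensor_op_add: "tensor_op (a(i := \<lambda>p. f p + g p)) = (\<lambda>p. tensor_op (a(i := f)) p + tensor_op (a(i := g)) p)"
  by (rule plin_eqI) (simp_all add: tensor_op_slot plinD distrib_right del: fun_upd_apply)

lemma tensor_op_scale: "tensor_op (a(i := \<lambda>p. pscale c (f p))) = (\<lambda>p. pscale c (tensor_op (a(i := f)) p))"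
  by (rule plin_eqI) (simp_all add: tensor_op_slot plinD pscale_mult del: fun_upd_apply)

lemma tensor_op_zero: "tensor_op (a(i := \<lambda>p. 0)) = (\<lambda>p. 0)"
  by (rule plin_eqI) (simp_all add: tensor_op_slot plin_0 del: fun_upd_apply)

text \<open>The embedding of the one-variable algebra as \<open>i\<close>-th tensor factor;
  relations in one variable are transported along it.\<close>

definition at_var :: "'n::finite \<Rightarrow> (unit, 'k::field_char_0) pol_op \<Rightarrow> ('n, 'k) pol_op" where
  "at_var i b = tensor_op ((\<lambda>_. id)(i := b))"

lemma plin_at_var [simp]: "plin (at_var i b)"
  by (simp add: at_var_def)

lemma at_var_tensor_op:
  assumes "plin b"
  shows "at_var i b \<circ> tensor_op a = tensor_op (a(i := b \<circ> a i))"
  unfolding at_var_def using assms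
  by (subst tensor_op_comp) (auto intro!: arg_cong[where f = tensor_op])

lemma tensor_op_at_var:
  assumes "\<And>j. plin (a j)"
  shows "tensor_op a \<circ> at_var i b = tensor_op (a(i := a i \<circ> b))"
  unfolding at_var_def using assms
  by (subst tensor_op_comp) (auto intro!: arg_cong[where f = tensor_op])

lemma at_var_comp: "plin b \<Longrightarrow> at_var i b \<circ> at_var i c = at_var i (b \<circ> c)"
  unfolding at_var_def[of i c] at_var_tensor_op by (simp add: at_var_def)

lemma at_var_id: "at_var i id = id"
  unfolding at_var_def by (subst fun_upd_idem) (rule refl, rule tensor_op_id)

text \<open>\<open>m - sgl i (lkp m i)\<close> is \<open>m\<close> with its \<open>i\<close>-th
  exponent erased.\<close>

lemma at_var_xpow:
  "at_var i b (xpow m) = embed_var i (b (xpow (sgl () (lkp m i)))) * xpow (m - sgl i (lkp m i))"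
proof -
  have "(\<Sum>j\<in>UNIV - {i}. sgl j (lkp m j)) = m - sgl i (lkp m i)"
  proof -
    have "(\<Sum>j\<in>UNIV. sgl j (lkp m j)) = m"
      by (rule poly_mapping_eqI) (rule lookup_sum_single)
    moreover have "(\<Sum>j\<in>UNIV. sgl j (lkp m j)) = sgl i (lkp m i) + (\<Sum>j\<in>UNIV - {i}. sgl j (lkp m j))"
      by (rule sum.remove) auto
    ultimately show ?thesis by (metis add_diff_cancel_left')
  qed
  then show ?thesis
    unfolding at_var_def tensor_op_slot by (simp add: prod_xpow)
qed

lemma exponent_decompose: "(m - sgl i (lkp m i)) + sgl i (lkp m i) = (m :: 'n \<Rightarrow>\<^sub>0 nat)"
  by (rule poly_mapping_eqI) (simp add: lookup_add lookup_minus lookup_single when_def)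

lemma at_var_opX: "at_var i (opX ()) = opX i"
proof (rule plin_eqI)
  fix m :: "'a \<Rightarrow>\<^sub>0 nat"
  have "sgl i (lkp m i + 1) + (m - sgl i (lkp m i)) = m + sgl i 1"
    by (rule poly_mapping_eqI) (simp add: lookup_add lookup_minus lookup_single when_def)
  then show "at_var i (opX ()) (xpow m) = opX i (xpow m)"
    by (simp add: at_var_xpow xpow_add[symmetric] lookup_add)
qed simp_all

lemma at_var_opD: "at_var i (opD ()) = opD i"
proof (rule plin_eqI)
  fix m :: "'a \<Rightarrow>\<^sub>0 nat"
  have "sgl i (lkp m i - 1) + (m - sgl i (lkp m i)) = m - sgl i 1" if "lkp m i \<noteq> 0"
    by (rule poly_mapping_eqI) (use that in \<open>auto simp: lookup_add lookup_minus lookup_single when_def\<close>)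
  then show "at_var i (opD ()) (xpow m) = opD i (xpow m)"
    by (cases "lkp m i = 0")
      (simp_all add: at_var_xpow xpow_add[symmetric] lookup_minus plinD plin_0 pscale_mult)
qed simp_all

lemma at_var_opHinv: "at_var i (opHinv () j) = opHinv i j"
proof (rule plin_eqI)
  fix m :: "'a \<Rightarrow>\<^sub>0 nat"
  have "sgl i (lkp m i) + (m - sgl i (lkp m i)) = m"
    using exponent_decompose[of m i] by (simp add: add.commute)
  then show "at_var i (opHinv () j) (xpow m) = opHinv i j (xpow m)"
    by (simp add: at_var_xpow xpow_add[symmetric] plinD pscale_mult)
qed simp_all

lemma at_var_add: "at_var i (\<lambda>p. f p + g p) = (\<lambda>p. at_var i f p + at_var i g p)"
  unfolding at_var_def by (rule tensor_op_add)

lemma at_var_scale: "at_var i (\<lambda>p. pscale c (f p)) = (\<lambda>p. pscale c (at_var i f p))"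
  unfolding at_var_def by (rule tensor_op_scale)

text \<open>\<open>at_var i\<close> respects the algebra operations and sends the generators in one
  variable to the generators with index \<open>i\<close>.\<close>

lemma at_var_Jac:
  fixes b :: "(unit, 'k::field_char_0) pol_op" and i :: "'n::finite"
  assumes "b \<in> carrier Jac"
  shows "at_var i b \<in> carrier Jac"
proof -
  let ?B = "{b :: (unit, 'k) pol_op. plin b \<and> at_var i b \<in> carrier Jac}"
  have "carrier Jac \<subseteq> ?B"
  proof (rule Jac_minimal)
    show "subalgebra_of End_alg ?B"
    proof (rule subalgebra_EndI)
      show "id \<in> ?B" by (simp add: at_var_id)
    next
      fix f g assume "f \<in> ?B" "g \<in> ?B"
      then have *: "plin f" "plin g" "at_var i f \<in> carrier Jac" "at_var i g \<in> carrier Jac" by auto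
      show "f \<circ> g \<in> ?B"
        using plin_comp[OF *(1,2)] Jac_closed(3)[OF *(3,4)] at_var_comp[OF *(1), of i g] by simp
      show "(\<lambda>p. f p + g p) \<in> ?B"
        using plin_add[OF *(1,2)] Jac_closed(4)[OF *(3,4)] at_var_add[of i f g] by simp
    next
      fix c f assume "f \<in> ?B"
      then have *: "plin f" "at_var i f \<in> carrier Jac" by auto
      show "(\<lambda>p. pscale c (f p)) \<in> ?B"
        using plin_scale[OF *(1)] Jac_closed(5)[OF *(2)] at_var_scale[of i c f] by simp
    qed auto
    show "opX j \<in> ?B" "opD j \<in> ?B" "opHinv j 0 \<in> ?B" for j :: unit
      by (simp_all add: at_var_opX at_var_opD at_var_opHinv)
  qed
  with assms show ?thesis by auto
qed

text \<open>An elementary tensor is the product of the operators \<open>at_var i (a i)\<close>; the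
  slots are filled one at a time.\<close>

lemma tensor_op_Jac:
  fixes a :: "'n::finite \<Rightarrow> (unit, 'k::field_char_0) pol_op"
  assumes a: "\<And>j. a j \<in> carrier Jac"
  shows "tensor_op a \<in> carrier Jac"
proof -
  have "tensor_op (\<lambda>j. if j \<in> J then a j else id) \<in> carrier Jac" if "finite J" for J
    using that
  proof (induction J rule: finite_induct)
    case empty
    then show ?case
      unfolding empty_iff if_False tensor_op_id by (rule Jac_closed(1))
  next
    case (insert i J)
    let ?a = "\<lambda>j. if j \<in> J then a j else id"
    have "tensor_op (\<lambda>j. if j \<in> insert i J then a j else id) = tensor_op (?a(i := a i \<circ> ?a i))"
      using insert.hyps by (intro arg_cong[where f = tensor_op]) auto
    also have "\<dots> = at_var i (a i) \<circ> tensor_op ?a"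
      by (rule at_var_tensor_op[symmetric]) (simp add: a)
    finally have eq: "tensor_op (\<lambda>j. if j \<in> insert i J then a j else id) = at_var i (a i) \<circ> tensor_op ?a" .
    show ?case
      unfolding eq by (rule Jac_closed(3)[OF at_var_Jac[OF a] insert.IH])
  qed
  from this[of UNIV] show ?thesis by simp
qed

section \<open>Matrix units and the ideal \<open>ideal_F\<close> in one variable\<close>

lemma plin_unitE [simp]: "plin (unitE i j)"
  by (simp add: unitE_def)

lemma unitE_xpow [simp]: "unitE i j (xpow (sgl () k)) = (if k = j then xpow (sgl () i) else 0)"
  by (simp add: unitE_def)

lemma unit_xpow_simps:
  "opX () (xpow (sgl () k)) = xpow (sgl () (Suc k))"
  "opD () (xpow (sgl () k)) = pscale (of_nat k) (xpow (sgl () (k - 1)))"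
  "opHinv () j (xpow (sgl () k)) = pscale (inverse (of_nat (k + 1 + j))) (xpow (sgl () k))"
  by (simp_all add: single_add[symmetric] single_diff[symmetric])

text \<open>Composition with a generator turns a matrix unit into a multiple of a matrix unit, from
  which the stability of \<open>ideal_F\<close> follows. For \<open>i = 0\<close> the truncated
  index \<open>i - 1\<close> is harmless because its coefficient is zero.\<close>

lemma unitE_relations:
  "opX () \<circ> unitE i j = unitE (Suc i) j"
  "opD () \<circ> unitE i j = (\<lambda>p. pscale (of_nat i) (unitE (i - 1) j p))"
  "opHinv () 0 \<circ> unitE i j = (\<lambda>p. pscale (inverse (of_nat (i + 1))) (unitE i j p))"
  "unitE i 0 \<circ> opX () = (\<lambda>p. 0)"
  "unitE i (Suc j) \<circ> opX () = unitE i j"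
  "unitE i j \<circ> opHinv () 0 = (\<lambda>p. pscale (inverse (of_nat (j + 1))) (unitE i j p))"
  by (rule plin_eqI_unit; auto simp: unit_xpow_simps plinD plin_0 simp del: opX_xpow opD_xpow opHinv_xpow)+

lemma unitE_opD: "unitE i j \<circ> opD () = (\<lambda>p. pscale (of_nat (Suc j)) (unitE i (Suc j) p))"
proof (rule plin_eqI_unit)
  fix k
  show "(unitE i j \<circ> opD ()) (xpow (sgl () k)) = pscale (of_nat (Suc j)) (unitE i (Suc j) (xpow (sgl () k)))"
    by (cases k) (simp_all add: unit_xpow_simps plinD plin_0 del: opD_xpow single_zero)
qed simp_all

text \<open>For \<open>k > 0\<close> the eigenvalue of \<open>H\<close> on \<open>x^(k-1)\<close> is
  \<open>k\<close>, which cancels the factor from differentiation. Only the constants are lost, and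
  \<open>unitE 0 0\<close> restores them.\<close>

lemma unit_decompose: "id = (\<lambda>p. (opX () \<circ> (opHinv () 0 \<circ> opD ())) p + unitE 0 0 p)"
proof (rule plin_eqI_unit)
  fix k
  have "of_nat (Suc k) \<noteq> (0 :: 'a)" for k
    by (rule of_nat_neq_0)
  then show "id (xpow (sgl () k)) = (opX () \<circ> (opHinv () 0 \<circ> opD ())) (xpow (sgl () k)) + (unitE 0 0 (xpow (sgl () k)) :: (unit, 'a) pol)"
    by (cases k) (simp_all add: unit_xpow_simps plinD plin_0 del: opX_xpow opD_xpow opHinv_xpow of_nat_Suc single_zero)
qed (intro plin_id plin_add plin_comp plin_opX plin_opD plin_opHinv plin_unitE)+

text \<open>\<open>unitE 0 0\<close> comes from \<open>unit_decompose\<close>; composing with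
  \<partial> on the right raises the column index up to a nonzero scalar, and composing with x on
  the left raises the row index.\<close>

lemma unitE_Jac: "(unitE i j :: (unit, 'k::field_char_0) pol_op) \<in> carrier Jac"
proof (induction i)
  case 0
  show ?case
  proof (induction j)
    case 0
    have "(unitE 0 0 :: (unit, 'k) pol_op)
        = (\<lambda>p. id p + pscale (-1) ((opX () \<circ> (opHinv () 0 \<circ> opD ())) p))"
    proof
      fix p :: "(unit, 'k) pol"
      have "pscale (-1) q = - q" for q :: "(unit, 'k) pol"
        using pscale_minus_one[of q] by (simp add: eq_neg_iff_add_eq_0)
      then show "unitE 0 0 p = id p + pscale (-1) ((opX () \<circ> (opHinv () 0 \<circ> opD ())) p)"
        using fun_cong[OF unit_decompose, of p] by (simp add: algebra_simps)
    qed
    moreover have "opX () \<circ> (opHinv () 0 \<circ> opD ()) \<in> (carrier Jac :: (unit, 'k) pol_op set)"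
      by (intro Jac_closed(3) Jac_gens)
    then have "(\<lambda>p. id p + pscale (-1) ((opX () \<circ> (opHinv () 0 \<circ> opD ())) p))
        \<in> (carrier Jac :: (unit, 'k) pol_op set)"
      by (intro Jac_closed(4)[OF Jac_closed(1)] Jac_closed(5))
    ultimately show ?case by (simp only:)
  next
    case (Suc j)
    have nz: "of_nat (Suc j) \<noteq> (0 :: 'k)"
      by (rule of_nat_neq_0)
    have "unitE 0 j \<circ> opD () \<in> (carrier Jac :: (unit, 'k) pol_op set)"
      by (intro Jac_closed(3) Jac_gens Suc.IH)
    then have "(\<lambda>p. pscale (inverse (of_nat (Suc j))) ((unitE 0 j \<circ> opD ()) p))
        \<in> (carrier Jac :: (unit, 'k) pol_op set)"
      by (rule Jac_closed(5))
    then show ?case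
      unfolding unitE_opD using nz by (simp del: of_nat_Suc)
  qed
next
  case (Suc i)
  then show ?case
    unfolding unitE_relations(1)[symmetric] by (intro Jac_closed(3) Jac_gens)
qed

lemma subspace_hull_End:
  "(\<And>f. f \<in> X \<Longrightarrow> plin f) \<Longrightarrow> subspace_of End_alg (subspace_of End_alg hull X)"
  by (rule k_algebra.subspace_hull[OF k_algebra_End]) auto

text \<open>For a span defined as a hull, stability under composition then has to be tested on the
  spanning elements only.\<close>

lemma subspace_comp_left:
  fixes b :: "('n, 'k::field_char_0) pol_op"
  assumes V: "subspace_of End_alg V" and b: "plin b"
  shows "subspace_of End_alg {f. plin f \<and> b \<circ> f \<in> V}"
proof -
  let ?W = "{f. plin f \<and> b \<circ> f \<in> V}"
  show ?thesis
  proof (rule subspace_EndI)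
    have "b \<circ> (\<lambda>p :: ('n, 'k) pol. 0 :: ('n, 'k) pol) = (\<lambda>p. 0)"
      using b by (simp add: fun_eq_iff plin_0)
    then show "(\<lambda>p. 0) \<in> ?W"
      using subspace_EndD(2)[OF V] by simp
  next
    fix f g assume *: "f \<in> ?W" "g \<in> ?W"
    have "b \<circ> (\<lambda>p. f p + g p) = (\<lambda>p. (b \<circ> f) p + (b \<circ> g) p)"
      using b by (simp add: fun_eq_iff plinD)
    then show "(\<lambda>p. f p + g p) \<in> ?W"
      using subspace_EndD(3)[OF V, of "b \<circ> f" "b \<circ> g"] * by simp
  next
    fix c f assume *: "f \<in> ?W"
    have "b \<circ> (\<lambda>p. pscale c (f p)) = (\<lambda>p. pscale c ((b \<circ> f) p))"
      using b by (simp add: fun_eq_iff plinD)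
    then show "(\<lambda>p. pscale c (f p)) \<in> ?W"
      using subspace_EndD(4)[OF V, of "b \<circ> f" c] * by simp
  qed auto
qed

lemma subspace_comp_right:
  fixes b :: "('n, 'k::field_char_0) pol_op"
  assumes V: "subspace_of End_alg V"
  shows "subspace_of End_alg {f. plin f \<and> f \<circ> b \<in> V}"
proof -
  let ?W = "{f. plin f \<and> f \<circ> b \<in> V}"
  show ?thesis
  proof (rule subspace_EndI)
    have "(\<lambda>p. 0) \<circ> b = (\<lambda>p. 0 :: ('n, 'k) pol)"
      by (simp add: fun_eq_iff)
    then show "(\<lambda>p. 0) \<in> ?W"
      using subspace_EndD(2)[OF V] by simp
  next
    fix f g assume *: "f \<in> ?W" "g \<in> ?W"
    have "(\<lambda>p. f p + g p) \<circ> b = (\<lambda>p. (f \<circ> b) p + (g \<circ> b) p)"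
      by (simp add: fun_eq_iff)
    then show "(\<lambda>p. f p + g p) \<in> ?W"
      using subspace_EndD(3)[OF V, of "f \<circ> b" "g \<circ> b"] * by simp
  next
    fix c f assume *: "f \<in> ?W"
    have "(\<lambda>p. pscale c (f p)) \<circ> b = (\<lambda>p. pscale c ((f \<circ> b) p))"
      by (simp add: fun_eq_iff)
    then show "(\<lambda>p. pscale c (f p)) \<in> ?W"
      using subspace_EndD(4)[OF V, of "f \<circ> b" c] * by simp
  qed auto
qed

lemma F_subspace: "subspace_of End_alg ideal_F"
  unfolding ideal_F_def by (rule subspace_hull_End) auto

lemma unitE_F: "unitE i j \<in> ideal_F"
  unfolding ideal_F_def by (rule subsetD[OF hull_subset]) auto

lemma F_minimal:
  assumes "subspace_of End_alg V" "\<And>i j. unitE i j \<in> V"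
  shows "ideal_F \<subseteq> V"
  unfolding ideal_F_def by (rule hull_minimal) (use assms in auto)

lemma F_stable_left:
  assumes "plin b" "\<And>i j. b \<circ> unitE i j \<in> ideal_F" "f \<in> ideal_F"
  shows "b \<circ> f \<in> ideal_F"
  using F_minimal[OF subspace_comp_left[OF F_subspace assms(1)]] assms by auto

lemma F_stable_right:
  assumes "\<And>i j. unitE i j \<circ> b \<in> ideal_F" "f \<in> ideal_F"
  shows "f \<circ> b \<in> ideal_F"
  using F_minimal[OF subspace_comp_right[OF F_subspace, of b]] assms by auto

lemma F_left:
  assumes "f \<in> ideal_F"
  shows "opX () \<circ> f \<in> ideal_F" "opHinv () 0 \<circ> f \<in> ideal_F"
  by (rule F_stable_left[OF _ _ assms];
      simp only: unitE_relations plin_opX plin_opHinv unitE_F subspace_EndD(4)[OF F_subspace unitE_F])+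

lemma F_right:
  assumes "f \<in> ideal_F"
  shows "f \<circ> opX () \<in> ideal_F" "f \<circ> opD () \<in> ideal_F" "f \<circ> opHinv () 0 \<in> ideal_F"
proof -
  have "unitE i j \<circ> opX () \<in> ideal_F" for i j
    by (cases j) (simp_all only: unitE_relations unitE_F subspace_EndD(2)[OF F_subspace])
  then show "f \<circ> opX () \<in> ideal_F"
    by (rule F_stable_right[OF _ assms])
  show "f \<circ> opD () \<in> ideal_F"
    by (rule F_stable_right[OF _ assms]) (simp only: unitE_opD subspace_EndD(4)[OF F_subspace unitE_F])
  show "f \<circ> opHinv () 0 \<in> ideal_F"
    by (rule F_stable_right[OF _ assms]) (simp only: unitE_relations subspace_EndD(4)[OF F_subspace unitE_F])
qed

lemma F_plin: "f \<in> ideal_F \<Longrightarrow> plin f"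
  by (rule subspace_EndD(1)[OF F_subspace])

lemma Jac_subspace: "subspace_of End_alg (carrier Jac)"
  by (rule subspace_EndI) simp_all

lemma F_Jac: "f \<in> ideal_F \<Longrightarrow> f \<in> carrier Jac"
  using F_minimal[OF Jac_subspace unitE_Jac] by auto

text \<open>\<open>unitE i j\<close> has its image in the multiples of \<open>x^i\<close>, which
  \<open>i + 1\<close> derivatives kill; for a sum, the exponents of the two summands are
  added.\<close>

lemma F_nilpotent:
  fixes f :: "(unit, 'k::field_char_0) pol_op"
  assumes "f \<in> ideal_F"
  shows "\<exists>k. (opD () ^^ k) \<circ> f = (\<lambda>p. 0)"
proof -
  let ?d = "opD () :: (unit, 'k) pol_op"
  let ?V = "{f :: (unit, 'k) pol_op. plin f \<and> (\<exists>k. \<forall>p. (?d ^^ k) (f p) = 0)}"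
  have d: "plin (?d ^^ k)" for k by simp
  have "ideal_F \<subseteq> ?V"
  proof (rule F_minimal)
    show "subspace_of End_alg ?V"
    proof (rule subspace_EndI)
      fix f g assume "f \<in> ?V" "g \<in> ?V"
      then obtain k l where *: "plin f" "plin g" "\<forall>p. (?d ^^ k) (f p) = 0" "\<forall>p. (?d ^^ l) (g p) = 0"
        by auto
      have "(?d ^^ (k + l)) (f p + g p) = 0" for p
      proof -
        have "(?d ^^ (k + l)) (f p + g p) = (?d ^^ (l + k)) (f p) + (?d ^^ (k + l)) (g p)"
          by (simp only: plinD(1)[OF d] add.commute)
        also have "\<dots> = 0"
          unfolding funpow_add comp_apply using *(3,4) plin_0[OF d] by simp
        finally show ?thesis .
      qed
      with * show "(\<lambda>p. f p + g p) \<in> ?V" by auto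
    next
      fix c f assume "f \<in> ?V"
      then obtain k where "plin f" "\<forall>p. (?d ^^ k) (f p) = 0"
        by auto
      then show "(\<lambda>p. pscale c (f p)) \<in> ?V"
        by (auto simp: plinD(2)[OF d] intro!: exI[of _ k])
    qed (auto intro!: exI[of _ 0])
    fix i j
    have "\<forall>p. (?d ^^ Suc i) (unitE i j p) = 0"
    proof (induction i)
      case 0
      then show ?case
        by (simp add: unitE_relations(2)[unfolded fun_eq_iff comp_apply, rule_format])
    next
      case (Suc i)
      have "?d (unitE (Suc i) j p) = pscale (of_nat (Suc i)) (unitE i j p)" for p
        by (simp add: unitE_relations(2)[unfolded fun_eq_iff comp_apply, rule_format])
      then show ?case
        using Suc unfolding funpow_Suc_right[of "Suc i"] comp_apply
        by (simp only: plinD(2)[OF d] pscale_simps simp_thms)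
    qed
    then show "unitE i j \<in> ?V" by (simp del: funpow.simps) blast
  qed
  with assms show ?thesis by (auto simp: fun_eq_iff)
qed

section \<open>The ideals \<open>ideal_p\<close> and \<open>ideal_a\<close>\<close>

lemma ideal_p_gen:
  assumes "a i \<in> ideal_F" "\<And>j. j \<noteq> i \<Longrightarrow> a j \<in> carrier Jac"
  shows "tensor_op a \<in> ideal_p i"
  unfolding ideal_p_def by (rule subsetD[OF hull_subset]) (use assms in auto)

lemma ideal_p_subspace: "subspace_of End_alg (ideal_p i)"
  unfolding ideal_p_def by (rule subspace_hull_End) auto

lemma ideal_p_minimal:
  assumes "subspace_of End_alg V"
    and "\<And>a. \<lbrakk>a i \<in> ideal_F; \<And>j. j \<noteq> i \<Longrightarrow> a j \<in> carrier Jac\<rbrakk> \<Longrightarrow> tensor_op a \<in> V"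
  shows "ideal_p i \<subseteq> V"
  unfolding ideal_p_def by (rule hull_minimal) (use assms in auto)

text \<open>Composition with \<open>at_var j b\<close> changes slot \<open>j\<close> only: for
  \<open>j = i\<close> the stability of \<open>ideal_F\<close> applies, otherwise the slot stays in
  \<open>Jac\<close>.\<close>

lemma ideal_p_left:
  fixes f :: "('n::finite, 'k::field_char_0) pol_op"
  assumes b: "b \<in> carrier Jac" "\<And>g. g \<in> ideal_F \<Longrightarrow> b \<circ> g \<in> ideal_F" and f: "f \<in> ideal_p i"
  shows "at_var j b \<circ> f \<in> ideal_p i"
proof -
  have "ideal_p i \<subseteq> {f. plin f \<and> at_var j b \<circ> f \<in> ideal_p i}"
  proof (rule ideal_p_minimal)
    show "subspace_of End_alg {f. plin f \<and> at_var j b \<circ> f \<in> ideal_p i}"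
      by (rule subspace_comp_left[OF ideal_p_subspace]) simp
    fix a :: "'n \<Rightarrow> (unit, 'k) pol_op"
    assume a: "a i \<in> ideal_F" "\<And>j. j \<noteq> i \<Longrightarrow> a j \<in> carrier Jac"
    have "tensor_op (a(j := b \<circ> a j)) \<in> ideal_p i"
      by (rule ideal_p_gen) (use a b Jac_closed(3)[of b "a j"] in auto)
    then show "tensor_op a \<in> {f. plin f \<and> at_var j b \<circ> f \<in> ideal_p i}"
      using at_var_tensor_op[OF Jac_plin[OF b(1)], of j a] by simp
  qed
  with f show ?thesis by auto
qed

lemma ideal_p_right:
  fixes f :: "('n::finite, 'k::field_char_0) pol_op"
  assumes b: "b \<in> carrier Jac" "\<And>g. g \<in> ideal_F \<Longrightarrow> g \<circ> b \<in> ideal_F" and f: "f \<in> ideal_p i"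
  shows "f \<circ> at_var j b \<in> ideal_p i"
proof -
  have "ideal_p i \<subseteq> {f. plin f \<and> f \<circ> at_var j b \<in> ideal_p i}"
  proof (rule ideal_p_minimal)
    show "subspace_of End_alg {f. plin f \<and> f \<circ> at_var j b \<in> ideal_p i}"
      by (rule subspace_comp_right[OF ideal_p_subspace])
    fix a :: "'n \<Rightarrow> (unit, 'k) pol_op"
    assume a: "a i \<in> ideal_F" "\<And>j. j \<noteq> i \<Longrightarrow> a j \<in> carrier Jac"
    have "tensor_op (a(j := a j \<circ> b)) \<in> ideal_p i"
      by (rule ideal_p_gen) (use a b Jac_closed(3)[of "a j" b] in auto)
    moreover have "plin (a k)" for k
      using a F_plin Jac_plin by (cases "k = i") auto
    ultimately show "tensor_op a \<in> {f. plin f \<and> f \<circ> at_var j b \<in> ideal_p i}"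
      using tensor_op_at_var[of a j b] by simp
  qed
  with f show ?thesis by auto
qed

lemma ideal_p_right_Jac:
  fixes f r :: "('n::finite, 'k::field_char_0) pol_op"
  assumes f: "f \<in> ideal_p i" and r: "r \<in> carrier Jac"
  shows "f \<circ> r \<in> ideal_p i"
proof -
  let ?B = "{r :: ('n, 'k) pol_op. plin r \<and> (\<forall>f\<in>ideal_p i. f \<circ> r \<in> ideal_p i)}"
  note sub = ideal_p_subspace[of i]
  have "carrier Jac \<subseteq> ?B"
  proof (rule Jac_minimal)
    show "subalgebra_of End_alg ?B"
    proof (rule subalgebra_EndI)
      fix r s assume rs: "r \<in> ?B" "s \<in> ?B"
      have "f \<circ> (r \<circ> s) \<in> ideal_p i" if "f \<in> ideal_p i" for f
        unfolding comp_assoc[symmetric] using rs that by blast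
      with rs show "r \<circ> s \<in> ?B" using plin_comp by blast
      have "f \<circ> (\<lambda>p. r p + s p) \<in> ideal_p i" if f: "f \<in> ideal_p i" for f
      proof -
        have "f \<circ> (\<lambda>p. r p + s p) = (\<lambda>p. (f \<circ> r) p + (f \<circ> s) p)"
          using plinD(1)[OF subspace_EndD(1)[OF sub f]] by (simp add: fun_eq_iff)
        then show ?thesis
          using subspace_EndD(3)[OF sub, of "f \<circ> r" "f \<circ> s"] rs f by simp
      qed
      with rs show "(\<lambda>p. r p + s p) \<in> ?B" by simp
    next
      fix c r assume r: "r \<in> ?B"
      have "f \<circ> (\<lambda>p. pscale c (r p)) \<in> ideal_p i" if f: "f \<in> ideal_p i" for f
      proof -
        have "f \<circ> (\<lambda>p. pscale c (r p)) = (\<lambda>p. pscale c ((f \<circ> r) p))"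
          using plinD(2)[OF subspace_EndD(1)[OF sub f]] by (simp add: fun_eq_iff)
        then show ?thesis
          using subspace_EndD(4)[OF sub, of "f \<circ> r" c] r f by simp
      qed
      with r show "(\<lambda>p. pscale c (r p)) \<in> ?B" by simp
    qed auto
    fix j :: 'n
    have "f \<circ> at_var j (opX ()) \<in> ideal_p i" if "f \<in> ideal_p i" for f :: "('n, 'k) pol_op"
      by (rule ideal_p_right[OF Jac_gens(1) F_right(1) that])
    moreover have "f \<circ> at_var j (opD ()) \<in> ideal_p i" if "f \<in> ideal_p i" for f :: "('n, 'k) pol_op"
      by (rule ideal_p_right[OF Jac_gens(2) F_right(2) that])
    moreover have "f \<circ> at_var j (opHinv () 0) \<in> ideal_p i" if "f \<in> ideal_p i" for f :: "('n, 'k) pol_op"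
      by (rule ideal_p_right[OF Jac_gens(3) F_right(3) that])
    ultimately show "opX j \<in> ?B" "opD j \<in> ?B" "opHinv j 0 \<in> ?B"
      unfolding at_var_opX at_var_opD at_var_opHinv by auto
  qed
  with assms show ?thesis by auto
qed

lemma ideal_p_Jac: "f \<in> ideal_p i \<Longrightarrow> f \<in> carrier Jac"
proof -
  assume f: "f \<in> ideal_p i"
  have "ideal_p i \<subseteq> carrier Jac"
  proof (rule ideal_p_minimal[OF Jac_subspace])
    fix a assume "a i \<in> ideal_F" "\<And>j. j \<noteq> i \<Longrightarrow> a j \<in> carrier Jac"
    then have "a j \<in> carrier Jac" for j
      using F_Jac by (cases "j = i") auto
    then show "tensor_op a \<in> carrier Jac"
      by (rule tensor_op_Jac)
  qed
  with f show ?thesis by auto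
qed

lemma at_var_power: "at_var i (opD () ^^ k) = opD i ^^ k"
proof (induction k)
  case 0
  show ?case unfolding funpow.simps by (rule at_var_id)
next
  case (Suc k)
  show ?case
    unfolding funpow.simps at_var_comp[OF plin_opD, symmetric] at_var_opD Suc.IH ..
qed

text \<open>A power of \<partial>_i acts in slot \<open>i\<close> alone, where it kills the entry
  from \<open>ideal_F\<close>; since \<open>I\<close> is a subspace, elementary tensors
  suffice.\<close>

lemma ideal_p_annihilated:
  fixes f :: "('n::finite, 'k::field_char_0) pol_op"
  assumes "f \<in> ideal_p i"
  shows "f \<in> ass_l Jac (range opD_pow)"
proof -
  interpret shift_frame "Jac :: ('k, ('n, 'k) pol_op) module" Delta "range opD_pow"
    by (rule shift_frame_Jac)
  have "ideal_p i \<subseteq> I"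
  proof (rule ideal_p_minimal)
    show "subspace_of End_alg I"
    proof (rule subspace_EndI)
      show "plin f" if "f \<in> I" for f using I_carrier[OF that] by simp
      show "(\<lambda>p. 0) \<in> I" using zero_I by simp
      show "(\<lambda>p. f p + g p) \<in> I" if "f \<in> I" "g \<in> I" for f g
        using I.a_closed[OF that] by simp
      show "(\<lambda>p. pscale c (f p)) \<in> I" if "f \<in> I" for c f
        using I_smult[OF that, of c] by simp
    qed
    fix a :: "'n \<Rightarrow> (unit, 'k) pol_op"
    assume a: "a i \<in> ideal_F" "\<And>j. j \<noteq> i \<Longrightarrow> a j \<in> carrier Jac"
    obtain k where k: "(opD () ^^ k) \<circ> a i = (\<lambda>p. 0)"
      using F_nilpotent[OF a(1)] by blast
    have "(opD i ^^ k) \<circ> tensor_op a = (\<lambda>p. 0)"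
      unfolding at_var_power[of i k, symmetric] by (subst at_var_tensor_op) (simp_all only: k tensor_op_zero plin_funpow plin_opD)
    moreover have "tensor_op a \<in> carrier Jac"
      using ideal_p_gen[where a = a and i = i, OF a] ideal_p_Jac by blast
    moreover have "(opD i ^^ k :: ('n, 'k) pol_op) \<in> range opD_pow"
      by (rule opD_power_in_range)
    ultimately show "tensor_op a \<in> I"
      unfolding I_iff Jac_simps by blast
  qed
  with assms show ?thesis by auto
qed

lemma ideal_aI: "(\<And>i. u i \<in> ideal_p i) \<Longrightarrow> (\<lambda>p. \<Sum>i\<in>UNIV. u i p) \<in> ideal_a"
  unfolding ideal_a_def by blast

lemma ideal_p_subset_a:
  fixes f :: "('n::finite, 'k::field_char_0) pol_op"
  assumes "f \<in> ideal_p i"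
  shows "f \<in> ideal_a"
proof -
  have "f = (\<lambda>p. \<Sum>j\<in>UNIV. ((\<lambda>j p. 0)(i := f)) j p)"
    by (rule ext) (simp add: if_distrib[where f = "\<lambda>g. g _"] cong: if_cong)
  moreover have "((\<lambda>j p. 0)(i := f)) j \<in> ideal_p j" for j
    using assms subspace_EndD(2)[OF ideal_p_subspace] by auto
  ultimately show ?thesis
    using ideal_aI by metis
qed

lemma ideal_a_add:
  assumes "f \<in> ideal_a" "g \<in> ideal_a"
  shows "(\<lambda>p. f p + g p) \<in> ideal_a"
proof -
  obtain u v where u: "f = (\<lambda>p. \<Sum>i\<in>UNIV. u i p)" "\<And>i. u i \<in> ideal_p i"
    and v: "g = (\<lambda>p. \<Sum>i\<in>UNIV. v i p)" "\<And>i. v i \<in> ideal_p i"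
    using assms unfolding ideal_a_def by blast
  have "(\<lambda>p. f p + g p) = (\<lambda>p. \<Sum>i\<in>UNIV. (\<lambda>p. u i p + v i p) p)"
    by (simp add: u v sum.distrib)
  moreover have "(\<lambda>p. u i p + v i p) \<in> ideal_p i" for i
    by (rule subspace_EndD(3)[OF ideal_p_subspace u(2) v(2)])
  ultimately show ?thesis
    using ideal_aI[of "\<lambda>i p. u i p + v i p"] by (simp only:)
qed

lemma ideal_a_left:
  fixes f :: "('n::finite, 'k::field_char_0) pol_op"
  assumes b: "b \<in> carrier Jac" "\<And>g. g \<in> ideal_F \<Longrightarrow> b \<circ> g \<in> ideal_F" and f: "f \<in> ideal_a"
  shows "at_var j b \<circ> f \<in> ideal_a"
proof -
  obtain u where u: "f = (\<lambda>p. \<Sum>i\<in>UNIV. u i p)" "\<And>i. u i \<in> ideal_p i"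
    using f unfolding ideal_a_def by blast
  have "at_var j b \<circ> f = (\<lambda>p. \<Sum>i\<in>UNIV. (at_var j b \<circ> u i) p)"
    by (simp add: u(1) fun_eq_iff plin_sum)
  moreover have "at_var j b \<circ> u i \<in> ideal_p i" for i
    by (rule ideal_p_left[OF b u(2)])
  ultimately show ?thesis
    using ideal_aI[of "\<lambda>i. at_var j b \<circ> u i"] by (simp only:)
qed

lemma ideal_a_cancel_opD:
  fixes r :: "('n::finite, 'k::field_char_0) pol_op"
  assumes r: "r \<in> carrier Jac" and dr: "opD i \<circ> r \<in> ideal_a"
  shows "r \<in> ideal_a"
proof -
  have "id = at_var i (\<lambda>p. (opX () \<circ> (opHinv () 0 \<circ> opD ())) p + unitE 0 0 p :: (unit, 'k) pol)"
    unfolding unit_decompose[symmetric] by (rule at_var_id[symmetric])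
  also have "\<dots> = (\<lambda>p. (at_var i (opX ()) \<circ> (at_var i (opHinv () 0) \<circ> opD i)) p + at_var i (unitE 0 0) p)"
    unfolding at_var_add
    by (simp only: at_var_comp plin_opX plin_opHinv at_var_opD[of i, symmetric])
  finally have e: "p = at_var i (opX ()) (at_var i (opHinv () 0) (opD i p)) + at_var i (unitE 0 0) p"
    for p :: "('n, 'k) pol"
    by (metis comp_apply id_apply)
  \<comment> \<open>The decomposition of the identity in slot \<open>i\<close> is inserted in front
    of \<open>r\<close>: the first summand contains \<open>opD i \<circ> r\<close>, and the second
    has a left factor in \<open>ideal_p i\<close>.\<close>
  have eq: "r = (\<lambda>p. (at_var i (opX ()) \<circ> (at_var i (opHinv () 0) \<circ> (opD i \<circ> r))) p + (at_var i (unitE 0 0) \<circ> r) p)"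
    unfolding comp_apply by (rule ext) (rule e)
  have 1: "at_var i (opX ()) \<circ> (at_var i (opHinv () 0) \<circ> (opD i \<circ> r)) \<in> ideal_a"
    by (intro ideal_a_left dr F_left Jac_gens)
  have "at_var i (unitE 0 0) \<in> (ideal_p i :: ('n, 'k) pol_op set)"
    unfolding at_var_def by (rule ideal_p_gen) (auto intro: unitE_F)
  then have 2: "at_var i (unitE 0 0) \<circ> r \<in> ideal_a"
    by (intro ideal_p_subset_a[of _ i] ideal_p_right_Jac r)
  show ?thesis
    by (subst eq) (rule ideal_a_add[OF 1 2])
qed

theorem ideal_a_eq_ass:
  "(ideal_a :: ('n::finite, 'k::field_char_0) pol_op set) = ass_l Jac (range opD_pow)"
proof
  interpret shift_frame "Jac :: ('k, ('n, 'k) pol_op) module" Delta "range opD_pow"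
    by (rule shift_frame_Jac)
  show "ideal_a \<subseteq> I"
  proof
    fix f :: "('n, 'k) pol_op" assume "f \<in> ideal_a"
    then obtain u where u: "f = (\<lambda>p. \<Sum>i\<in>UNIV. u i p)" "\<And>i. u i \<in> ideal_p i"
      unfolding ideal_a_def by blast
    have "(\<lambda>p. \<Sum>i\<in>J. u i p) \<in> I" if "finite J" for J
      using that
    proof (induction J rule: finite_induct)
      case empty
      then show ?case using zero_I by simp
    next
      case (insert i J)
      then show ?case
        using I.a_closed[OF ideal_p_annihilated[OF u(2)[of i]] insert.IH] by simp
    qed
    then show "f \<in> I" by (simp add: u(1))
  qed
  show "I \<subseteq> ideal_a"
  proof
    fix r assume "r \<in> I"
    then obtain \<alpha> where r: "r \<in> carrier Jac" "opD_pow \<alpha> \<circ> r = (\<lambda>p. 0)"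
      by (auto simp: I_iff)
    \<comment> \<open>Cancellability on the left modulo \<open>ideal_a\<close> is stable under
      composition, so it passes from the single \<partial>_i to \<partial>^\<alpha>. It applies
      because the zero operator lies in \<open>ideal_a\<close>.\<close>
    let ?P = "\<lambda>t :: ('n, 'k) pol_op. t \<in> carrier Jac \<and>
        (\<forall>r\<in>carrier Jac. t \<circ> r \<in> ideal_a \<longrightarrow> r \<in> (ideal_a :: ('n, 'k) pol_op set))"
    have "?P (opD_pow \<alpha>)"
    proof (rule opD_pow_induct[where P = ?P])
      show "f \<circ> g \<in> carrier Jac \<and> (\<forall>r\<in>carrier Jac. f \<circ> g \<circ> r \<in> ideal_a \<longrightarrow> r \<in> ideal_a)"
        if f: "f \<in> carrier Jac \<and> (\<forall>r\<in>carrier Jac. f \<circ> r \<in> ideal_a \<longrightarrow> r \<in> ideal_a)"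
          and g: "g \<in> carrier Jac \<and> (\<forall>r\<in>carrier Jac. g \<circ> r \<in> ideal_a \<longrightarrow> r \<in> ideal_a)"
        for f g :: "('n, 'k) pol_op"
        unfolding comp_assoc using f g Jac_closed(3) by blast
    qed (use ideal_a_cancel_opD in auto)
    moreover have "(\<lambda>p. 0) \<in> (ideal_a :: ('n, 'k) pol_op set)"
      by (rule ideal_p_subset_a[OF subspace_EndD(2)[OF ideal_p_subspace]])
    ultimately show "r \<in> ideal_a"
      using r by simp
  qed
qed

theorem theorem5p1:
  fixes A :: "('k::field_char_0, ('n::finite, 'k) pol_op) module"
    and Abar :: "('k, ('n, 'k) pol_op set) module"
    and I :: "('n, 'k) pol_op set"
    and D D' Dt D'' :: "('n, 'k) pol_op set"
    and S :: "('n, 'k) pol_op set"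
    and \<pi> :: "('n, 'k) pol_op \<Rightarrow> ('n, 'k) pol_op set"
  defines "A \<equiv> Jac" and "I \<equiv> ideal_a" and "Abar \<equiv> Jac_bar" and "\<pi> \<equiv> proj_a"
    and "S \<equiv> prime_S A"
    and "D \<equiv> Delta" and "D' \<equiv> prime_Delta" and "Dt \<equiv> tilde_Delta" and "D'' \<equiv> dprime_Delta"
  shows
    "\<comment> \<open>1\<close>
     (D' \<in> Den_l A I \<and> localization A D' \<simeq>\<^sub>K prime_Q A \<and>
      multiplicative A (left_regular A \<inter> D) \<and>
      left_denominator A D' \<and> largest_left_den_in A (left_regular A \<inter> D) D') \<and>
     \<comment> \<open>2\<close>
     (D' <+>\<^bsub>A\<^esub> I \<in> Den_l A I \<and> S <+>\<^bsub>A\<^esub> I \<in> Den_l A I \<and>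
      localization A (D' <+>\<^bsub>A\<^esub> I) \<simeq>\<^sub>K localization A (S <+>\<^bsub>A\<^esub> I) \<and>
      localization A (S <+>\<^bsub>A\<^esub> I) \<simeq>\<^sub>K prime_Q A) \<and>
     \<comment> \<open>3\<close>
     (bij_betw \<pi> D' (\<pi> ` D') \<and>
      \<pi> ` D' \<in> Den_l Abar {\<zero>\<^bsub>Abar\<^esub>} \<and>
      \<pi> ` (D' <+>\<^bsub>A\<^esub> I) \<in> Den_l Abar {\<zero>\<^bsub>Abar\<^esub>} \<and>
      \<pi> ` (S <+>\<^bsub>A\<^esub> I) \<in> Den_l Abar {\<zero>\<^bsub>Abar\<^esub>} \<and>
      localization Abar (\<pi> ` D') \<simeq>\<^sub>K localization Abar (\<pi> ` (D' <+>\<^bsub>A\<^esub> I)) \<and>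
      localization Abar (\<pi> ` (D' <+>\<^bsub>A\<^esub> I)) \<simeq>\<^sub>K localization Abar (\<pi> ` (S <+>\<^bsub>A\<^esub> I)) \<and>
      localization Abar (\<pi> ` (S <+>\<^bsub>A\<^esub> I)) \<simeq>\<^sub>K prime_Q A) \<and>
     \<comment> \<open>4\<close>
     (Dt \<in> Den_l A I \<and> localization A Dt \<simeq>\<^sub>K prime_Q A \<and>
      \<pi> ` Dt \<in> Den_l Abar {\<zero>\<^bsub>Abar\<^esub>} \<and> localization Abar (\<pi> ` Dt) \<simeq>\<^sub>K prime_Q A) \<and>
     \<comment> \<open>5\<close>
     (Dt <+>\<^bsub>A\<^esub> I \<in> Den_l A I \<and> localization A (Dt <+>\<^bsub>A\<^esub> I) \<simeq>\<^sub>K prime_Q A) \<and>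
     \<comment> \<open>6\<close>
     (D' \<in> Den_l (A\<lparr>carrier := D\<rparr>) {\<zero>\<^bsub>A\<^esub>} \<and>
      localization (A\<lparr>carrier := D\<rparr>) D' \<simeq>\<^sub>K prime_Q A) \<and>
     \<comment> \<open>7\<close>
     (D'' \<in> Den_l A I \<and> D' \<subseteq> D'' \<and> localization A D'' \<simeq>\<^sub>K prime_Q A)"
proof -
  interpret shift_frame A D "range opD_pow"
    unfolding A_def D_def by (rule shift_frame_Jac)
  have I: "ass_l A (range opD_pow) = I"
    unfolding A_def I_def by (rule ideal_a_eq_ass[symmetric])
  have D': "D' = D \<inter> prime_S A"
    unfolding D'_def prime_Delta_def D_def A_def ..
  have Dt: "Dt = D \<inter> sat"
    using D_carrier unfolding sat_def unfolding Dt_def tilde_Delta_def D_def A_def by auto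
  have D'': "D'' = (prime_S A \<inter> (left_regular (A\<lparr>carrier := D <+>\<^bsub>A\<^esub> I\<rparr>) <+>\<^bsub>A\<^esub> I)) <+>\<^bsub>A\<^esub> I"
    unfolding D''_def dprime_Delta_def D_def A_def I_def ..
  have B: "Abar = quot_algebra A I"
    unfolding Abar_def Jac_bar_def A_def I_def ..
  have \<pi>: "\<pi> = (+>\<^bsub>A\<^esub>) I"
    unfolding \<pi>_def A_def I_def proj_a_def ..
  have Q: "prime_Q A = localization A (prime_S A)"
    by (simp add: prime_Q_def)
  \<comment> \<open>Every denominator set of \<open>A\<close> in the theorem is one of these
    admissible sets, and those of the factor algebra are images of such sets. Rewriting with
    \<open>I\<close> replaces the annihilated ideal of the frame by \<open>ideal_a\<close>.\<close>
  note ad = admissible_D' admissible_add_I[OF admissible_D', unfolded I]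
    admissible_S admissible_add_I[OF admissible_S, unfolded I]
    admissible_tilde admissible_add_I[OF admissible_tilde, unfolded I] admissible_dprime[unfolded I]
  have sub: "D \<inter> prime_S A \<subseteq> X" if "admissible X" for X
    using that by (simp add: admissible_def)
  show ?thesis
    unfolding D' Dt D'' B \<pi> Q S_def
    by (intro conjI inj_on_imp_bij_betw inj_on_subset[OF pi_inj_D[unfolded I]] Int_lower1
        admissible_Den_l[unfolded I] admissible_den(1) admissible_quot_Den_l[unfolded I]
        localization_admissible2 localization_quot2[unfolded I] localization_quot3[unfolded I]
        multiplicative_regular_D largest_D' D'_Den_l_D localization_D sub ad)
qed

end
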